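(* Let $q>4$ be a power of $2$, let $n=q^2+q+1$, let $a\in\left\{-1,0,\dots,\left\lceil \frac{1+\sqrt{4q+9}}{2}\right\rceil-1\right\}$ and let $m_a=n+q-a$. Then \[\psi(m_a)=(m_a-a)q.\]
   Context: A vertex-colouring of a graph $G$ (not necessarily proper) is complete if for every pair of distinct colours used there are two adjacent vertices of $G$ carrying these two colours. The pseudoachromatic number $\psi(G)$ is the maximum number of colours in a complete vertex-colouring of $G$. For a positive integer $m$, $\psi(m):=\psi(L(K_m))$, where $L(K_m)$ is the line graph of the complete graph $K_m$. Equivalently, $\psi(m)$ is the maximum number of colours in an edge-colouring of $K_m$ (not necessarily proper) such that for every pair of distinct colours used there is a vertex of $K_m$ incident with edges of both colours. *)

theory Defs
  imports Complex_Main "HOL-Library.Ramsey"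
begin

text \<open>A simple graph is a pair of a vertex set and a set of two-element sets of vertices.\<close>

type_synonym 'a graph = "'a set \<times> 'a set set"

definition complete_graph :: "nat \<Rightarrow> nat graph" where
  "complete_graph m = ({..<m}, nsets {..<m} 2)"

definition line_graph :: "'a graph \<Rightarrow> 'a set graph" where
  "line_graph G = (snd G, {{e, f} | e f. e \<in> snd G \<and> f \<in> snd G \<and> e \<noteq> f \<and> e \<inter> f \<noteq> {}})"

text \<open>The colours used are those in \<open>c ` fst G\<close>; the colouring need not be proper.\<close>

definition complete_colouring :: "'a graph \<Rightarrow> ('a \<Rightarrow> 'c) \<Rightarrow> bool" where
  "complete_colouring G c \<longleftrightarrow>
     (\<forall>i \<in> c ` fst G. \<forall>j \<in> c ` fst G. i \<noteq> j \<longrightarrow>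
        (\<exists>u \<in> fst G. \<exists>v \<in> fst G. {u, v} \<in> snd G \<and> c u = i \<and> c v = j))"

text \<open>
  For finite graphs, natural numbers suffice as colours, and the maximum is over a finite
  nonempty set, as the two lemmas after it show.
\<close>

definition pseudoachromatic :: "'a graph \<Rightarrow> nat" where
  "pseudoachromatic G = Max {card (c ` fst G) | c :: 'a \<Rightarrow> nat. complete_colouring G c}"

lemma pseudoachromatic_attained:
  assumes "finite (fst G)"
  shows "\<exists>c :: 'a \<Rightarrow> nat. complete_colouring (G :: 'a graph) c \<and> card (c ` fst G) = pseudoachromatic G"
proof -
  let ?S = "{card (c ` fst G) | c :: 'a \<Rightarrow> nat. complete_colouring G c}"
  have "?S \<subseteq> {..card (fst G)}"
    using assms by (auto intro: card_image_le)
  then have "finite ?S"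
    by (rule finite_subset) simp
  moreover have "complete_colouring G (\<lambda>_. 0 :: nat)"
    by (auto simp: complete_colouring_def)
  then have "?S \<noteq> {}"
    by blast
  ultimately have "Max ?S \<in> ?S"
    by (rule Max_in)
  then show ?thesis
    by (auto simp: pseudoachromatic_def)
qed

lemma complete_colouring_le_pseudoachromatic:
  fixes c :: "'a \<Rightarrow> 'c"
  assumes fin: "finite (fst G)" and c: "complete_colouring G c"
  shows "card (c ` fst G) \<le> pseudoachromatic G"
proof -
  let ?S = "{card (c ` fst G) | c :: 'a \<Rightarrow> nat. complete_colouring G c}"
  have "?S \<subseteq> {..card (fst G)}"
    using fin by (auto intro: card_image_le)
  then have S: "finite ?S"
    by (rule finite_subset) simp
  from fin obtain h :: "'c \<Rightarrow> nat" where h: "inj_on h (c ` fst G)"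
    using finite_imp_inj_to_nat_seg[of "c ` fst G"] by blast
  have "complete_colouring G (h \<circ> c)"
    unfolding complete_colouring_def
  proof (intro ballI impI)
    fix i j assume "i \<in> (h \<circ> c) ` fst G" "j \<in> (h \<circ> c) ` fst G" "i \<noteq> j"
    then obtain x y where xy: "x \<in> fst G" "y \<in> fst G" "i = h (c x)" "j = h (c y)"
      by auto
    with \<open>i \<noteq> j\<close> have "c x \<noteq> c y"
      by auto
    with xy obtain u v where "u \<in> fst G" "v \<in> fst G" "{u, v} \<in> snd G" "c u = c x" "c v = c y"
      using c unfolding complete_colouring_def by (meson imageI)
    with xy show "\<exists>u \<in> fst G. \<exists>v \<in> fst G. {u, v} \<in> snd G \<and> (h \<circ> c) u = i \<and> (h \<circ> c) v = j"
      by (intro bexI[of _ u] bexI[of _ v]) auto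
  qed
  moreover have "card ((h \<circ> c) ` fst G) = card (c ` fst G)"
    using card_image[OF h] by (simp add: image_comp)
  ultimately have "card (c ` fst G) \<in> ?S"
    by force
  with S show ?thesis
    unfolding pseudoachromatic_def by (rule Max_ge)
qed

definition psi :: "nat \<Rightarrow> nat" where
  "psi m = pseudoachromatic (line_graph (complete_graph m))"

end

theory Submission
  imports Defs "HOL-Library.Z2" "HOL-Number_Theory.Cong" "HOL-Algebra.Algebraic_Closure_Type"
begin

text \<open>
  Write \<open>h = q / 2\<close>; in all cases \<open>m = (q + 1)\<^sup>2 - a\<close>.

  Upper bound. If all colour classes have at least \<open>h + 1\<close> edges, then counting edges gives
  \<open>(q + 2) * psi m \<le> m * (m - 1) = (q + 2) * q * (m - a) + a * (a - 1)\<close>, and the range of \<open>a\<close> says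
  precisely that \<open>a * (a - 1) < q + 2\<close>. Otherwise some class has at most \<open>h\<close> edges. Every other
  colour occurs on an edge that meets one of its at most \<open>q\<close> endpoints, and there are too few such
  edges for more than \<open>q * (m - a)\<close> colours (\<open>psi_upper\<close>).

  Lower bound. For equality almost all classes must have exactly \<open>h + 1\<close> edges, although any two of
  them share a vertex. Such classes live on the lines of a projective plane of order \<open>q\<close>, which
  pairwise meet; the plane has \<open>n\<close> points, and the remaining \<open>q - a\<close> vertices are called outer. A line
  has an odd number \<open>q + 1\<close> of points, so its edges split into \<open>q + 1\<close> near-perfect matchings, one
  missing each point. An edge from the missed point to an outer vertex completes such a matching
  to a class that covers the line.

  If \<open>a = -1\<close>, every point has an outer edge for each of its \<open>q + 1\<close> lines. The edges between the
  outer vertices provide \<open>q - 1\<close> further classes that cover all outer vertices and therefore meet all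
  other classes (\<open>psi_lower_minus\<close>).

  If \<open>a \<ge> 0\<close>, each point has outer edges for only \<open>q - a\<close> of its lines. Fix a line \<open>M\<close> and a set \<open>P\<close> of
  \<open>a + 1\<close> of its points. Lines that miss \<open>P\<close> are served by outer edges as before; a point off \<open>M\<close> lies
  on exactly \<open>q - a\<close> of them. A line through a point \<open>p\<close> of \<open>P\<close> carries \<open>q - 1\<close> perfect matchings of its
  other \<open>q\<close> points, and any edge at \<open>p\<close> completes one of them to a class. The line \<open>M\<close> and the outer
  vertices together with \<open>P\<close> are treated in the same way, with centre \<open>p0\<close> in \<open>P\<close>. All these classes meet:
  those on lines because lines do, and those on the outer vertices and \<open>P\<close> because every other class
  contains an outer vertex or a point of \<open>P\<close>.

  A point of \<open>M - P\<close> lies on \<open>q\<close> lines that miss \<open>P\<close>, hence on \<open>a\<close> of them the matching that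
  misses it has to be given up. The edges of these matchings are not lost: \<open>h\<close> additional
  edges at suitable points turn the \<open>q - 1\<close> classes of a line through \<open>P\<close> into \<open>q\<close> classes
  (\<open>upgraded_factorization\<close>, \<open>coned_factorization\<close>). The locale \<open>pencil_scheme\<close> collects what a
  distribution of the spare edges has to satisfy, \<open>complete_labels\<close> and \<open>card_labels\<close> show that it
  yields the required number of classes, and \<open>psi_lower_0\<close> and \<open>psi_lower_pos\<close> construct
  distributions for \<open>a = 0\<close> and \<open>a \<ge> 1\<close>.
\<close>

section \<open>The upper bound\<close>

lemma psi_colouring:
  fixes m :: nat
  obtains c :: "nat set \<Rightarrow> nat" where
    "card (c ` nsets {..<m} 2) = psi m"
    "\<And>i j. i \<in> c ` nsets {..<m} 2 \<Longrightarrow> j \<in> c ` nsets {..<m} 2 \<Longrightarrow> i \<noteq> j \<Longrightarrow>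
      \<exists>e \<in> nsets {..<m} 2. \<exists>f \<in> nsets {..<m} 2. c e = i \<and> c f = j \<and> e \<inter> f \<noteq> {}"
proof -
  let ?G = "line_graph (complete_graph m)"
  have fst: "fst ?G = nsets {..<m} 2"
    by (simp add: line_graph_def complete_graph_def)
  have snd: "snd ?G = {{e, f} | e f. e \<in> nsets {..<m} 2 \<and> f \<in> nsets {..<m} 2 \<and> e \<noteq> f \<and> e \<inter> f \<noteq> {}}"
    by (simp add: line_graph_def complete_graph_def)
  obtain c :: "nat set \<Rightarrow> nat" where c: "complete_colouring ?G c" "card (c ` fst ?G) = pseudoachromatic ?G"
    using pseudoachromatic_attained[of ?G] by (auto simp: fst finite_imp_finite_nsets)
  show thesis
  proof (rule that[of c])
    show "card (c ` nsets {..<m} 2) = psi m"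
      using c(2) by (simp add: fst psi_def)
    fix i j assume "i \<in> c ` nsets {..<m} 2" "j \<in> c ` nsets {..<m} 2" "i \<noteq> j"
    then obtain e f where ef: "e \<in> nsets {..<m} 2" "f \<in> nsets {..<m} 2" "{e, f} \<in> snd ?G" "c e = i" "c f = j"
      using c(1) unfolding complete_colouring_def fst by blast
    moreover have "e \<inter> f \<noteq> {}"
      using ef(3) unfolding snd by (auto simp: doubleton_eq_iff)
    ultimately show "\<exists>e \<in> nsets {..<m} 2. \<exists>f \<in> nsets {..<m} 2. c e = i \<and> c f = j \<and> e \<inter> f \<noteq> {}"
      by blast
  qed
qed

lemma card_nsets_2: "finite A \<Longrightarrow> 2 * card (nsets A 2) = card A * (card A - 1)"
proof -
  assume A: "finite A"
  have "nsets A 2 = {B. B \<subseteq> A \<and> card B = 2}"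
    using A by (auto simp: nsets_def intro: finite_subset)
  then have "card (nsets A 2) = card A choose 2"
    using A by (simp add: n_subsets)
  then show ?thesis
    using even_mult_iff[of "card A" "card A - 1"] by (cases "card A") (auto simp: choose_two)
qed

lemma edges_meeting:
  assumes "W \<subseteq> {..<m}"
  shows "2 * card {e \<in> nsets {..<m} 2. e \<inter> W \<noteq> {}} + (m - card W) * (m - card W - 1) = m * (m - 1)"
proof -
  have *: "nsets {..<m} 2 = {e \<in> nsets {..<m} 2. e \<inter> W \<noteq> {}} \<union> nsets ({..<m} - W) 2"
    by (auto simp: nsets_def)
  have "card (nsets {..<m} 2) = card {e \<in> nsets {..<m} 2. e \<inter> W \<noteq> {}} + card (nsets ({..<m} - W) 2)"
    by (subst *, rule card_Un_disjoint) (auto simp: nsets_def finite_subset)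
  moreover have "card ({..<m} - W) = m - card W"
    using assms by (simp add: card_Diff_subset finite_subset)
  ultimately show ?thesis
    using card_nsets_2[of "{..<m}"] card_nsets_2[of "{..<m} - W"] by simp
qed

text \<open>
  Every other colour occurs on an edge that meets an endpoint of the small class, so the number of
  those edges bounds the number of colours. The worst case is a class of \<open>h\<close> disjoint edges.
\<close>

lemma psi_le_small_class:
  assumes c: "\<And>i j. i \<in> c ` nsets {..<m} 2 \<Longrightarrow> j \<in> c ` nsets {..<m} 2 \<Longrightarrow> i \<noteq> j \<Longrightarrow>
      \<exists>e \<in> nsets {..<m} 2. \<exists>f \<in> nsets {..<m} 2. c e = i \<and> c f = j \<and> e \<inter> f \<noteq> {}"
    and i: "i \<in> c ` nsets {..<m} 2"
    and s: "card {e \<in> nsets {..<m} 2. c e = i} \<le> h" and m: "2 * h < m"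
  shows "card (c ` nsets {..<m} 2) \<le> 2 * h * (m - h - 1) + 1"
proof -
  let ?E = "nsets {..<m} 2"
  define D where "D = {e \<in> ?E. c e = i}"
  define W where "W = \<Union>D"
  define t where "t = card W"
  have finE: "finite ?E" by (simp add: finite_imp_finite_nsets)
  then have finD: "finite D" by (simp add: D_def)
  have W: "W \<subseteq> {..<m}" by (auto simp: W_def D_def nsets_def)
  have t: "t \<le> 2 * card D"
  proof -
    have "t \<le> (\<Sum>e\<in>D. card e)" unfolding t_def W_def by (rule card_Union_le_sum_card)
    also have "\<dots> = (\<Sum>e\<in>D. 2)" by (rule sum.cong) (auto simp: D_def nsets_def)
    finally show ?thesis by simp
  qed
  define R where "R = {e \<in> ?E. e \<inter> W \<noteq> {}}"
  have DR: "D \<subseteq> R"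
  proof
    fix e assume e: "e \<in> D"
    then have "e \<noteq> {}" by (auto simp: D_def nsets_def)
    with e show "e \<in> R" by (auto simp: D_def R_def W_def)
  qed
  have "c ` ?E - {i} \<subseteq> c ` (R - D)"
  proof
    fix j assume j: "j \<in> c ` ?E - {i}"
    then obtain e f where "e \<in> ?E" "f \<in> ?E" "c e = i" "c f = j" "e \<inter> f \<noteq> {}"
      using c[OF i, of j] by auto
    then show "j \<in> c ` (R - D)"
      using j by (auto simp: R_def D_def W_def intro!: image_eqI[of _ _ f])
  qed
  then have "card (c ` ?E - {i}) \<le> card (R - D)"
    using finE by (intro order_trans[OF card_mono card_image_le]) (auto simp: R_def)
  moreover have "card (c ` ?E - {i}) = card (c ` ?E) - 1"
    using i by (simp add: card_Diff_singleton)
  moreover have "card (R - D) = card R - card D"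
    using DR finD by (simp add: card_Diff_subset)
  moreover have "card D \<le> card R"
    using DR finE by (simp add: card_mono R_def)
  ultimately have K: "card (c ` ?E) + card D \<le> card R + 1"
    by linarith
  have R: "2 * card R + (m - t) * (m - t - 1) = m * (m - 1)"
    using edges_meeting[OF W] by (simp add: R_def t_def)
  define s where "s = card D"
  have sh: "s \<le> h" "t \<le> 2 * s" using s t by (simp_all add: s_def D_def)
  have "2 * (card R) \<le> 2 * (s * (2 * m - 2 * s - 1))"
  proof -
    have "m - 2 * s \<le> m - t" using sh by simp
    then have "(m - 2 * s) * (m - 2 * s - 1) \<le> (m - t) * (m - t - 1)"
      by (intro mult_mono) auto
    then have "2 * card R + (m - 2 * s) * (m - 2 * s - 1) \<le> m * (m - 1)"
      using R by linarith
    moreover obtain d where d: "m = 2 * s + d + 1" 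
      using sh m less_imp_Suc_add[of "2 * s" m] by auto
    ultimately show ?thesis unfolding d by (simp add: algebra_simps)
  qed
  then have 1: "card (c ` ?E) + s \<le> s * (2 * m - 2 * s - 1) + 1"
    using K by (simp add: s_def)
  have 2: "s * (2 * m - 2 * s - 1) = 2 * (s * (m - s - 1)) + s"
  proof -
    obtain d where d: "m = s + d + 1"
      using sh m less_imp_Suc_add[of s m] by auto
    show ?thesis unfolding d by (simp add: algebra_simps)
  qed
  have 3: "s * (m - s - 1) \<le> h * (m - h - 1)"
  proof -
    obtain u where u: "h = s + u" using sh by (metis le_iff_add)
    obtain d where d: "m = 2 * h + d + 1" using m less_imp_Suc_add[of "2 * h" m] by auto
    show ?thesis unfolding d u by (simp add: algebra_simps)
  qed
  have "card (c ` ?E) + s \<le> (2 * (h * (m - h - 1)) + 1) + s"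
    using 1 3 unfolding 2 by simp
  then show ?thesis by (simp only: add_le_cancel_right mult.assoc)
qed

text \<open>
  Either all classes have more than \<open>h\<close> edges, and the total number of edges limits their number,
  or the preceding lemma applies.
\<close>

lemma psi_upper:
  fixes a :: int and h m q :: nat
  assumes q: "q = 2 * h" and h: "h > 0" and m: "int m = (int q + 1)\<^sup>2 - a"
    and a1: "a * (a - 1) < int q + 2" and a2: "a \<le> int h"
  shows "int (psi m) \<le> (int m - a) * int q"
proof -
  let ?E = "nsets {..<m} 2"
  show ?thesis
  proof (rule psi_colouring[of m])
    fix c :: "nat set \<Rightarrow> nat"
    assume c: "card (c ` ?E) = psi m"
    "\<And>i j. i \<in> c ` ?E \<Longrightarrow> j \<in> c ` ?E \<Longrightarrow> i \<noteq> j \<Longrightarrow>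
      \<exists>e \<in> ?E. \<exists>f \<in> ?E. c e = i \<and> c f = j \<and> e \<inter> f \<noteq> {}"
    have finE: "finite ?E" by (simp add: finite_imp_finite_nsets)
    have m': "int m = 4 * int h * int h + 4 * int h + 1 - a"
      using m q by (simp add: power2_eq_square algebra_simps)
    have hh: "0 \<le> int h * int h" by simp
    have "int (2 * h) < int m"
    proof -
      have "2 * int h < 4 * t + 4 * int h + 1 - a" if "0 \<le> t" for t
        using that a2 by linarith
      from this[OF hh] show ?thesis by (simp add: m' mult.assoc)
    qed
    then have m0: "2 * h < m"
      by (simp only: of_nat_less_iff)
    show ?thesis
    proof (cases "\<exists>i \<in> c ` ?E. card {e \<in> ?E. c e = i} \<le> h")
      case True
      then obtain i where i: "i \<in> c ` ?E" "card {e \<in> ?E. c e = i} \<le> h" by blast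
      have *: "psi m \<le> 2 * h * (m - h - 1) + 1"
        using psi_le_small_class[OF c(2) i m0] unfolding c(1) .
      obtain d where d: "m = Suc (2 * h + d)" using m0 less_imp_Suc_add by blast
      have "int (psi m) \<le> 2 * int h * (int m - int h - 1) + 1"
        using of_nat_mono[OF *, where ?'a = int] by (simp add: d algebra_simps)
      also have "\<dots> \<le> (int m - a) * int q"
      proof -
        have "1 * 1 \<le> int h * (int h + 1 - a)" using a2 h by (intro mult_mono) auto
        then show ?thesis by (simp add: q algebra_simps)
      qed
      finally show ?thesis .
    next
      case False
      have "psi m * (h + 1) = (\<Sum>i\<in>c ` ?E. h + 1)" by (simp add: c(1))
      also have "\<dots> \<le> (\<Sum>i\<in>c ` ?E. card {e \<in> ?E. c e = i})"
        using False by (intro sum_mono) (auto simp: not_le)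
      also have "\<dots> = card ?E"
        using sum.image_gen[OF finE, of "\<lambda>_. 1 :: nat" c] by simp
      finally have "2 * (psi m * (h + 1)) \<le> m * (m - 1)"
        using card_nsets_2[of "{..<m}"] by simp
      then have "int (2 * (psi m * (h + 1))) \<le> int (m * (m - 1))" by (rule of_nat_mono)
      then have "int (psi m) * (int q + 2) \<le> int m * (int m - 1)"
        using m0 by (simp add: q of_nat_diff algebra_simps)
      also have "int m * (int m - 1) = (int q + 2) * (int q * (int m - a)) + a * (a - 1)"
        unfolding m by (simp add: power2_eq_square algebra_simps)
      finally have "int (psi m) * (int q + 2) < (int q + 2) * (int q * (int m - a)) + (int q + 2)"
        using a1 by linarith
      then have "(int q + 2) * int (psi m) < (int q + 2) * (int q * (int m - a) + 1)"
        by (simp add: algebra_simps)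
      then have "int (psi m) < int q * (int m - a) + 1"
        by (simp add: mult_less_cancel_left)
      then show ?thesis by (simp add: mult.commute)
    qed
  qed
qed

section \<open>From labelled edges to complete colourings\<close>

text \<open>
  The constructions below label only some of the edges. As an edge carries at most one label,
  the classes of different labels are disjoint by construction.
\<close>

definition touches :: "('v set \<Rightarrow> 'l option) \<Rightarrow> 'v set \<Rightarrow> 'l \<Rightarrow> 'v \<Rightarrow> bool" where
  "touches cl V t v \<longleftrightarrow> v \<in> V \<and> (\<exists>u \<in> V. u \<noteq> v \<and> cl {v, u} = Some t)"

text \<open>
  Unlabelled edges may receive any label. Two different labels that touch a common vertex \<open>v\<close> sit
  on two different edges at \<open>v\<close>, and these are adjacent in the line graph.
\<close>

lemma card_le_psi_of_meeting_labels:
  fixes cl :: "'v set \<Rightarrow> 'l option"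
  assumes V: "finite V"
    and meet: "\<And>t t'. t \<in> T \<Longrightarrow> t' \<in> T \<Longrightarrow> \<exists>v. touches cl V t v \<and> touches cl V t' v"
  shows "card T \<le> psi (card V)"
proof (cases "T = {}")
  case False
  then obtain t0 where t0: "t0 \<in> T" by blast
  let ?m = "card V"
  let ?E = "nsets {..<?m} 2"
  let ?G = "line_graph (complete_graph ?m)"
  have fst: "fst ?G = ?E"
    by (simp add: line_graph_def complete_graph_def)
  have snd: "snd ?G = {{e, f} | e f. e \<in> ?E \<and> f \<in> ?E \<and> e \<noteq> f \<and> e \<inter> f \<noteq> {}}"
    by (simp add: line_graph_def complete_graph_def)
  obtain b where b: "bij_betw b V {..<?m}"
    using V by (metis ex_bij_betw_finite_nat atLeast0LessThan)
  define g where "g = inv_into V b"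
  have g: "g (b v) = v" if "v \<in> V" for v
    using that b by (simp add: g_def bij_betw_def)
  define c where "c e = (case cl (g ` e) of Some t \<Rightarrow> if t \<in> T then t else t0 | None \<Rightarrow> t0)" for e
  have cT: "c e \<in> T" for e
    using t0 by (auto simp: c_def split: option.split)
  have edge: "{b v, b u} \<in> ?E \<and> c {b v, b u} = t"
    if "v \<in> V" "u \<in> V" "u \<noteq> v" "cl {v, u} = Some t" "t \<in> T" for v u t
    using that b by (auto simp: c_def g bij_betw_def inj_on_def)
  have img: "c ` ?E = T"
  proof
    show "T \<subseteq> c ` ?E"
    proof
      fix t assume t: "t \<in> T"
      then obtain v u where "v \<in> V" "u \<in> V" "u \<noteq> v" "cl {v, u} = Some t"
        using meet[OF t t] by (auto simp: touches_def)
      with edge t show "t \<in> c ` ?E" by (metis image_eqI)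
    qed
  qed (use cT in auto)
  have "complete_colouring ?G c"
    unfolding complete_colouring_def fst img
  proof (intro ballI impI)
    fix i j assume ij: "i \<in> T" "j \<in> T" "i \<noteq> j"
    then obtain v u w where v: "v \<in> V" "u \<in> V" "u \<noteq> v" "cl {v, u} = Some i"
      "w \<in> V" "w \<noteq> v" "cl {v, w} = Some j"
      using meet[OF ij(1,2)] by (auto simp: touches_def)
    let ?e = "{b v, b u}" and ?f = "{b v, b w}"
    have e: "?e \<in> ?E" "c ?e = i" using edge[OF v(1-4) ij(1)] by auto
    have f: "?f \<in> ?E" "c ?f = j" using edge[OF v(1,5-7) ij(2)] by auto
    have "?e \<noteq> ?f" using e(2) f(2) ij(3) by metis
    moreover have "?e \<inter> ?f \<noteq> {}" by simp
    ultimately have "{?e, ?f} \<in> snd ?G" unfolding snd using e(1) f(1) by blast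
    with e f show "\<exists>e \<in> ?E. \<exists>f \<in> ?E. {e, f} \<in> snd ?G \<and> c e = i \<and> c f = j" by metis
  qed
  then have "card (c ` fst ?G) \<le> pseudoachromatic ?G"
    by (intro complete_colouring_le_pseudoachromatic) (simp_all add: fst finite_imp_finite_nsets)
  then show ?thesis by (simp add: fst img psi_def)
qed simp

text \<open>
  This lemma reduces large parts of the construction to counting: if the labels that still
  need an edge in some place are no more than the unlabelled edges reserved for that place, then
  an injection assigns them, and disjoint reserves keep the places independent.
\<close>

lemma extend_by_tokens:
  fixes cl :: "'v set \<Rightarrow> 'l option" and demand :: "'j \<Rightarrow> 'l set" and offer :: "'j \<Rightarrow> 'v set set"
  assumes fin: "\<And>j. j \<in> J \<Longrightarrow> finite (demand j) \<and> finite (offer j)"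
    and card: "\<And>j. j \<in> J \<Longrightarrow> card (demand j) \<le> card (offer j)"
    and free: "\<And>j e. j \<in> J \<Longrightarrow> e \<in> offer j \<Longrightarrow> cl e = None"
    and disj: "\<And>j j'. j \<in> J \<Longrightarrow> j' \<in> J \<Longrightarrow> j \<noteq> j' \<Longrightarrow> offer j \<inter> offer j' = {}"
  obtains cl' where "\<And>e t. cl e = Some t \<Longrightarrow> cl' e = Some t"
    "\<And>j t. j \<in> J \<Longrightarrow> t \<in> demand j \<Longrightarrow> \<exists>e \<in> offer j. cl' e = Some t"
proof -
  have "\<forall>j. \<exists>\<phi>. j \<in> J \<longrightarrow> \<phi> ` demand j \<subseteq> offer j \<and> inj_on \<phi> (demand j)"
    using fin card by (meson card_le_inj)
  then obtain \<phi> where \<phi>: "\<And>j. j \<in> J \<Longrightarrow> \<phi> j ` demand j \<subseteq> offer j" "\<And>j. j \<in> J \<Longrightarrow> inj_on (\<phi> j) (demand j)"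
    by metis
  define pick where "pick e = (SOME t. \<exists>j \<in> J. t \<in> demand j \<and> \<phi> j t = e)" for e
  have pick: "pick (\<phi> j t) = t" if "j \<in> J" "t \<in> demand j" for j t
    unfolding pick_def
  proof (rule some_equality)
    fix t' assume "\<exists>j' \<in> J. t' \<in> demand j' \<and> \<phi> j' t' = \<phi> j t"
    then obtain j' where j': "j' \<in> J" "t' \<in> demand j'" "\<phi> j' t' = \<phi> j t" by blast
    then have "\<phi> j t \<in> offer j'" "\<phi> j t \<in> offer j" using \<phi>(1) that by (metis image_subset_iff)+
    then have "j' = j" using disj j' that by blast
    then show "t' = t" using \<phi>(2) j' that by (metis inj_onD)
  qed (use that in blast)
  show thesis
  proof (rule that)
    let ?cl' = "\<lambda>e. if cl e = None then Some (pick e) else cl e"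
    show "?cl' e = Some t" if "cl e = Some t" for e t using that by simp
    show "\<exists>e \<in> offer j. ?cl' e = Some t" if "j \<in> J" "t \<in> demand j" for j t
    proof -
      have "\<phi> j t \<in> offer j" using \<phi>(1) that by blast
      then show ?thesis using free[of j] pick that by (intro bexI[of _ "\<phi> j t"]) auto
    qed
  qed
qed

section \<open>Factorizations of complete graphs\<close>

text \<open>
  Number the vertices by the residues modulo \<open>r\<close> and colour an edge with half the sum of its
  endpoints, which exists as \<open>r\<close> is odd. Colour \<open>v\<close> pairs \<open>w\<close> with \<open>2 v - w\<close>, so it misses
  only \<open>v\<close>. The congruence is part of the result because \<open>coned_factorization\<close> needs
  the colours of specific edges.
\<close>

lemma near_factorization_arith:
  fixes f :: "'v \<Rightarrow> nat"
  assumes f: "bij_betw f S {..<r}" and r: "odd r"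
  obtains c :: "'v set \<Rightarrow> 'v" where
    "\<And>x y. x \<in> S \<Longrightarrow> y \<in> S \<Longrightarrow> x \<noteq> y \<Longrightarrow> c {x, y} \<in> S \<and> [2 * f (c {x, y}) = f x + f y] (mod r)"
    "\<And>v w. v \<in> S \<Longrightarrow> w \<in> S \<Longrightarrow> v \<noteq> w \<Longrightarrow> \<exists>u \<in> S. u \<noteq> w \<and> c {w, u} = v"
proof -
  have fr: "f x < r" if "x \<in> S" for x using f that by (auto simp: bij_betw_def)
  have r0: "r > 0" using r by (cases r) auto
  have half: "x = y" if "x \<in> S" "y \<in> S" "[2 * f x = 2 * f y] (mod r)" for x y
  proof -
    have "coprime 2 r" using r by simp
    then have "[f x = f y] (mod r)" using that(3) cong_mult_lcancel_nat by blast
    then have "f x = f y" using fr that by (simp add: cong_def)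
    then show ?thesis using f that by (auto simp: bij_betw_def inj_on_def)
  qed
  have surj: "\<exists>x \<in> S. [f x = s] (mod r)" for s
  proof -
    have "s mod r \<in> f ` S" using f r0 by (simp add: bij_betw_def)
    then show ?thesis by (metis cong_def image_iff mod_mod_trivial)
  qed
  have halfex: "\<exists>x \<in> S. [2 * f x = s] (mod r)" for s
  proof -
    obtain k where k: "r = 2 * k + 1" using r by (elim oddE)
    obtain x where x: "x \<in> S" "[f x = (k + 1) * s] (mod r)" using surj by blast
    have "2 * ((k + 1) * s) = s + r * s" by (simp add: k algebra_simps)
    then have "[2 * ((k + 1) * s) = s] (mod r)" by (simp only: cong_def mod_mult_self2)
    then show ?thesis using x cong_scalar_left cong_trans by blast
  qed
  define c where "c e = (SOME x. x \<in> S \<and> [2 * f x = (\<Sum>y\<in>e. f y)] (mod r))" for e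
  have c: "c e \<in> S \<and> [2 * f (c e) = (\<Sum>y\<in>e. f y)] (mod r)" for e
    unfolding c_def by (rule someI_ex) (use halfex[of "\<Sum>y\<in>e. f y"] in blast)
  show thesis
  proof (rule that[of c])
    show c2: "c {x, y} \<in> S \<and> [2 * f (c {x, y}) = f x + f y] (mod r)" if "x \<noteq> y" for x y
      using c[of "{x, y}"] that by simp
    fix v w assume vw: "v \<in> S" "w \<in> S" "v \<noteq> w"
    obtain u where u: "u \<in> S" "[f u = 2 * f v + (r - f w)] (mod r)" using surj by blast
    then have "[f w + f u = f w + (2 * f v + (r - f w))] (mod r)"
      by (simp add: cong_add_lcancel_nat)
    moreover have "f w + (2 * f v + (r - f w)) = 2 * f v + r" using fr[OF vw(2)] by simp
    ultimately have wu: "[f w + f u = 2 * f v] (mod r)" by (simp add: cong_def)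
    have "u \<noteq> w" using wu half vw by (metis mult_2 cong_sym)
    moreover have "c {w, u} = v"
      using half[of "c {w, u}" v] cong_trans[OF _ wu] c2[of w u] vw \<open>u \<noteq> w\<close> by auto
    ultimately show "\<exists>u \<in> S. u \<noteq> w \<and> c {w, u} = v" using u by blast
  qed
qed

text \<open>
  A numbering with \<open>mate b = - b\<close> and \<open>x0 = 0\<close> makes a prescribed perfect matching of \<open>S - {x0}\<close>
  the class of the colour \<open>x0\<close>.
\<close>

lemma near_factorization_with_class:
  assumes S: "finite S" "card S = 2 * h + 1" and x0: "x0 \<in> S"
    and B: "B \<subseteq> S - {x0}" "card B = h" and mate: "bij_betw mate B (S - {x0} - B)"
  obtains c :: "'v set \<Rightarrow> 'v" where
    "\<And>v w. v \<in> S \<Longrightarrow> w \<in> S \<Longrightarrow> v \<noteq> w \<Longrightarrow> \<exists>u \<in> S. u \<noteq> w \<and> c {w, u} = v"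
    "\<And>b. b \<in> B \<Longrightarrow> c {b, mate b} = x0"
proof -
  have finB: "finite B" using B S finite_subset by blast
  obtain g where g: "bij_betw g B {1..h}"
    using finB B by (metis ex_bij_betw_nat_finite_1 bij_betw_inv)
  let ?C = "S - {x0} - B"
  \<comment> \<open>residues \<open>1, \<dots>, h\<close> for \<open>B\<close> and their negatives for the mates\<close>
  define k where "k = (\<lambda>y. 2 * h + 1 - y) \<circ> g \<circ> inv_into B mate"
  have k: "bij_betw k ?C {h+1..2*h}"
    unfolding k_def
  proof (intro bij_betw_trans)
    show "bij_betw (inv_into B mate) ?C B" using mate by (rule bij_betw_inv_into)
    show "bij_betw g B {1..h}" by fact
    show "bij_betw (\<lambda>y. 2 * h + 1 - y) {1..h} {h + 1..2 * h}"
      by (rule bij_betwI[of _ _ _ "\<lambda>y. 2 * h + 1 - y"]) auto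
  qed
  define f where "f x = (if x = x0 then 0 else if x \<in> B then g x else k x)" for x
  have f1: "bij_betw f {x0} {0}" by (simp add: f_def bij_betw_def)
  have f2: "bij_betw f B {1..h}"
    using g B by (subst bij_betw_cong[of _ _ g]) (auto simp: f_def)
  have f3: "bij_betw f ?C {h+1..2*h}"
    using k by (subst bij_betw_cong[of _ _ k]) (auto simp: f_def)
  have "bij_betw f ({x0} \<union> B \<union> ?C) ({0} \<union> {1..h} \<union> {h+1..2*h})"
    using f1 f2 f3 by (intro bij_betw_combine) auto
  moreover have "{x0} \<union> B \<union> ?C = S" using x0 B by blast
  moreover have "{0} \<union> {1..h} \<union> {h+1..2*h} = {..<2 * h + 1}" by auto
  ultimately have f: "bij_betw f S {..<2 * h + 1}" by simp
  obtain c where c: "\<And>x y. x \<in> S \<Longrightarrow> y \<in> S \<Longrightarrow> x \<noteq> y \<Longrightarrow>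
      c {x, y} \<in> S \<and> [2 * f (c {x, y}) = f x + f y] (mod (2 * h + 1))"
    "\<And>v w. v \<in> S \<Longrightarrow> w \<in> S \<Longrightarrow> v \<noteq> w \<Longrightarrow> \<exists>u \<in> S. u \<noteq> w \<and> c {w, u} = v"
    by (rule near_factorization_arith[OF f]) (simp, blast)
  show thesis
  proof (rule that[of c])
    fix b assume b: "b \<in> B"
    then have mb: "mate b \<in> ?C" using mate by (auto simp: bij_betw_def)
    have "inv_into B mate (mate b) = b" using mate b by (simp add: bij_betw_def)
    moreover have "g b \<le> h" using g b by (auto simp: bij_betw_def)
    ultimately have sum: "f b + f (mate b) = 2 * h + 1" using b mb B by (auto simp: f_def k_def)
    have "b \<in> S" "mate b \<in> S" "b \<noteq> mate b" using b mb B by auto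
    from c(1)[OF this] have cb: "c {b, mate b} \<in> S" "[2 * f (c {b, mate b}) = 2 * h + 1] (mod (2 * h + 1))"
      unfolding sum by blast+
    then have "2 * h + 1 dvd 2 * f (c {b, mate b})"
      by (simp add: cong_def mod_eq_0_iff_dvd)
    moreover have "coprime (2 * h + 1) 2" by simp
    ultimately have "2 * h + 1 dvd f (c {b, mate b})"
      using coprime_dvd_mult_right_iff by blast
    moreover have "f (c {b, mate b}) < 2 * h + 1" using f cb by (auto simp: bij_betw_def)
    ultimately have "f (c {b, mate b}) = f x0" using nat_dvd_not_less[of "f (c {b, mate b})" "2 * h + 1"] by (auto simp: f_def[of x0])
    then show "c {b, mate b} = x0" using f cb x0 by (auto simp: bij_betw_def inj_on_def)
  qed (use c(2) in blast)
qed

lemma near_factorization: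
  assumes S: "finite S" "odd (card S)"
  obtains c :: "'v set \<Rightarrow> 'v" where
    "\<And>v w. v \<in> S \<Longrightarrow> w \<in> S \<Longrightarrow> v \<noteq> w \<Longrightarrow> \<exists>u \<in> S. u \<noteq> w \<and> c {w, u} = v"
proof -
  obtain f where "bij_betw f S {..<card S}"
    using S by (metis ex_bij_betw_finite_nat atLeast0LessThan)
  then show thesis
    using near_factorization_arith[of f S "card S"] S that by metis
qed

text \<open>
  Joining \<open>z\<close> to the missed point turns each near-perfect matching of \<open>S - {z}\<close> into a perfect
  matching of \<open>S\<close>.
\<close>

lemma factorization:
  assumes S: "finite S" "even (card S)" and z: "z \<in> S"
  obtains c :: "'v set \<Rightarrow> 'v" where
    "\<And>v w. v \<in> S - {z} \<Longrightarrow> w \<in> S \<Longrightarrow> \<exists>u \<in> S. u \<noteq> w \<and> c {w, u} = v"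
proof -
  have "odd (card (S - {z}))" using S z by (metis card_Suc_Diff1 even_Suc)
  then obtain c0 where c0: "\<And>v w. v \<in> S - {z} \<Longrightarrow> w \<in> S - {z} \<Longrightarrow> v \<noteq> w \<Longrightarrow>
      \<exists>u \<in> S - {z}. u \<noteq> w \<and> c0 {w, u} = v"
    using near_factorization[of "S - {z}"] S by (metis finite_Diff)
  define c where "c e = (if z \<in> e then the_elem (e - {z}) else c0 e)" for e
  have cz: "c {z, v} = v" "c {v, z} = v" if "v \<noteq> z" for v
  proof -
    have "{z, v} - {z} = {v}" "{v, z} - {z} = {v}" using that by auto
    then show "c {z, v} = v" "c {v, z} = v" by (simp_all add: c_def)
  qed
  show thesis
  proof (rule that[of c])
    fix v w assume v: "v \<in> S - {z}" and w: "w \<in> S"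
    consider "w = z" | "w = v" | "w \<in> S - {z}" "v \<noteq> w" using w by blast
    then show "\<exists>u \<in> S. u \<noteq> w \<and> c {w, u} = v"
    proof cases
      case 3
      then obtain u where "u \<in> S - {z}" "u \<noteq> w" "c0 {w, u} = v" using c0 v by blast
      then show ?thesis using 3 by (intro bexI[of _ u]) (auto simp: c_def)
    next
      case 1
      then show ?thesis using v cz by (intro bexI[of _ v]) auto
    next
      case 2
      then show ?thesis using v z cz by (intro bexI[of _ z]) auto
    qed
  qed
qed

text \<open>
  Dissolve the class of the colour \<open>p\<close> in a near-factorization in which each edge of that class joins
  a point of \<open>B\<close> to a point outside \<open>B\<close>. The edge completes the class that misses the latter point. So
  only the classes missing a point of \<open>B\<close> still need an edge, one at each point of \<open>B\<close>.
\<close>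

lemma upgraded_factorization:
  assumes S: "finite S" "card S = 2 * h + 1" and p: "p \<in> S"
    and B: "B \<subseteq> S - {p}" "card B = h"
  obtains c :: "'v set \<Rightarrow> 'v" where
    "\<And>v w. v \<in> S - {p} \<Longrightarrow> w \<in> S \<Longrightarrow> v \<noteq> w \<or> v \<notin> B \<Longrightarrow> \<exists>u \<in> S. u \<noteq> w \<and> c {w, u} = v"
proof -
  have finB: "finite B" using B S finite_subset by blast
  have "card (S - {p} - B) = h"
    using B S p finB by (simp add: card_Diff_subset)
  then obtain mate where mate: "bij_betw mate B (S - {p} - B)"
    using finite_same_card_bij[of B "S - {p} - B"] finB S B by auto
  obtain c0 where c0: "\<And>v w. v \<in> S \<Longrightarrow> w \<in> S \<Longrightarrow> v \<noteq> w \<Longrightarrow> \<exists>u \<in> S. u \<noteq> w \<and> c0 {w, u} = v"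
    "\<And>b. b \<in> B \<Longrightarrow> c0 {b, mate b} = p"
    by (rule near_factorization_with_class[OF S p B mate]) blast
  define c where "c e = (if c0 e = p then the_elem (e - B) else c0 e)" for e
  show thesis
  proof (rule that[of c])
    fix v w assume v: "v \<in> S - {p}" and w: "w \<in> S" and vw: "v \<noteq> w \<or> v \<notin> B"
    show "\<exists>u \<in> S. u \<noteq> w \<and> c {w, u} = v"
    proof (cases "v = w")
      case False
      then obtain u where "u \<in> S" "u \<noteq> w" "c0 {w, u} = v" using c0(1) v w by blast
      then show ?thesis using v by (intro bexI[of _ u]) (auto simp: c_def)
    next
      case True
      then have "v \<in> mate ` B" using vw v mate by (auto simp: bij_betw_def)
      then obtain b where b: "b \<in> B" "mate b = v" by blast
      have "{v, b} - B = {v}" using b vw True by auto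
      then have "c {w, b} = v" using c0(2)[OF b(1)] b True by (simp add: c_def insert_commute)
      moreover have "b \<noteq> w" using b vw True by auto
      ultimately show ?thesis using b B by blast
    qed
  qed
qed

text \<open>
  Compared with a 1-factorization of \<open>S\<close>, one more colour covers \<open>S\<close> if the edges to an additional
  point \<open>p\<close> are used. In the 1-factorization of \<open>S\<close> by residues modulo \<open>2 h - 1\<close>, the
  edges \<open>{2 i, 2 i + 1}\<close> with \<open>i < h - 1\<close> have different colours. They become the new class, which \<open>p\<close>
  completes at the two remaining points, and in its old class each of them is replaced by the two
  edges from its endpoints to \<open>p\<close>. Hence \<open>h\<close> of the classes reach \<open>p\<close>, each by two edges.
\<close>

lemma coned_factorization:
  assumes S: "finite S" "card S = 2 * h" "h > 0" and p: "p \<notin> S"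
  obtains c :: "'v set \<Rightarrow> 'v" where
    "\<And>v w. v \<in> S \<Longrightarrow> w \<in> S \<Longrightarrow> \<exists>u \<in> insert p S. u \<noteq> w \<and> c {w, u} = v"
    "card {v \<in> S. \<not> (\<exists>u \<in> S. c {p, u} = v)} \<le> h"
proof -
  obtain z where z: "z \<in> S" using S by force
  define S' where "S' = S - {z}"
  define r where "r = 2 * h - 1"
  have r: "odd r" "card S' = r" "finite S'" using S z by (auto simp: S'_def r_def)
  obtain f where f: "bij_betw f S' {..<r}"
    using r by (metis ex_bij_betw_finite_nat atLeast0LessThan)
  obtain c0 where c0: "\<And>x y. x \<in> S' \<Longrightarrow> y \<in> S' \<Longrightarrow> x \<noteq> y \<Longrightarrow>
      c0 {x, y} \<in> S' \<and> [2 * f (c0 {x, y}) = f x + f y] (mod r)"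
    "\<And>v w. v \<in> S' \<Longrightarrow> w \<in> S' \<Longrightarrow> v \<noteq> w \<Longrightarrow> \<exists>u \<in> S'. u \<noteq> w \<and> c0 {w, u} = v"
    by (rule near_factorization_arith[OF f r(1)]) blast
  define g where "g = inv_into S' f"
  have g: "g i \<in> S'" "f (g i) = i" if "i < r" for i
    using f that by (simp_all add: g_def bij_betw_def inv_into_into f_inv_into_f)
  have ginj: "g i = g j \<longleftrightarrow> i = j" if "i < r" "j < r" for i j using g that by metis
  \<comment> \<open>the edges with different colours; their colours \<open>s\<close> satisfy \<open>2 s = 4 i + 1\<close> modulo \<open>r\<close>\<close>
  define R where "R i = {g (2 * i), g (2 * i + 1)}" for i
  have ir: "2 * i < r" "2 * i + 1 < r" if "i < h - 1" for i using that by (auto simp: r_def)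
  have R2: "c0 (R i) \<in> S' \<and> [2 * f (c0 (R i)) = 4 * i + 1] (mod r)" if "i < h - 1" for i
  proof -
    have "g (2 * i) \<noteq> g (2 * i + 1)" using ginj ir[OF that] by simp
    moreover have "f (g (2 * i)) + f (g (2 * i + 1)) = 4 * i + 1" using g ir[OF that] by simp
    ultimately show ?thesis using c0(1) g ir[OF that] by (metis R_def)
  qed
  have Rdisj: "i = j" if "i < h - 1" "j < h - 1" "x \<in> R i" "x \<in> R j" for i j x
  proof -
    from that have R: "x \<in> R i" "x \<in> R j" and ij: "i < h - 1" "j < h - 1" by blast+
    obtain a where a: "x = g a" "a < r" "a = 2 * i \<or> a = 2 * i + 1"
      using R(1) ir[OF ij(1)] by (auto simp: R_def)
    obtain b where b: "x = g b" "b < r" "b = 2 * j \<or> b = 2 * j + 1"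
      using R(2) ir[OF ij(2)] by (auto simp: R_def)
    have "a = b" using a b ginj by metis
    then show "i = j" using a(3) b(3) by presburger
  qed
  have Rinj: "i = j" if "i < h - 1" "j < h - 1" "c0 (R i) = c0 (R j)" for i j
  proof -
    have "[4 * i + 1 = 4 * j + 1] (mod r)" using R2 that by (metis cong_sym cong_trans)
    then have "[4 * i = 4 * j] (mod r)" by (simp only: cong_add_rcancel_nat)
    moreover have "coprime 4 r" using r(1) coprime_power_left_iff[of 2 2 r] by simp
    ultimately have "[i = j] (mod r)" using cong_mult_lcancel_nat by blast
    moreover have "i < r" "j < r" using ir[OF that(1)] ir[OF that(2)] by linarith+
    ultimately show ?thesis by (simp add: cong_def)
  qed
  have RS: "R i \<subseteq> S'" if "i < h - 1" for i using g ir[OF that] by (auto simp: R_def)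
  define idx where "idx x = (THE i. i < h - 1 \<and> x \<in> R i)" for x
  have idx: "idx x = i" if "i < h - 1" "x \<in> R i" for i x
    unfolding idx_def using that Rdisj by blast
  define c where "c e =
    (if p \<in> e then let x = the_elem (e - {p}) in if \<exists>i<h-1. x \<in> R i then c0 (R (idx x)) else z
     else if \<exists>i<h-1. e = R i then z
     else if z \<in> e then the_elem (e - {z}) else c0 e)" for e
  have cp: "c {p, x} = (if \<exists>i<h-1. x \<in> R i then c0 (R (idx x)) else z)"
    "c {x, p} = (if \<exists>i<h-1. x \<in> R i then c0 (R (idx x)) else z)" if "x \<in> S" for x
  proof -
    have "{p, x} - {p} = {x}" "{x, p} - {p} = {x}" using that p by auto
    then show "c {p, x} = (if \<exists>i<h-1. x \<in> R i then c0 (R (idx x)) else z)"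
      "c {x, p} = (if \<exists>i<h-1. x \<in> R i then c0 (R (idx x)) else z)" by (simp_all add: c_def)
  qed
  have cR: "c (R i) = z" if "i < h - 1" for i
    using RS[OF that] that p by (auto simp: c_def S'_def)
  have cz: "c {z, x} = x" "c {x, z} = x" if "x \<in> S'" for x
  proof -
    have "{z, x} - {z} = {x}" "{x, z} - {z} = {x}" using that by (auto simp: S'_def)
    moreover have "p \<noteq> z" "p \<noteq> x" using p z that by (auto simp: S'_def)
    moreover have "{z, x} \<noteq> R i" if "i < h - 1" for i using RS[OF that] by (auto simp: S'_def)
    ultimately show "c {z, x} = x" "c {x, z} = x" by (auto simp: c_def insert_commute)
  qed
  show thesis
  proof (rule that[of c])
    fix v w assume v: "v \<in> S" and w: "w \<in> S"
    show "\<exists>u \<in> insert p S. u \<noteq> w \<and> c {w, u} = v"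
    proof (cases "v = z")
      case True
      show ?thesis
      proof (cases "\<exists>i<h-1. w \<in> R i")
        case True
        then obtain i where i: "i < h - 1" "w \<in> R i" by blast
        have "\<exists>u \<in> R i. u \<noteq> w \<and> {w, u} = R i"
          using i ginj[of "2 * i" "2 * i + 1"] ir[OF i(1)] by (auto simp: R_def)
        then show ?thesis using cR[OF i(1)] \<open>v = z\<close> RS[OF i(1)] by (auto simp: S'_def)
      next
        case False
        then show ?thesis using cp(2)[OF w] \<open>v = z\<close> w p by (intro bexI[of _ p]) auto
      qed
    next
      case False
      then have vS: "v \<in> S'" using v by (simp add: S'_def)
      consider "w = z" | "w = v" | "w \<in> S'" "v \<noteq> w" using w by (auto simp: S'_def)
      then show ?thesis
      proof cases
        case 1
        then show ?thesis using cz vS False v by blast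
      next
        case 2
        then show ?thesis using cz(2)[OF vS] False z by (intro bexI[of _ z]) auto
      next
        case 3
        then obtain u where u: "u \<in> S'" "u \<noteq> w" "c0 {w, u} = v" using c0(2) vS by blast
        show ?thesis
        proof (cases "\<exists>i<h-1. {w, u} = R i")
          case True
          then obtain i where i: "i < h - 1" "{w, u} = R i" by blast
          then have "c {w, p} = v" using cp(2)[OF w] idx[of i w] u by auto
          then show ?thesis using w p by (intro bexI[of _ p]) auto
        next
          case False
          then have "c {w, u} = v" using u 3 p by (auto simp: c_def S'_def)
          then show ?thesis using u by (auto simp: S'_def)
        qed
      qed
    qed
  next
    let ?good = "insert z ((\<lambda>i. c0 (R i)) ` {..<h - 1})"
    have "{v \<in> S. \<not> (\<exists>u \<in> S. c {p, u} = v)} \<subseteq> S - ?good"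
    proof -
      have "\<exists>u \<in> S. c {p, u} = v" if v: "v \<in> ?good" for v
      proof (cases "v = z")
        case True
        have "\<not> (\<exists>i<h-1. z \<in> R i)" using RS by (auto simp: S'_def)
        then have "c {p, z} = z" using cp(1)[OF z] by argo
        then show ?thesis using z True by blast
      next
        case False
        then obtain i where i: "i < h - 1" "v = c0 (R i)" using v by auto
        then have "g (2 * i) \<in> R i" "g (2 * i) \<in> S" using RS by (auto simp: R_def S'_def)
        then show ?thesis using cp(1) idx i by (metis (full_types))
      qed
      then show ?thesis by blast
    qed
    then have "card {v \<in> S. \<not> (\<exists>u \<in> S. c {p, u} = v)} \<le> card (S - ?good)"
      using S by (intro card_mono) auto
    also have "\<dots> = card S - card ?good"
      using R2 z by (intro card_Diff_subset) (auto simp: S'_def)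
    also have "card ?good = h"
    proof -
      have "z \<notin> (\<lambda>i. c0 (R i)) ` {..<h - 1}" using R2 by (auto simp: S'_def)
      moreover have "card ((\<lambda>i. c0 (R i)) ` {..<h - 1}) = h - 1"
        using Rinj by (subst card_image) (auto simp: inj_on_def)
      ultimately show ?thesis using S(3) by simp
    qed
    finally show "card {v \<in> S. \<not> (\<exists>u \<in> S. c {p, u} = v)} \<le> h" using S by simp
  qed
qed

text \<open>
  A circulant relation.
\<close>

lemma regular_relation:
  assumes A: "finite A" "card A = N" and B: "finite B" "card B = N" and h: "h \<le> N"
  obtains R :: "('v \<times> 'w) set" where "R \<subseteq> A \<times> B"
    "\<And>x. x \<in> A \<Longrightarrow> card {y. (x, y) \<in> R} = h" "\<And>y. y \<in> B \<Longrightarrow> card {x. (x, y) \<in> R} = h"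
proof -
  obtain f where f: "bij_betw f A {..<N}" using A by (metis ex_bij_betw_finite_nat atLeast0LessThan)
  obtain g where g: "bij_betw g B {..<N}" using B by (metis ex_bij_betw_finite_nat atLeast0LessThan)
  have count: "card {y \<in> D. (i + k y) mod N < h} = h" if k: "bij_betw k D {..<N}" and i: "i < N"
    for i and D :: "'z set" and k
  proof -
    have "bij_betw (\<lambda>j. (i + j) mod N) {..<N} {..<N}"
    proof (rule bij_betwI[of _ _ _ "\<lambda>j. (N - i + j) mod N"])
      show "(N - i + (i + j) mod N) mod N = j" if "j \<in> {..<N}" for j
      proof -
        have "(N - i + (i + j) mod N) mod N = (N - i + (i + j)) mod N" by (rule mod_add_right_eq)
        also have "N - i + (i + j) = N + j" using i by simp
        finally show ?thesis using that by simp
      qed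
      show "(i + (N - i + j) mod N) mod N = j" if "j \<in> {..<N}" for j
      proof -
        have "(i + (N - i + j) mod N) mod N = (i + (N - i + j)) mod N" by (rule mod_add_right_eq)
        also have "i + (N - i + j) = N + j" using i by simp
        finally show ?thesis using that by simp
      qed
    qed (use i in auto)
    then have b: "bij_betw ((\<lambda>j. (i + j) mod N) \<circ> k) D {..<N}" using k bij_betw_trans by blast
    have "bij_betw ((\<lambda>j. (i + j) mod N) \<circ> k) {y \<in> D. (i + k y) mod N < h} {..<h}"
      unfolding bij_betw_def
    proof
      show "inj_on ((\<lambda>j. (i + j) mod N) \<circ> k) {y \<in> D. (i + k y) mod N < h}"
        using b by (auto simp: bij_betw_def intro: inj_on_subset)
      have "((\<lambda>j. (i + j) mod N) \<circ> k) ` {y \<in> D. (i + k y) mod N < h} = (((\<lambda>j. (i + j) mod N) \<circ> k) ` D) \<inter> {..<h}"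
        by auto
      then show "((\<lambda>j. (i + j) mod N) \<circ> k) ` {y \<in> D. (i + k y) mod N < h} = {..<h}"
        using b h by (auto simp: bij_betw_def)
    qed
    then show ?thesis by (metis bij_betw_same_card card_lessThan)
  qed
  let ?R = "{(x, y). x \<in> A \<and> y \<in> B \<and> (f x + g y) mod N < h}"
  show thesis
  proof (rule that[of ?R])
    show "card {y. (x, y) \<in> ?R} = h" if "x \<in> A" for x
      using count[OF g, of "f x"] that f by (auto simp: bij_betw_def)
    show "card {x. (x, y) \<in> ?R} = h" if "y \<in> B" for y
      using count[OF f, of "g y"] that g by (auto simp: bij_betw_def add.commute)
  qed auto
qed

section \<open>Projective planes\<close>

text \<open>
  The last axiom replaces the usual quadrangle of points in general position: projecting from a
  point onto a line that avoids it counts the lines through the point.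
\<close>

locale projective_plane =
  fixes pts :: "'p set" and lines :: "'p set set" and q :: nat
  assumes finite_pts: "finite pts"
    and pts_nonempty: "pts \<noteq> {}"
    and line_subset: "l \<in> lines \<Longrightarrow> l \<subseteq> pts"
    and card_line: "l \<in> lines \<Longrightarrow> card l = Suc q"
    and join_exists: "x \<in> pts \<Longrightarrow> y \<in> pts \<Longrightarrow> x \<noteq> y \<Longrightarrow> \<exists>l \<in> lines. x \<in> l \<and> y \<in> l"
    and line_unique: "l \<in> lines \<Longrightarrow> l' \<in> lines \<Longrightarrow> x \<noteq> y \<Longrightarrow> x \<in> l \<Longrightarrow> y \<in> l \<Longrightarrow> x \<in> l' \<Longrightarrow> y \<in> l' \<Longrightarrow> l = l'"
    and lines_meet: "l \<in> lines \<Longrightarrow> l' \<in> lines \<Longrightarrow> \<exists>x. x \<in> l \<and> x \<in> l'"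
    and line_avoiding: "x \<in> pts \<Longrightarrow> \<exists>l \<in> lines. x \<notin> l"
begin

definition star :: "'p \<Rightarrow> 'p set set" where
  "star x = {l \<in> lines. x \<in> l}"

definition join :: "'p \<Rightarrow> 'p \<Rightarrow> 'p set" where
  "join x y = (THE l. l \<in> lines \<and> x \<in> l \<and> y \<in> l)"

lemma finite_line: "l \<in> lines \<Longrightarrow> finite l"
  using line_subset finite_pts finite_subset by blast

lemma finite_lines: "finite lines"
  using line_subset finite_pts by (metis PowI finite_Pow_iff finite_subset subsetI)

lemma finite_star: "finite (star x)"
  using finite_lines by (simp add: star_def)

lemma join_eq: "l \<in> lines \<Longrightarrow> x \<in> l \<Longrightarrow> y \<in> l \<Longrightarrow> x \<noteq> y \<Longrightarrow> join x y = l"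
  unfolding join_def using line_unique by (intro the_equality) auto

lemma join:
  assumes "x \<in> pts" "y \<in> pts" "x \<noteq> y"
  shows "join x y \<in> lines" "x \<in> join x y" "y \<in> join x y"
  using join_exists[OF assms] join_eq assms by auto

lemma card_star:
  assumes x: "x \<in> pts"
  shows "card (star x) = Suc q"
proof -
  obtain l where l: "l \<in> lines" "x \<notin> l" using line_avoiding x by blast
  have xl: "x \<noteq> y" "y \<in> pts" if "y \<in> l" for y using that l line_subset by auto
  have "bij_betw (join x) l (star x)"
    unfolding bij_betw_def
  proof
    show "inj_on (join x) l"
    proof (rule inj_onI, rule ccontr)
      fix y z assume yz: "y \<in> l" "z \<in> l" "join x y = join x z" "y \<noteq> z"
      have "join x y = l"
        using line_unique[of "join x y" l y z] join[OF x] xl yz l by metis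
      then show False using join[OF x] xl yz l by metis
    qed
    show "join x ` l = star x"
    proof
      show "join x ` l \<subseteq> star x" using join[OF x] xl by (auto simp: star_def)
      show "star x \<subseteq> join x ` l"
      proof
        fix k assume k: "k \<in> star x"
        then obtain y where y: "y \<in> k" "y \<in> l" using lines_meet l by (auto simp: star_def)
        then have "k = join x y" using join_eq[of k x y] k xl by (simp add: star_def)
        then show "k \<in> join x ` l" using y by blast
      qed
    qed
  qed
  then show ?thesis using card_line l by (metis bij_betw_same_card)
qed

lemma card_star_Diff:
  assumes "l \<in> lines" "x \<in> l"
  shows "card (star x - {l}) = q"
proof -
  have "x \<in> pts" "l \<in> star x" using assms line_subset by (auto simp: star_def)
  then show ?thesis using card_star by simp
qed

lemma card_pts: "card pts = q\<^sup>2 + q + 1"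
proof -
  obtain x where x: "x \<in> pts" using pts_nonempty by blast
  have eq: "pts - {x} = (\<Union>l\<in>star x. l - {x})"
    using line_subset join[OF x] by (fastforce simp: star_def)
  have "card (pts - {x}) = (\<Sum>l\<in>star x. card (l - {x}))"
    unfolding eq
  proof (rule card_UN_disjoint)
    show "\<forall>l\<in>star x. finite (l - {x})" using finite_line by (auto simp: star_def)
    show "\<forall>l\<in>star x. \<forall>k\<in>star x. l \<noteq> k \<longrightarrow> (l - {x}) \<inter> (k - {x}) = {}"
      using line_unique by (auto simp: star_def)
  qed (rule finite_star)
  also have "\<dots> = (\<Sum>l\<in>star x. q)"
    by (rule sum.cong) (auto simp: star_def card_line)
  finally have "card (pts - {x}) = q\<^sup>2 + q"
    using card_star[OF x] by (simp add: power2_eq_square)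
  then show ?thesis
    using card_Suc_Diff1[OF finite_pts x] by simp
qed

lemma lines_split:
  assumes M: "M \<in> lines"
  shows "lines = insert M (\<Union>p\<in>M. star p - {M})"
  using lines_meet[OF M] M by (fastforce simp: star_def)

text \<open>
  Every line other than \<open>M\<close> is counted at the only point that it shares with \<open>M\<close>.
\<close>

lemma sum_lines:
  assumes M: "M \<in> lines"
  shows "sum f lines = (f M :: nat) + (\<Sum>p\<in>M. \<Sum>l\<in>star p - {M}. f l)"
proof -
  have "sum f lines = f M + sum f (\<Union>p\<in>M. star p - {M})"
    by (subst lines_split[OF M], rule sum.insert) (use M in \<open>auto simp: finite_line finite_star\<close>)
  also have "sum f (\<Union>p\<in>M. star p - {M}) = (\<Sum>p\<in>M. \<Sum>l\<in>star p - {M}. f l)"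
  proof (rule sum.UNION_disjoint)
    show "\<forall>p\<in>M. \<forall>r\<in>M. p \<noteq> r \<longrightarrow> (star p - {M}) \<inter> (star r - {M}) = {}"
      using line_unique M by (auto simp: star_def)
  qed (use M in \<open>auto simp: finite_line finite_star\<close>)
  finally show ?thesis .
qed

lemma card_lines: "card lines = q\<^sup>2 + q + 1"
proof -
  obtain M where M: "M \<in> lines" using line_avoiding pts_nonempty by blast
  have "(\<Sum>p\<in>M. \<Sum>l\<in>star p - {M}. 1) = (\<Sum>p\<in>M. q)"
    using card_star_Diff[OF M] by (intro sum.cong) simp_all
  then show ?thesis
    using sum_lines[OF M, of "\<lambda>_. 1"] card_line[OF M] by (simp add: power2_eq_square)
qed

end

text \<open>
  The affine plane over \<open>F\<close>, completed by a point at infinity for each slope; the point \<open>None\<close> is the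
  direction of the vertical lines.
\<close>

lemma projective_plane_over_field:
  fixes F :: "'a :: field set"
  assumes F: "finite F" "0 \<in> F" "1 \<in> F"
    and diff: "\<And>x y. x \<in> F \<Longrightarrow> y \<in> F \<Longrightarrow> x - y \<in> F"
    and mult: "\<And>x y. x \<in> F \<Longrightarrow> y \<in> F \<Longrightarrow> x * y \<in> F"
    and div: "\<And>x y. x \<in> F \<Longrightarrow> y \<in> F \<Longrightarrow> x / y \<in> F"
  shows "\<exists>(pts :: (('a \<times> 'a) + 'a option) set) lines. projective_plane pts lines (card F)"
proof -
  have add: "x + y \<in> F" if "x \<in> F" "y \<in> F" for x y
    using diff[OF that(1) diff[OF F(2) that(2)]] by simp
  define slant :: "'a \<Rightarrow> 'a \<Rightarrow> (('a \<times> 'a) + 'a option) set"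
    where "slant s b = insert (Inr (Some s)) ((\<lambda>x. Inl (x, s * x + b)) ` F)" for s b
  define vert :: "'a \<Rightarrow> (('a \<times> 'a) + 'a option) set"
    where "vert c = insert (Inr None) ((\<lambda>y. Inl (c, y)) ` F)" for c
  define inf :: "(('a \<times> 'a) + 'a option) set"
    where "inf = insert (Inr None) ((\<lambda>s. Inr (Some s)) ` F)"
  define pts :: "(('a \<times> 'a) + 'a option) set"
    where "pts = Inl ` (F \<times> F) \<union> inf"
  define lines where "lines = {slant s b | s b. s \<in> F \<and> b \<in> F} \<union> vert ` F \<union> {inf}"
  have cases: thesis if "l \<in> lines" "\<And>s b. s \<in> F \<Longrightarrow> b \<in> F \<Longrightarrow> l = slant s b \<Longrightarrow> thesis"
    "\<And>c. c \<in> F \<Longrightarrow> l = vert c \<Longrightarrow> thesis" "l = inf \<Longrightarrow> thesis" for l thesis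
    using that by (auto simp: lines_def)
  have mem:
    "Inl (x, y) \<in> slant s b \<longleftrightarrow> x \<in> F \<and> y = s * x + b"
    "Inr (Some t) \<in> slant s b \<longleftrightarrow> t = s" "Inr None \<in> slant s b \<longleftrightarrow> False"
    "Inl (x, y) \<in> vert c \<longleftrightarrow> x = c \<and> y \<in> F" "Inr (Some t) \<in> vert c \<longleftrightarrow> False" "Inr None \<in> vert c \<longleftrightarrow> True"
    "Inl (x, y) \<in> inf \<longleftrightarrow> False" "Inr (Some t) \<in> inf \<longleftrightarrow> t \<in> F" "Inr None \<in> inf \<longleftrightarrow> True"
    for x y s b t c
    by (auto simp: slant_def vert_def inf_def)
  have ptcases: thesis if "z \<in> pts" "\<And>x y. x \<in> F \<Longrightarrow> y \<in> F \<Longrightarrow> z = Inl (x, y) \<Longrightarrow> thesis"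
    "\<And>s. s \<in> F \<Longrightarrow> z = Inr (Some s) \<Longrightarrow> thesis" "z = Inr None \<Longrightarrow> thesis" for z thesis
    using that by (auto simp: pts_def inf_def)
  have l1: "slant s b \<in> lines" if "s \<in> F" "b \<in> F" for s b using that by (auto simp: lines_def)
  have l2: "vert c \<in> lines" if "c \<in> F" for c using that by (auto simp: lines_def)
  have l3: "inf \<in> lines" by (auto simp: lines_def)
  have slope: "\<exists>l \<in> lines. Inl (x, y) \<in> l \<and> Inl (x', y') \<in> l"
    if "x \<in> F" "y \<in> F" "x' \<in> F" "y' \<in> F" for x y x' y'
  proof (cases "x = x'")
    case True
    then show ?thesis using l2 that mem by (intro bexI[of _ "vert x"]) auto
  next
    case False
    define s where "s = (y' - y) / (x' - x)"
    have sF: "s \<in> F" unfolding s_def using that div diff by blast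
    have "s * (x' - x) = y' - y" using False by (simp add: s_def)
    then have "y' = s * x' + (y - s * x)" by (simp add: algebra_simps)
    then show ?thesis using l1[OF sF diff[OF that(2) mult[OF sF that(1)]]] that mem
      by (intro bexI[of _ "slant s (y - s * x)"]) auto
  qed
  have slope2: "\<exists>l \<in> lines. Inl (x, y) \<in> l \<and> Inr (Some s) \<in> l" if "x \<in> F" "y \<in> F" "s \<in> F" for x y s
    using l1[OF that(3) diff[OF that(2) mult[OF that(3,1)]]] that mem
    by (intro bexI[of _ "slant s (y - s * x)"]) auto
  have slope3: "\<exists>l \<in> lines. Inl (x, y) \<in> l \<and> Inr None \<in> l" if "x \<in> F" "y \<in> F" for x y
    using l2 that mem by (intro bexI[of _ "vert x"]) auto
  have infin: "\<exists>l \<in> lines. Inr (Some s) \<in> l \<and> Inr (Some t) \<in> l" "\<exists>l \<in> lines. Inr (Some s) \<in> l \<and> Inr None \<in> l"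
    if "s \<in> F" "t \<in> F" for s t
    by (rule bexI[OF _ l3], use that mem in simp)+
  have "projective_plane pts lines (card F)"
  proof
    show "finite pts" "pts \<noteq> {}" using F by (auto simp: pts_def inf_def)
    show "l \<subseteq> pts" if "l \<in> lines" for l
      using that add mult by (elim cases) (auto simp: pts_def slant_def vert_def inf_def)
    show "card l = Suc (card F)" if "l \<in> lines" for l
      using that F by (elim cases) (auto simp: slant_def vert_def inf_def card_image inj_on_def card_insert_if)
    show "\<exists>l \<in> lines. z \<in> l \<and> w \<in> l" if zw: "z \<in> pts" "w \<in> pts" "z \<noteq> w" for z w
    proof (rule ptcases[OF zw(1)])
      show ?thesis if "x \<in> F" "y \<in> F" "z = Inl (x, y)" for x y
        by (rule ptcases[OF zw(2)]) (use that slope slope2 slope3 in simp_all)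
      show ?thesis if "s \<in> F" "z = Inr (Some s)" for s
        by (rule ptcases[OF zw(2)]) (use that slope2 infin infin(2)[OF _ F(2)] in \<open>simp_all add: conj_commute\<close>)
      show ?thesis if "z = Inr None"
        by (rule ptcases[OF zw(2)]) (use that zw slope3 infin(2)[OF _ F(2)] in \<open>simp_all add: conj_commute\<close>)
    qed
    show "l = l'" if "l \<in> lines" "l' \<in> lines" "z \<noteq> w" "z \<in> l" "w \<in> l" "z \<in> l'" "w \<in> l'" for l l' z w
    proof -
      have key: "s = s' \<and> b = b'" if "s * x + b = s' * x + b'" "s * x' + b = s' * x' + b'" "x \<noteq> x'"
        for s s' b b' x x' :: 'a
      proof -
        have "(s - s') * (x - x') = ((s * x + b) - (s' * x + b')) - ((s * x' + b) - (s' * x' + b'))"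
          by (simp add: algebra_simps)
        also have "\<dots> = 0" unfolding that(1,2) by simp
        finally have "(s - s') * (x - x') = 0" .
        then show ?thesis using that by auto
      qed
      have slants: "s = s' \<and> b = b'"
        if zw: "z \<noteq> w" "z \<in> slant s b" "w \<in> slant s b" "z \<in> slant s' b'" "w \<in> slant s' b'" for z w s b s' b'
      proof -
        have form: "u = Inr (Some s) \<or> (\<exists>x. u = Inl (x, s * x + b))" if "u \<in> slant s b" for u
          using that by (auto simp: slant_def)
        have inf_case: "s = s' \<and> b = b'" if "u = Inr (Some s)" "v = Inl (x, s * x + b)"
          "u \<in> slant s' b'" "v \<in> slant s' b'" for u v x
          using that mem by auto
        show ?thesis
        proof (cases "z = Inr (Some s) \<or> w = Inr (Some s)")
          case True
          then show ?thesis using form zw inf_case by metis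
        next
          case False
          then obtain x x' where x: "z = Inl (x, s * x + b)" "w = Inl (x', s * x' + b)"
            using form zw by metis
          then show ?thesis using key[of s x b s' b' x'] zw mem by auto
        qed
      qed
      have sv: "z = w" if "z \<in> slant s b" "w \<in> slant s b" "z \<in> vert c" "w \<in> vert c" for z w s b c
        using that by (auto simp: slant_def vert_def)
      have si: "z = w" if "z \<in> slant s b" "w \<in> slant s b" "z \<in> inf" "w \<in> inf" for z w s b
        using that by (auto simp: slant_def inf_def)
      have vi: "z = w" if "z \<in> vert c" "w \<in> vert c" "z \<in> inf" "w \<in> inf" for z w c
        using that by (auto simp: vert_def inf_def)
      have vv: "c = d \<or> z = w" if "z \<in> vert c" "w \<in> vert c" "z \<in> vert d" "w \<in> vert d" for z w c d
        using that by (auto simp: vert_def)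
      note zw = that(3-7)
      show ?thesis
      proof (rule cases[OF that(1)])
        fix s b assume l: "l = slant s b"
        show ?thesis
        proof (rule cases[OF that(2)])
          show ?thesis if "l' = slant s' b'" for s' b'
            using slants[of z w s b s' b'] zw unfolding l that by blast
          show ?thesis if "l' = vert c" for c using sv[of z s b w c] zw unfolding l that by blast
          show ?thesis if "l' = inf" using si[of z s b w] zw unfolding l that by blast
        qed
      next
        fix c assume l: "l = vert c"
        show ?thesis
        proof (rule cases[OF that(2)])
          show ?thesis if "l' = slant s b" for s b using sv[of z s b w c] zw unfolding l that by blast
          show ?thesis if "l' = vert d" for d using vv[of z c w d] zw unfolding l that by blast
          show ?thesis if "l' = inf" using vi[of z c w] zw unfolding l that by blast
        qed
      next
        assume l: "l = inf"
        show ?thesis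
        proof (rule cases[OF that(2)])
          show ?thesis if "l' = slant s b" for s b using si[of z s b w] zw unfolding l that by blast
          show ?thesis if "l' = vert c" for c using vi[of z c w] zw unfolding l that by blast
          show ?thesis if "l' = inf" unfolding l that ..
        qed
      qed
    qed
    show "\<exists>x. x \<in> l \<and> x \<in> l'" if "l \<in> lines" "l' \<in> lines" for l l'
    proof -
      have A: "\<exists>x. x \<in> slant s b \<and> x \<in> slant s' b'" if "s \<in> F" "b \<in> F" "s' \<in> F" "b' \<in> F" for s b s' b'
      proof (cases "s = s'")
        case True
        then show ?thesis using mem by blast
      next
        case False
        define x where "x = (b' - b) / (s - s')"
        have xF: "x \<in> F" unfolding x_def using that div diff by blast
        have "(s - s') * x = b' - b" using False by (simp add: x_def)
        moreover have "(s * x + b) - (s' * x + b') = (s - s') * x - (b' - b)" by (simp add: algebra_simps)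
        ultimately have "s * x + b = s' * x + b'" by simp
        then show ?thesis
          using xF by (intro exI[of _ "Inl (x, s * x + b)"]) (simp add: mem)
      qed
      have B: "\<exists>x. x \<in> slant s b \<and> x \<in> vert c" if "s \<in> F" "b \<in> F" "c \<in> F" for s b c
        by (rule exI[of _ "Inl (c, s * c + b)"]) (use that mem add mult in simp)
      have C: "\<exists>x. x \<in> slant s b \<and> x \<in> inf" if "s \<in> F" for s b
        by (rule exI[of _ "Inr (Some s)"]) (use that mem in simp)
      have D: "\<exists>x. x \<in> vert c \<and> x \<in> inf" "\<exists>x. x \<in> vert c \<and> x \<in> vert c'" "\<exists>x. x \<in> inf \<and> x \<in> inf" for c c'
        by (rule exI[of _ "Inr None"], simp add: mem)+
      have E: "\<exists>x. x \<in> vert c \<and> x \<in> slant s b" "\<exists>x. x \<in> inf \<and> x \<in> slant s b"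
        "\<exists>x. x \<in> inf \<and> x \<in> vert c" if "s \<in> F" "b \<in> F" "c \<in> F" for s b c
        using B[OF that] C[OF that(1)] D(1) by (simp_all only: conj_commute)
      show ?thesis
      proof (rule cases[OF that(1)])
        show ?thesis if "s \<in> F" "b \<in> F" "l = slant s b" for s b
          by (rule cases[OF \<open>l' \<in> lines\<close>]) (simp_all only: that A B C)
        show ?thesis if "c \<in> F" "l = vert c" for c
          by (rule cases[OF \<open>l' \<in> lines\<close>]) (simp_all only: that E D)
        show ?thesis if "l = inf"
          by (rule cases[OF \<open>l' \<in> lines\<close>]) (simp_all only: that E(2) E(3)[OF F(2,2)] D F(2))
      qed
    qed
    show "\<exists>l \<in> lines. z \<notin> l" if "z \<in> pts" for z
    proof (rule ptcases[OF that])
      show ?thesis if "z = Inl (x, y)" for x y using l3 mem(7)[of x y] that by metis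
      show ?thesis if "z = Inr (Some s)" for s using l2[OF F(2)] mem(5) that by metis
      show ?thesis if "z = Inr None" using l1[OF F(2,2)] mem(3) that by metis
    qed
  qed
  then show ?thesis by (intro exI)
qed

section \<open>Fields with a power of two elements\<close>

text \<open>
  The field consists of the roots of \<open>X ^ (2 ^ k) - X\<close>. All roots are simple because the derivative is
  \<open>-1\<close>, and they are closed under subtraction because squaring is additive in characteristic 2.
\<close>

lemma finite_field_of_order_2_power:
  assumes "k > 0"
  obtains F :: "bit alg_closure set"
  where "card F = 2 ^ k" "0 \<in> F" "1 \<in> F"
    "\<And>x y. x \<in> F \<Longrightarrow> y \<in> F \<Longrightarrow> x - y \<in> F"
    "\<And>x y. x \<in> F \<Longrightarrow> y \<in> F \<Longrightarrow> x * y \<in> F"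
    "\<And>x y. x \<in> F \<Longrightarrow> y \<in> F \<Longrightarrow> x / y \<in> F"
proof -
  define Q :: nat where "Q = 2 ^ k"
  have Q0: "Q > 0" by (simp add: Q_def)
  have two: "(2 :: bit alg_closure) = 0"
    using to_ac_numeral[of "Num.Bit0 Num.One", where ?'a = bit] by simp
  have neg: "- x = x" for x :: "bit alg_closure"
    using two by (metis add.inverse_unique mult_2 mult_zero_left)
  have add2: "(x + y) ^ 2 ^ j = x ^ 2 ^ j + y ^ 2 ^ j" for x y :: "bit alg_closure" and j
  proof (induction j)
    case (Suc j)
    have "(x + y) ^ 2 ^ Suc j = (x ^ 2 ^ j + y ^ 2 ^ j)\<^sup>2"
      by (simp add: Suc power_mult mult.commute[of 2])
    also have "\<dots> = (x ^ 2 ^ j)\<^sup>2 + (y ^ 2 ^ j)\<^sup>2"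
      by (simp add: power2_sum two)
    finally show ?case by (simp add: power_mult mult.commute[of 2])
  qed simp
  define F where "F = {x :: bit alg_closure. x ^ Q = x}"
  define p where "p = monom (1 :: bit alg_closure) Q - monom 1 1"
  have Q1: "Q > 1" using assms unfolding Q_def by (intro one_less_power) auto
    have deg: "degree p = Q"
      unfolding p_def diff_conv_add_uminus using Q1
      by (subst degree_add_eq_left) (simp_all add: degree_monom_eq)
    then have p0: "p \<noteq> 0" using Q0 by auto
    have F: "F = {x. poly p x = 0}"
      by (simp add: F_def p_def poly_monom)
    have Qz: "of_nat Q = (0 :: bit alg_closure)"
      using assms two by (simp add: Q_def)
    have der: "pderiv p = -1"
      by (simp add: p_def pderiv_diff pderiv_monom Qz monom_0 one_pCons)
    obtain A where A: "size A = degree p" "p = smult (lead_coeff p) (\<Prod>x\<in>#A. [:-x, 1:])"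
      using alg_closed_imp_factorization[OF p0] by auto
    have count: "count A x \<le> 1" for x
    proof (rule ccontr)
      assume "\<not> ?thesis"
      then have "{#x, x#} \<subseteq># A"
        by (intro mset_subset_eqI) auto
      then obtain A' where "A = {#x, x#} + A'"
        by (auto simp: subset_mset.le_iff_add)
      then have "[:-x, 1:] * [:-x, 1:] dvd p"
        by (subst A(2), intro dvd_smult)
          (simp add: mult.assoc[symmetric] del: mult_pCons_left mult_pCons_right)
      then obtain r where "p = [:-x, 1:] * ([:-x, 1:] * r)"
        by (metis dvdE mult.assoc)
      then have "poly (pderiv p) x = 0"
        by (simp add: pderiv_mult del: mult_pCons_left mult_pCons_right)
      then show False by (simp add: der)
    qed
    have "set_mset A = F"
      unfolding F by (subst A(2)) (use p0 in \<open>auto simp: poly_prod_mset prod_mset_zero_iff\<close>)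
    moreover have "card (set_mset A) = size A"
      using count
      by (simp add: size_multiset_overloaded_eq) (metis One_nat_def count_greater_zero_iff le_antisym Suc_leI card_eq_sum sum.cong)
    ultimately have card: "card F = 2 ^ k"
      using A deg by (simp add: Q_def)
    show thesis
    proof (rule that[of F, OF card])
      show "x - y \<in> F" if "x \<in> F" "y \<in> F" for x y
        using that add2[of x y k] neg[of y]
        by (metis (mono_tags, lifting) F_def Q_def diff_conv_add_uminus mem_Collect_eq)
    qed (use Q0 in \<open>auto simp: F_def power_mult_distrib power_divide\<close>)
qed

section \<open>Labels on the lines of a plane with outer vertices\<close>

text \<open>
  \<open>M\<close> is a line with a set \<open>P\<close> of \<open>a + 1\<close> chosen points, and \<open>Out\<close> is the set of outer vertices.

  A line in \<open>Thin\<close> misses \<open>P\<close> and gives up the class that misses its point on \<open>M\<close>. The edges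
  of this class are the pairs \<open>{b, mate l b}\<close> for \<open>b\<close> in \<open>heads l\<close>. Every point of \<open>M - P\<close> lies on \<open>a\<close>
  such lines, so that its \<open>q - a\<close> outer edges suffice for the remaining ones.

  A line in \<open>Up\<close> meets \<open>P\<close> and carries \<open>q\<close> classes by \<open>upgraded_factorization\<close>; the class that misses the
  head \<open>b\<close> in \<open>heads l\<close> uses the edge \<open>spare l b\<close>. This edge either comes from a thin line, or it is the
  edge between \<open>b\<close> and a point \<open>p\<close> of \<open>P\<close> on a line that is neither upgraded nor coned. A line in \<open>Coned\<close>
  passes through \<open>p0\<close> and carries \<open>q\<close> classes by \<open>coned_factorization\<close>, at most \<open>h\<close> of which need another
  edge at \<open>p0\<close>.

  The assumptions \<open>count\<close> and \<open>count0\<close> say that enough edges remain at each point of \<open>P\<close>; here a line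
  that is neither upgraded nor coned leaves one of its \<open>q\<close> edges at \<open>p\<close>, the term \<open>a - 1\<close> bounds the number of
  classes on \<open>M\<close> in which the partner of \<open>p\<close> lies in \<open>P\<close>, and \<open>q - 2\<close> is the balance at \<open>p0\<close> of the
  classes on \<open>M\<close> and of those on \<open>Out \<union> P\<close>. The last assumption adjusts the number of classes.
\<close>

locale pencil_scheme = projective_plane pts lines q
  for pts :: "'v set" and lines :: "'v set set" and q :: nat +
  fixes h a :: nat and M P Out :: "'v set" and p0 :: 'v
    and Thin Up Coned :: "'v set set" and heads :: "'v set \<Rightarrow> 'v set"
    and mate :: "'v set \<Rightarrow> 'v \<Rightarrow> 'v" and spare :: "'v set \<Rightarrow> 'v \<Rightarrow> 'v set"
  assumes q: "q = 2 * h" "h > 0" and a: "a < q"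
    and M: "M \<in> lines" and P: "P \<subseteq> M" "card P = Suc a" and p0: "p0 \<in> P"
    and Out: "finite Out" "Out \<inter> pts = {}" "card Out + a = q"
    and Thin: "l \<in> Thin \<Longrightarrow> l \<in> lines" "l \<in> Thin \<Longrightarrow> l \<inter> P = {}"
    and Thin_heads: "l \<in> Thin \<Longrightarrow> heads l \<subseteq> l - M" "l \<in> Thin \<Longrightarrow> card (heads l) = h"
      "l \<in> Thin \<Longrightarrow> bij_betw (mate l) (heads l) (l - M - heads l)"
    and card_Thin: "x \<in> M - P \<Longrightarrow> card (star x \<inter> Thin) = a"
    and Coned: "Coned \<subseteq> star p0 - {M}"
    and Up: "l \<in> Up \<Longrightarrow> l \<in> lines" "l \<in> Up \<Longrightarrow> l \<noteq> M" "l \<in> Up \<Longrightarrow> l \<inter> P \<noteq> {}" "Up \<inter> Coned = {}"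
    and Up_heads: "l \<in> Up \<Longrightarrow> heads l \<subseteq> l - M" "l \<in> Up \<Longrightarrow> card (heads l) = h"
    and spare: "l \<in> Up \<Longrightarrow> b \<in> heads l \<Longrightarrow>
        (\<exists>k \<in> Thin. b \<in> heads k \<and> spare l b = {b, mate k b}) \<or>
        (\<exists>p \<in> P. spare l b = {b, p} \<and> join b p \<notin> Up \<union> Coned)"
    and spare_inj: "l \<in> Up \<Longrightarrow> b \<in> heads l \<Longrightarrow> l' \<in> Up \<Longrightarrow> b' \<in> heads l' \<Longrightarrow>
        spare l b = spare l' b' \<Longrightarrow> l = l' \<and> b = b'"
    and count: "p \<in> P \<Longrightarrow> p \<noteq> p0 \<Longrightarrow>
        card {b. \<exists>l \<in> Up. b \<in> heads l \<and> spare l b = {b, p}} + (a - 1) \<le> card (star p - {M} - Up - Coned)"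
    and count0: "card {b. \<exists>l \<in> Up. b \<in> heads l \<and> spare l b = {b, p0}} + h * card Coned + (q - 2)
        \<le> card (star p0 - {M} - Up - Coned) + card Out"
    and total: "(\<Sum>p\<in>P. card (star p - {M} - Up - Coned)) + 2 = q + a\<^sup>2"
begin

definition outer :: "'v set" where "outer = Out \<union> P"
definition verts :: "'v set" where "verts = pts \<union> Out"
definition ext :: "'v set \<Rightarrow> bool" where "ext l \<longleftrightarrow> l \<in> lines \<and> l \<inter> P = {}"
definition normal :: "'v set \<Rightarrow> bool" where
  "normal l \<longleftrightarrow> l \<in> lines \<and> l \<noteq> M \<and> l \<inter> P \<noteq> {} \<and> l \<notin> Up \<and> l \<notin> Coned"
definition foot :: "'v set \<Rightarrow> 'v" where "foot l = (THE x. l \<inter> M = {x})"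
definition core :: "'v set \<Rightarrow> 'v set" where
  "core \<beta> = (if \<beta> = M \<or> \<beta> = outer then \<beta> - {p0} else \<beta> - M)"

text \<open>
  Blocks of this kind carry \<open>q - 1\<close> perfect matchings of their core. The line \<open>M\<close> and the block
  of outer vertices are treated like lines through \<open>p0\<close>.
\<close>

definition matched :: "'v set \<Rightarrow> bool" where
  "matched \<beta> \<longleftrightarrow> normal \<beta> \<or> \<beta> = M \<or> \<beta> = outer"

lemma finite_P: "finite P" using P M finite_line finite_subset by blast
lemma M_pts: "M \<subseteq> pts" using M line_subset by blast
lemma P_pts: "P \<subseteq> pts" using P M_pts by blast
lemma finite_verts: "finite verts" using finite_pts Out by (simp add: verts_def)
lemma Out_ne: "Out \<noteq> {}" using Out a by auto
lemma Out_pts: "o' \<in> Out \<Longrightarrow> o' \<notin> pts" using Out by blast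

lemma foot:
  assumes "l \<in> lines" "l \<noteq> M"
  shows "l \<inter> M = {foot l}"
proof -
  obtain x where "x \<in> l" "x \<in> M" using lines_meet assms M by blast
  then have "l \<inter> M = {x}" using line_unique[OF assms(1) M] assms by blast
  then show ?thesis by (simp add: foot_def)
qed

lemma foot_in:
  assumes "l \<in> lines" "l \<noteq> M"
  shows "foot l \<in> l" "foot l \<in> M" "x \<in> l \<Longrightarrow> x \<in> M \<Longrightarrow> x = foot l"
proof -
  note foot = foot[OF assms]
  show "foot l \<in> l" "foot l \<in> M" using foot by blast+
  assume "x \<in> l" "x \<in> M"
  then have "x \<in> l \<inter> M" by simp
  then show "x = foot l" unfolding foot by simp
qed

lemma foot_eq: "l \<in> lines \<Longrightarrow> l \<noteq> M \<Longrightarrow> x \<in> l \<Longrightarrow> x \<in> M \<Longrightarrow> foot l = x"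
  by (rule foot_in(3)[symmetric])

lemma diff_M: "l \<in> lines \<Longrightarrow> l \<noteq> M \<Longrightarrow> l - M = l - {foot l}"
  using foot_in by blast

lemma card_diff_M:
  assumes "l \<in> lines" "l \<noteq> M"
  shows "card (l - M) = q"
  using card_line[OF assms(1)] diff_M[OF assms] foot_in(1)[OF assms] by simp

lemma ext_ne_M: "ext l \<Longrightarrow> l \<noteq> M" using P p0 by (auto simp: ext_def)
lemma ext_lines: "ext l \<Longrightarrow> l \<in> lines" by (simp add: ext_def)
lemma ext_foot: "ext l \<Longrightarrow> foot l \<in> M - P"
  using foot_in(1,2)[of l] ext_ne_M[of l] unfolding ext_def by blast
lemma Thin_ext: "l \<in> Thin \<Longrightarrow> ext l" using Thin by (simp add: ext_def)

lemma outer_notin_lines: "outer \<notin> lines"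
  using Out_ne Out_pts line_subset by (auto simp: outer_def)
lemma not_ext_outer: "\<not> ext outer" using outer_notin_lines by (simp add: ext_def)
lemma not_normal_outer: "\<not> normal outer" using outer_notin_lines by (simp add: normal_def)
lemma outer_ne_M: "outer \<noteq> M" using outer_notin_lines M by blast

lemma Coned_line: "l \<in> Coned \<Longrightarrow> l \<in> lines \<and> l \<noteq> M \<and> p0 \<in> l"
  using Coned by (auto simp: star_def)
lemma Coned_foot: "l \<in> Coned \<Longrightarrow> foot l = p0"
  using foot_eq[of l p0] Coned_line[of l] p0 P by blast
lemma normal_foot: "normal l \<Longrightarrow> foot l \<in> P"
  using foot_in(3)[of l] P unfolding normal_def by blast

lemma line_cases:
  assumes "\<beta> \<in> insert outer lines"
  obtains "ext \<beta>" | "\<beta> \<in> Up" | "\<beta> \<in> Coned" | "matched \<beta>"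
  using assms by (auto simp: ext_def matched_def normal_def)

lemma kinds:
  "ext \<beta> \<Longrightarrow> \<beta> \<notin> Up" "ext \<beta> \<Longrightarrow> \<beta> \<notin> Coned" "ext \<beta> \<Longrightarrow> \<not> matched \<beta>"
  "\<beta> \<in> Up \<Longrightarrow> \<not> matched \<beta>" "\<beta> \<in> Coned \<Longrightarrow> \<not> matched \<beta>" "\<beta> \<in> Coned \<Longrightarrow> \<beta> \<notin> Up"
proof -
  show "ext \<beta> \<Longrightarrow> \<beta> \<notin> Up" using Up by (auto simp: ext_def)
  show "ext \<beta> \<Longrightarrow> \<beta> \<notin> Coned" using Coned_line p0 by (auto simp: ext_def)
  show "ext \<beta> \<Longrightarrow> \<not> matched \<beta>" using ext_ne_M not_ext_outer by (auto simp: matched_def ext_def normal_def)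
  show "\<beta> \<in> Up \<Longrightarrow> \<not> matched \<beta>" using Up outer_notin_lines by (auto simp: matched_def normal_def)
  show "\<beta> \<in> Coned \<Longrightarrow> \<not> matched \<beta>" using Coned_line outer_notin_lines by (auto simp: matched_def normal_def)
  show "\<beta> \<in> Coned \<Longrightarrow> \<beta> \<notin> Up" using Up by blast
qed

lemma core_normal: "normal l \<Longrightarrow> core l = l - M"
  using not_normal_outer by (auto simp: core_def normal_def)

lemma card_core:
  assumes "matched \<beta>"
  shows "finite (core \<beta>)" "card (core \<beta>) = q"
proof -
  have "finite (core \<beta>) \<and> card (core \<beta>) = q"
    using assms unfolding matched_def
  proof (elim disjE)
    assume "normal \<beta>"
    then show ?thesis using card_diff_M finite_line by (auto simp: core_normal normal_def)
  next
    assume "\<beta> = M"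
    then show ?thesis using M P p0 card_line finite_line by (auto simp: core_def)
  next
    assume \<beta>: "\<beta> = outer"
    have "card outer = Suc q"
      unfolding outer_def using Out P P_pts finite_P by (subst card_Un_disjoint) auto
    then show ?thesis using \<beta> p0 finite_P Out by (simp add: core_def outer_def)
  qed
  then show "finite (core \<beta>)" "card (core \<beta>) = q" by auto
qed

text \<open>
  What the factorization lemmas provide on a block, according to its kind. The point \<open>z\<close> stands for
  the colour that a block with \<open>q\<close> core points lacks, since it has only \<open>q - 1\<close> perfect matchings.
\<close>

definition line_colouring :: "'v set \<Rightarrow> ('v set \<Rightarrow> 'v) \<Rightarrow> 'v \<Rightarrow> bool" where
  "line_colouring \<beta> c z \<longleftrightarrow>
    (ext \<beta> \<longrightarrow> (\<forall>v \<in> \<beta>. \<forall>w \<in> \<beta>. v \<noteq> w \<longrightarrow> (\<exists>u \<in> \<beta>. u \<noteq> w \<and> c {w, u} = v)) \<and>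
      (\<beta> \<in> Thin \<longrightarrow> (\<forall>b \<in> heads \<beta>. c {b, mate \<beta> b} = foot \<beta>))) \<and>
    (\<beta> \<in> Up \<longrightarrow> (\<forall>v \<in> \<beta> - M. \<forall>w \<in> \<beta>. v \<noteq> w \<or> v \<notin> heads \<beta> \<longrightarrow> (\<exists>u \<in> \<beta>. u \<noteq> w \<and> c {w, u} = v))) \<and>
    (\<beta> \<in> Coned \<longrightarrow> (\<forall>v \<in> \<beta> - M. \<forall>w \<in> \<beta> - M. \<exists>u \<in> \<beta>. u \<noteq> w \<and> c {w, u} = v) \<and>
      card {v \<in> \<beta> - M. \<not> (\<exists>u \<in> \<beta> - M. c {p0, u} = v)} \<le> h) \<and>
    (matched \<beta> \<longrightarrow> z \<in> core \<beta> \<and>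
      (\<forall>v \<in> core \<beta> - {z}. \<forall>w \<in> core \<beta>. \<exists>u \<in> core \<beta>. u \<noteq> w \<and> c {w, u} = v))"

lemma line_colouring_exists:
  assumes "\<beta> \<in> insert outer lines"
  shows "\<exists>cz. line_colouring \<beta> (fst cz) (snd cz)"
  using assms
proof (cases rule: line_cases)
  case 1
  have card: "finite \<beta>" "card \<beta> = 2 * h + 1" using 1 card_line finite_line q by (auto simp: ext_def)
  have "\<exists>c. (\<forall>v \<in> \<beta>. \<forall>w \<in> \<beta>. v \<noteq> w \<longrightarrow> (\<exists>u \<in> \<beta>. u \<noteq> w \<and> c {w, u} = v)) \<and>
      (\<beta> \<in> Thin \<longrightarrow> (\<forall>b \<in> heads \<beta>. c {b, mate \<beta> b} = foot \<beta>))"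
  proof (cases "\<beta> \<in> Thin")
    case True
    have "\<beta> - M = \<beta> - {foot \<beta>}" "foot \<beta> \<in> \<beta>"
      using diff_M[of \<beta>] foot_in(1)[of \<beta>] 1 ext_ne_M[of \<beta>] by (simp_all add: ext_def)
    then show ?thesis
      using near_factorization_with_class[OF card, of "foot \<beta>" "heads \<beta>" "mate \<beta>"] Thin_heads[OF True]
      by metis
  next
    case False
    have "odd (card \<beta>)" using card by simp
    then obtain c where "\<And>v w. v \<in> \<beta> \<Longrightarrow> w \<in> \<beta> \<Longrightarrow> v \<noteq> w \<Longrightarrow> \<exists>u \<in> \<beta>. u \<noteq> w \<and> c {w, u} = v"
      using near_factorization[OF card(1)] by blast
    then show ?thesis using False by blast
  qed
  then obtain c where "(\<forall>v \<in> \<beta>. \<forall>w \<in> \<beta>. v \<noteq> w \<longrightarrow> (\<exists>u \<in> \<beta>. u \<noteq> w \<and> c {w, u} = v)) \<and>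
      (\<beta> \<in> Thin \<longrightarrow> (\<forall>b \<in> heads \<beta>. c {b, mate \<beta> b} = foot \<beta>))" ..
  then have "line_colouring \<beta> c undefined" using 1 kinds by (simp add: line_colouring_def)
  then show ?thesis by (metis fst_conv snd_conv)
next
  case 2
  have card: "finite \<beta>" "card \<beta> = 2 * h + 1" using 2 Up card_line finite_line q by auto
  have M': "\<beta> - M = \<beta> - {foot \<beta>}" "foot \<beta> \<in> \<beta>"
    using diff_M[of \<beta>] foot_in(1)[of \<beta>] Up(1,2)[OF 2] by simp_all
  then obtain c where "\<And>v w. v \<in> \<beta> - {foot \<beta>} \<Longrightarrow> w \<in> \<beta> \<Longrightarrow> v \<noteq> w \<or> v \<notin> heads \<beta> \<Longrightarrow> \<exists>u \<in> \<beta>. u \<noteq> w \<and> c {w, u} = v"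
    using upgraded_factorization[OF card, of "foot \<beta>" "heads \<beta>"] Up_heads[OF 2] by metis
  then have "line_colouring \<beta> c undefined" using 2 kinds M' by (auto simp: line_colouring_def)
  then show ?thesis by (metis fst_conv snd_conv)
next
  case 3
  have l: "\<beta> \<in> lines" "\<beta> \<noteq> M" "p0 \<in> \<beta>" using 3 Coned_line by auto
  have M': "insert p0 (\<beta> - M) = \<beta>" "p0 \<notin> \<beta> - M" using diff_M[OF l(1,2)] Coned_foot[OF 3] l by auto
  have card: "finite (\<beta> - M)" "card (\<beta> - M) = 2 * h" using l card_diff_M finite_line q by auto
  obtain c where
    "\<And>v w. v \<in> \<beta> - M \<Longrightarrow> w \<in> \<beta> - M \<Longrightarrow> \<exists>u \<in> insert p0 (\<beta> - M). u \<noteq> w \<and> c {w, u} = v"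
    "card {v \<in> \<beta> - M. \<not> (\<exists>u \<in> \<beta> - M. c {p0, u} = v)} \<le> h"
    using coned_factorization[OF card q(2) M'(2)] by blast
  then have "line_colouring \<beta> c undefined" using 3 kinds by (auto simp: line_colouring_def M')
  then show ?thesis by (metis fst_conv snd_conv)
next
  case 4
  then have card: "finite (core \<beta>)" "even (card (core \<beta>))" "core \<beta> \<noteq> {}"
    using card_core q by force+
  then obtain z where z: "z \<in> core \<beta>" by blast
  obtain c where "\<And>v w. v \<in> core \<beta> - {z} \<Longrightarrow> w \<in> core \<beta> \<Longrightarrow> \<exists>u \<in> core \<beta>. u \<noteq> w \<and> c {w, u} = v"
    using factorization[OF card(1,2) z] by blast
  then have "line_colouring \<beta> c z" using 4 kinds z by (auto simp: line_colouring_def)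
  then show ?thesis by (metis fst_conv snd_conv)
qed

definition colour :: "'v set \<Rightarrow> 'v set \<Rightarrow> 'v" where
  "colour \<beta> = fst (SOME cz. line_colouring \<beta> (fst cz) (snd cz))"
definition omitted :: "'v set \<Rightarrow> 'v" where
  "omitted \<beta> = snd (SOME cz. line_colouring \<beta> (fst cz) (snd cz))"

lemma colour_is_line_colouring: "\<beta> \<in> insert outer lines \<Longrightarrow> line_colouring \<beta> (colour \<beta>) (omitted \<beta>)"
  unfolding colour_def omitted_def using line_colouring_exists by (rule someI_ex)

lemma colour_ext: "ext \<beta> \<Longrightarrow> v \<in> \<beta> \<Longrightarrow> w \<in> \<beta> \<Longrightarrow> v \<noteq> w \<Longrightarrow> \<exists>u \<in> \<beta>. u \<noteq> w \<and> colour \<beta> {w, u} = v"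
  using colour_is_line_colouring[of \<beta>] by (auto simp: line_colouring_def ext_lines)
lemma colour_Thin: "\<beta> \<in> Thin \<Longrightarrow> b \<in> heads \<beta> \<Longrightarrow> colour \<beta> {b, mate \<beta> b} = foot \<beta>"
  using colour_is_line_colouring[of \<beta>] Thin_ext by (auto simp: line_colouring_def ext_lines)
lemma colour_Up: "\<beta> \<in> Up \<Longrightarrow> v \<in> \<beta> - M \<Longrightarrow> w \<in> \<beta> \<Longrightarrow> v \<noteq> w \<or> v \<notin> heads \<beta> \<Longrightarrow> \<exists>u \<in> \<beta>. u \<noteq> w \<and> colour \<beta> {w, u} = v"
  using colour_is_line_colouring[of \<beta>] Up unfolding line_colouring_def by blast
lemma colour_Coned: "\<beta> \<in> Coned \<Longrightarrow> v \<in> \<beta> - M \<Longrightarrow> w \<in> \<beta> - M \<Longrightarrow> \<exists>u \<in> \<beta>. u \<noteq> w \<and> colour \<beta> {w, u} = v"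
  "\<beta> \<in> Coned \<Longrightarrow> card {v \<in> \<beta> - M. \<not> (\<exists>u \<in> \<beta> - M. colour \<beta> {p0, u} = v)} \<le> h"
  using colour_is_line_colouring[of \<beta>] Coned_line[of \<beta>] unfolding line_colouring_def by blast+
lemma matched_block: "matched \<beta> \<Longrightarrow> \<beta> \<in> insert outer lines"
  using M by (auto simp: matched_def normal_def)
lemma colour_matched: "matched \<beta> \<Longrightarrow> omitted \<beta> \<in> core \<beta>"
  "matched \<beta> \<Longrightarrow> v \<in> core \<beta> - {omitted \<beta>} \<Longrightarrow> w \<in> core \<beta> \<Longrightarrow> \<exists>u \<in> core \<beta>. u \<noteq> w \<and> colour \<beta> {w, u} = v"
  using colour_is_line_colouring[OF matched_block, of \<beta>] unfolding line_colouring_def by blast+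

text \<open>
  A colour is named by a point of its block; on a line that misses \<open>P\<close> it is the point that the
  matching does not cover. A thin line drops the colour of its point on \<open>M\<close>.
\<close>

definition colours :: "'v set \<Rightarrow> 'v set" where
  "colours \<beta> = (if ext \<beta> then (if \<beta> \<in> Thin then \<beta> - M else \<beta>)
     else if matched \<beta> then core \<beta> - {omitted \<beta>} else \<beta> - M)"

definition labels :: "('v set \<times> 'v) set" where "labels = Sigma (insert outer lines) colours"

text \<open>
  Two blocks have an edge in common only if one of them is \<open>M\<close>, the other one is the outer block and
  the edge lies in \<open>P\<close>. Such edges are left to the outer block.
\<close>

definition coloured_edges :: "'v set \<Rightarrow> 'v set set" where
  "coloured_edges \<beta> = (if ext \<beta> then {e \<in> nsets \<beta> 2. \<beta> \<in> Thin \<longrightarrow> colour \<beta> e \<noteq> foot \<beta>}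
     else if matched \<beta> then {e \<in> nsets (core \<beta>) 2. \<beta> = M \<longrightarrow> \<not> e \<subseteq> P} else nsets \<beta> 2)"

lemma colours_simps:
  "ext \<beta> \<Longrightarrow> colours \<beta> = (if \<beta> \<in> Thin then \<beta> - M else \<beta>)"
  "\<beta> \<in> Up \<Longrightarrow> colours \<beta> = \<beta> - M" "\<beta> \<in> Coned \<Longrightarrow> colours \<beta> = \<beta> - M"
  "matched \<beta> \<Longrightarrow> colours \<beta> = core \<beta> - {omitted \<beta>}"
  unfolding colours_def using kinds[of \<beta>] by argo+

lemma coloured_edges_simps:
  "ext \<beta> \<Longrightarrow> coloured_edges \<beta> = {e \<in> nsets \<beta> 2. \<beta> \<in> Thin \<longrightarrow> colour \<beta> e \<noteq> foot \<beta>}"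
  "\<beta> \<in> Up \<Longrightarrow> coloured_edges \<beta> = nsets \<beta> 2" "\<beta> \<in> Coned \<Longrightarrow> coloured_edges \<beta> = nsets \<beta> 2"
  "matched \<beta> \<Longrightarrow> coloured_edges \<beta> = {e \<in> nsets (core \<beta>) 2. \<beta> = M \<longrightarrow> \<not> e \<subseteq> P}"
  unfolding coloured_edges_def using kinds[of \<beta>] by argo+

definition base :: "'v set \<Rightarrow> ('v set \<times> 'v) option" where
  "base e = (if \<exists>\<beta> \<in> insert outer lines. e \<in> coloured_edges \<beta>
     then let \<beta> = SOME \<beta>. \<beta> \<in> insert outer lines \<and> e \<in> coloured_edges \<beta> in Some (\<beta>, colour \<beta> e) else None)"

lemma core_subset: "core \<beta> \<subseteq> \<beta>" by (auto simp: core_def)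
lemma coloured_edges_subset: "e \<in> coloured_edges \<beta> \<Longrightarrow> e \<in> nsets \<beta> 2"
  using nsets_mono[OF core_subset] by (auto simp: coloured_edges_def split: if_splits)

lemma coloured_edges_disjoint:
  assumes "\<beta> \<in> insert outer lines" "\<beta>' \<in> insert outer lines" "e \<in> coloured_edges \<beta>" "e \<in> coloured_edges \<beta>'"
  shows "\<beta> = \<beta>'"
proof -
  obtain x y where e: "e = {x, y}" "x \<noteq> y" using coloured_edges_subset[OF assms(3)] by (auto simp: nsets_2_eq)
  have in\<beta>: "x \<in> \<beta>" "y \<in> \<beta>" "x \<in> \<beta>'" "y \<in> \<beta>'" using coloured_edges_subset assms(3,4) e by (auto simp: nsets_def)
  have *: False if "x \<in> outer" "y \<in> outer" "l \<in> lines" "x \<in> l" "y \<in> l" "e \<in> coloured_edges l" for l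
  proof -
    have "x \<in> P" "y \<in> P" using that line_subset Out_pts by (auto simp: outer_def)
    moreover have "l = M" using line_unique[OF that(3) M e(2)] that P \<open>x \<in> P\<close> \<open>y \<in> P\<close> by blast
    ultimately show False using that(6) e coloured_edges_simps(4)[of M] by (auto simp: matched_def)
  qed
  show ?thesis
  proof (cases "\<beta> = outer \<or> \<beta>' = outer")
    case True
    then show ?thesis using * in\<beta> assms by blast
  next
    case False
    then show ?thesis using line_unique[of \<beta> \<beta>' x y] in\<beta> e assms by blast
  qed
qed

lemma base_eq:
  assumes "\<beta> \<in> insert outer lines" "e \<in> coloured_edges \<beta>"
  shows "base e = Some (\<beta>, colour \<beta> e)"
proof -
  have "(SOME \<beta>. \<beta> \<in> insert outer lines \<and> e \<in> coloured_edges \<beta>) = \<beta>"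
    by (rule some_equality) (use assms coloured_edges_disjoint in blast)+
  then show ?thesis using assms by (auto simp: base_def Let_def)
qed

lemma base_None: "(\<And>\<beta>. \<beta> \<in> insert outer lines \<Longrightarrow> e \<notin> coloured_edges \<beta>) \<Longrightarrow> base e = None"
  by (auto simp: base_def)

lemma block_subset: "\<beta> \<in> insert outer lines \<Longrightarrow> \<beta> \<subseteq> verts"
  using line_subset P_pts by (auto simp: verts_def outer_def)

lemma touchesI:
  assumes "\<beta> \<in> insert outer lines" "{w, u} \<in> coloured_edges \<beta>" "colour \<beta> {w, u} = v" "u \<noteq> w"
  shows "touches base verts (\<beta>, v) w"
proof -
  have "w \<in> verts" "u \<in> verts" using coloured_edges_subset[OF assms(2)] block_subset[OF assms(1)] by (auto simp: nsets_def)
  then show ?thesis using base_eq[OF assms(1,2)] assms(3,4) by (auto simp: touches_def)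
qed

text \<open>
  The vertices of its own block that a label does not touch yet: these are the demands that
  free edges have to meet.
\<close>

lemma base_cover:
  assumes t: "(\<beta>, v) \<in> labels" and w: "w \<in> \<beta>"
  shows "touches base verts (\<beta>, v) w \<or> ext \<beta> \<and> w = v \<or> \<beta> \<in> Up \<and> w = v \<and> v \<in> heads \<beta> \<or> w \<in> P"
proof -
  have \<beta>: "\<beta> \<in> insert outer lines" and v: "v \<in> colours \<beta>" using t by (auto simp: labels_def)
  from \<beta> show ?thesis
  proof (cases rule: line_cases)
    case 1
    then have v': "v \<in> \<beta>" using v colours_simps(1) by (auto split: if_splits)
    show ?thesis
    proof (cases "w = v")
      case False
      then obtain u where u: "u \<in> \<beta>" "u \<noteq> w" "colour \<beta> {w, u} = v" using colour_ext 1 v' w by metis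
      have "v \<noteq> foot \<beta>" if "\<beta> \<in> Thin" using ext_foot[OF 1] v that 1 colours_simps(1) by auto
      then have "{w, u} \<in> coloured_edges \<beta>" using 1 u w by (auto simp: coloured_edges_simps)
      then show ?thesis using touchesI[OF \<beta> _ u(3,2)] by blast
    qed (use 1 in blast)
  next
    case 2
    then have v': "v \<in> \<beta> - M" using v colours_simps by metis
    show ?thesis
    proof (cases "v \<noteq> w \<or> v \<notin> heads \<beta>")
      case True
      then obtain u where u: "u \<in> \<beta>" "u \<noteq> w" "colour \<beta> {w, u} = v" using colour_Up[OF 2 v' w] by blast
      then have "{w, u} \<in> coloured_edges \<beta>" using 2 u w by (auto simp: coloured_edges_simps)
      then show ?thesis using touchesI[OF \<beta> _ u(3,2)] by blast
    qed (use 2 in blast)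
  next
    case 3
    then have v': "v \<in> \<beta> - M" using v colours_simps by metis
    show ?thesis
    proof (cases "w \<in> M")
      case True
      then show ?thesis using foot_eq Coned_foot Coned_line 3 w p0 by metis
    next
      case False
      then obtain u where u: "u \<in> \<beta>" "u \<noteq> w" "colour \<beta> {w, u} = v" using colour_Coned(1)[OF 3 v', of w] w by blast
      then have "{w, u} \<in> coloured_edges \<beta>" using 3 u w by (auto simp: coloured_edges_simps)
      then show ?thesis using touchesI[OF \<beta> _ u(3,2)] by blast
    qed
  next
    case 4
    then have v': "v \<in> core \<beta> - {omitted \<beta>}" using v colours_simps by metis
    show ?thesis
    proof (cases "w \<in> core \<beta>")
      case True
      then obtain u where u: "u \<in> core \<beta>" "u \<noteq> w" "colour \<beta> {w, u} = v" using colour_matched(2)[OF 4 v'] by blast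
      show ?thesis
      proof (cases "w \<in> P")
        case False
        then have "{w, u} \<in> coloured_edges \<beta>" using 4 True u by (auto simp: coloured_edges_simps)
        then show ?thesis using touchesI[OF \<beta> _ u(3,2)] by blast
      qed blast
    next
      case False
      then have "w \<in> P"
        using 4 w p0 normal_foot[of \<beta>] foot_eq[of \<beta> w] unfolding matched_def core_def normal_def
        by (metis DiffI singletonD)
      then show ?thesis by blast
    qed
  qed
qed

end

section \<open>Completing the labels by counting free edges\<close>

context pencil_scheme begin

text \<open>
  The edges from \<open>p\<close> to these points are spare edges of upgraded lines and no longer free.
\<close>

definition given :: "'v \<Rightarrow> 'v set" where "given p = {b. \<exists>l \<in> Up. b \<in> heads l \<and> spare l b = {b, p}}"
definition normals :: "'v \<Rightarrow> 'v set set" where "normals p = star p - {M} - Up - Coned"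

text \<open>
  An edge between \<open>p0\<close> and another point of \<open>P\<close> is at the disposal of \<open>p0\<close> alone, so that the free edges
  of different points are disjoint.
\<close>

definition free_at :: "'v \<Rightarrow> 'v set" where
  "free_at p = ((\<Union>l\<in>normals p. l - M) - given p) \<union> (if p = p0 then (M - {p0}) \<union> Out else {})"

text \<open>
  There is a slot for every point and a slot for every head of an upgraded line. At a point off \<open>P\<close>,
  the demand comes from the lines that miss \<open>P\<close>. It must be met by edges to \<open>Out\<close> because only these
  make the class meet the classes on the outer block.
\<close>

definition demand :: "'v + 'v set \<times> 'v \<Rightarrow> ('v set \<times> 'v) set" where
  "demand j = (case j of
     Inl v \<Rightarrow> if v \<in> P then {t \<in> labels. v \<in> fst t \<and> \<not> touches base verts t v} else (\<lambda>l. (l, v)) ` {l. ext l \<and> v \<in> colours l}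
   | Inr (l, b) \<Rightarrow> {(l, b)})"
definition offer :: "'v + 'v set \<times> 'v \<Rightarrow> 'v set set" where
  "offer j = (case j of
     Inl v \<Rightarrow> if v \<in> P then (\<lambda>y. {v, y}) ` free_at v else (\<lambda>y. {v, y}) ` Out
   | Inr (l, b) \<Rightarrow> {spare l b})"
definition slots :: "('v + 'v set \<times> 'v) set" where "slots = Inl ` pts \<union> Inr ` Sigma Up heads"

lemma normals: "p \<in> P \<Longrightarrow> l \<in> normals p \<longleftrightarrow> normal l \<and> p \<in> l"
  by (auto simp: normals_def star_def normal_def)

lemma finite_labels: "finite labels"
proof -
  have "finite (colours \<beta>)" if "\<beta> \<in> insert outer lines" for \<beta>
  proof -
    have "finite \<beta>" using block_subset[OF that] finite_verts finite_subset by blast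
    moreover have "colours \<beta> \<subseteq> \<beta>" using core_subset by (auto simp: colours_def)
    ultimately show ?thesis using finite_subset by blast
  qed
  then show ?thesis unfolding labels_def using finite_lines by (intro finite_SigmaI) auto
qed

lemma spare_cases:
  assumes "l \<in> Up" "b \<in> heads l"
  obtains k where "k \<in> Thin" "b \<in> heads k" "spare l b = {b, mate k b}" "mate k b \<in> k - M - heads k" "b \<in> pts - M" "b \<in> k"
  | p where "p \<in> P" "spare l b = {b, p}" "join b p \<in> normals p" "b \<in> pts - M" "b \<in> join b p"
proof -
  have b: "b \<in> pts - M" using Up_heads(1)[OF assms(1)] Up(1)[OF assms(1)] assms(2) line_subset by blast
  from spare[OF assms] show thesis
  proof
    assume "\<exists>k \<in> Thin. b \<in> heads k \<and> spare l b = {b, mate k b}"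
    then obtain k where k: "k \<in> Thin" "b \<in> heads k" "spare l b = {b, mate k b}" by blast
    have "mate k b \<in> k - M - heads k" using Thin_heads(3)[OF k(1)] k(2) by (auto simp: bij_betw_def)
    moreover have "b \<in> k" using Thin_heads(1)[OF k(1)] k(2) by blast
    ultimately show thesis using that(1) k b by blast
  next
    assume "\<exists>p \<in> P. spare l b = {b, p} \<and> join b p \<notin> Up \<union> Coned"
    then obtain p where p: "p \<in> P" "spare l b = {b, p}" "join b p \<notin> Up \<union> Coned" by blast
    have "b \<noteq> p" "p \<in> pts" using b p(1) P P_pts by auto
    then have j: "join b p \<in> lines" "b \<in> join b p" "p \<in> join b p" using join b by auto
    then have "join b p \<noteq> M" using b by blast
    then have "join b p \<in> normals p" using j p by (auto simp: normals_def star_def)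
    then show thesis using that(2) p b j by blast
  qed
qed

lemma free_out: "v \<in> pts - P \<Longrightarrow> y \<in> Out \<Longrightarrow> base {v, y} = None"
proof (rule base_None)
  fix \<beta> assume v: "v \<in> pts - P" and y: "y \<in> Out" and \<beta>: "\<beta> \<in> insert outer lines"
  show "{v, y} \<notin> coloured_edges \<beta>"
  proof
    assume "{v, y} \<in> coloured_edges \<beta>"
    then have in\<beta>: "v \<in> \<beta>" "y \<in> \<beta>" using coloured_edges_subset[of "{v, y}" \<beta>] by (auto simp: nsets_def)
    then have "\<beta> \<notin> lines" using y Out_pts line_subset by blast
    then have "\<beta> = outer" using \<beta> by blast
    then show False using in\<beta>(1) v Out_pts by (auto simp: outer_def)
  qed
qed

lemma coloured_edges_line:
  assumes "\<beta> \<in> insert outer lines" "{x, y} \<in> coloured_edges \<beta>" "l \<in> lines" "x \<in> l" "y \<in> l" "x \<noteq> y" "x \<notin> outer \<or> y \<notin> outer"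
  shows "\<beta> = l"
proof -
  have in\<beta>: "x \<in> \<beta>" "y \<in> \<beta>" using coloured_edges_subset[OF assms(2)] by (auto simp: nsets_def)
  then have "\<beta> \<in> lines" using assms(1,7) by blast
  then show ?thesis using line_unique[OF _ assms(3,6)] in\<beta> assms(4,5) by blast
qed

lemma notin_outer: "x \<in> pts - M \<Longrightarrow> x \<notin> outer"
  using P Out_pts by (auto simp: outer_def)

lemma finite_normals: "finite (normals p)" by (simp add: normals_def finite_star)

lemma normals_line: "l \<in> normals p \<Longrightarrow> l \<in> lines \<and> p \<in> l \<and> l \<noteq> M"
  by (auto simp: normals_def star_def)

text \<open>
  A line that is neither upgraded nor coned leaves its edges at \<open>p\<close> uncoloured, as they
  do not lie in its core.
\<close>

lemma coloured_edges_normals: "p \<in> P \<Longrightarrow> l \<in> normals p \<Longrightarrow> {x, p} \<notin> coloured_edges l"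
proof
  assume p: "p \<in> P" and l: "l \<in> normals p" and d: "{x, p} \<in> coloured_edges l"
  have n: "normal l" using normals[OF p] l by blast
  then have "{x, p} \<in> nsets (l - M) 2"
    using d coloured_edges_simps(4)[of l] core_normal[OF n] by (simp add: matched_def)
  then show False using p P by (auto simp: nsets_def)
qed

lemma free_P:
  assumes p: "p \<in> P" and y: "y \<in> free_at p"
  shows "base {p, y} = None"
proof (rule base_None)
  fix \<beta> assume \<beta>: "\<beta> \<in> insert outer lines"
  show "{p, y} \<notin> coloured_edges \<beta>"
  proof
    assume d: "{p, y} \<in> coloured_edges \<beta>"
    then have in\<beta>: "p \<in> \<beta>" "y \<in> \<beta>" "p \<noteq> y" using coloured_edges_subset[OF d] by (auto simp: nsets_2_eq doubleton_eq_iff)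
    consider l where "l \<in> normals p" "y \<in> l - M" | "p = p0" "y \<in> M - {p0}" | "p = p0" "y \<in> Out"
      using y by (auto simp: free_at_def split: if_splits)
    then show False
    proof cases
      case 1
      then have "y \<in> pts - M" using normals_line line_subset by blast
      then have "\<beta> = l" using coloured_edges_line[OF \<beta> d, of l] 1 normals_line[OF 1(1)] in\<beta>(3) notin_outer by blast
      then show False using coloured_edges_normals[OF p 1(1), of y] d by (simp add: insert_commute)
    next
      case 2
      have "matched \<beta> \<and> p0 \<notin> core \<beta>"
      proof (cases "\<beta> = outer")
        case True
        then show ?thesis by (simp add: matched_def core_def)
      next
        case False
        then have "\<beta> \<in> lines" using \<beta> by blast
        then have "\<beta> = M" using line_unique[OF _ M in\<beta>(3)] in\<beta> 2 p P by blast
        then show ?thesis by (simp add: matched_def core_def)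
      qed
      then show False using d 2(1) coloured_edges_simps(4)[of \<beta>] by (auto simp: nsets_def)
    next
      case 3
      then have "\<beta> \<notin> lines" using in\<beta> Out_pts line_subset by blast
      then have "\<beta> = outer" using \<beta> by blast
      then show False using d 3(1) coloured_edges_simps(4)[of outer] by (auto simp: matched_def core_def nsets_def)
    qed
  qed
qed

lemma free_spare:
  assumes l: "l \<in> Up" "b \<in> heads l"
  shows "base (spare l b) = None"
proof (rule base_None)
  fix \<beta> assume \<beta>: "\<beta> \<in> insert outer lines"
  show "spare l b \<notin> coloured_edges \<beta>"
    using l
  proof (cases rule: spare_cases)
    case (1 k)
    show ?thesis
    proof
      assume "spare l b \<in> coloured_edges \<beta>"
      then have d: "{b, mate k b} \<in> coloured_edges \<beta>" using 1 by simp
      have "b \<noteq> mate k b" using 1 by auto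
      then have "\<beta> = k" using coloured_edges_line[OF \<beta> d, of k] 1 Thin(1)[OF 1(1)] notin_outer by blast
      then show False using d coloured_edges_simps(1)[OF Thin_ext[OF 1(1)]] colour_Thin[OF 1(1,2)] 1(1) by simp
    qed
  next
    case (2 p)
    show ?thesis
    proof
      assume "spare l b \<in> coloured_edges \<beta>"
      then have d: "{b, p} \<in> coloured_edges \<beta>" using 2 by simp
      have "b \<noteq> p" using 2 P by blast
      then have "\<beta> = join b p" using coloured_edges_line[OF \<beta> d, of "join b p"] 2 normals_line[OF 2(3)] notin_outer by blast
      then show False using d coloured_edges_normals[OF 2(1,3)] by simp
    qed
  qed
qed

lemma free_slots: "j \<in> slots \<Longrightarrow> e \<in> offer j \<Longrightarrow> base e = None"
  by (auto simp: slots_def offer_def free_out free_P free_spare split: if_splits)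

lemma slots_disjoint:
  assumes "i \<in> slots" "j \<in> slots" "i \<noteq> j"
  shows "offer i \<inter> offer j = {}"
proof -
  have vv: "offer (Inl v) \<inter> offer (Inl w) = {}" if "v \<in> pts" "w \<in> pts" "v \<noteq> w" for v w
  proof -
    have "{v, y} \<noteq> {w, z}" if "y \<in> Out" "z \<in> Out" for y z
      using that \<open>v \<in> pts\<close> \<open>w \<in> pts\<close> \<open>v \<noteq> w\<close> Out_pts by (auto simp: doubleton_eq_iff)
    moreover have "{v', y} \<noteq> {w', z}" if "v' \<in> P" "w' \<in> pts - P" "y \<in> free_at v'" "z \<in> Out" for v' w' y z
      using that Out_pts P_pts by (auto simp: doubleton_eq_iff)
    moreover have "{v, y} \<noteq> {w, z}" if "v \<in> P" "w \<in> P" "y \<in> free_at v" "z \<in> free_at w" for y z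
    proof
      assume "{v, y} = {w, z}"
      then have "y = w" "z = v" using \<open>v \<noteq> w\<close> by (auto simp: doubleton_eq_iff)
      then have "v = p0" "w = p0"
        using that P P_pts Out_pts by (auto simp: free_at_def split: if_splits)
      then show False using \<open>v \<noteq> w\<close> by simp
    qed
    ultimately show ?thesis using that by (auto simp: offer_def split: if_splits) metis+
  qed
  have vs: "offer (Inl v) \<inter> offer (Inr (l, b)) = {}" if "v \<in> pts" "l \<in> Up" "b \<in> heads l" for v l b
    using that(2,3)
  proof (cases rule: spare_cases)
    case (1 k)
    have "mate k b \<in> pts" using 1 Thin(1) line_subset by blast
    then have "spare l b \<noteq> {v, y}" if "y \<in> Out" for y using 1 that Out_pts by (auto simp: doubleton_eq_iff)
    moreover have "spare l b \<noteq> {v, y}" if "v \<in> P" for y using 1 that P by (auto simp: doubleton_eq_iff)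
    ultimately show ?thesis by (auto simp: offer_def split: if_splits)
  next
    case (2 p)
    have "spare l b \<noteq> {v, y}" if "y \<in> Out" for y using 2 that Out_pts P_pts by (auto simp: doubleton_eq_iff)
    moreover have "spare l b \<noteq> {v, y}" if "v \<in> P" "y \<in> free_at v" for y
    proof
      assume eq: "spare l b = {v, y}"
      then have "v = p" "y = b" using 2 that P by (auto simp: doubleton_eq_iff)
      then have "b \<in> given v" using 2 that \<open>l \<in> Up\<close> \<open>b \<in> heads l\<close> by (auto simp: given_def)
      then show False using that(2) 2 \<open>y = b\<close> Out_pts by (auto simp: free_at_def split: if_splits)
    qed
    ultimately show ?thesis by (auto simp: offer_def split: if_splits)
  qed
  have ss: "offer (Inr (l, b)) \<inter> offer (Inr (l', b')) = {}" if "l \<in> Up" "b \<in> heads l" "l' \<in> Up" "b' \<in> heads l'" "(l, b) \<noteq> (l', b')" for l b l' b'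
    using spare_inj[OF that(1-4)] that(5) by (auto simp: offer_def)
  have sv: "offer (Inr (l, b)) \<inter> offer (Inl v) = {}" if "v \<in> pts" "l \<in> Up" "b \<in> heads l" for v l b
    using vs[OF that] by blast
  from assms show ?thesis
    unfolding slots_def using vv vs sv ss by (elim UnE imageE SigmaE) simp_all
qed

text \<open>
  Off \<open>M\<close> a point is joined to \<open>P\<close> by \<open>a + 1\<close> different lines, which leaves \<open>q - a\<close>. On \<open>M\<close> there are
  \<open>q\<close> lines that miss \<open>P\<close>, but \<open>a\<close> of them have given up the class in question.
\<close>

lemma card_demand_off_P:
  assumes v: "v \<in> pts - P"
  shows "card {l. ext l \<and> v \<in> colours l} \<le> card Out"
proof (cases "v \<in> M")
  case True
  have "{l. ext l \<and> v \<in> colours l} \<subseteq> (star v - {M}) - (star v \<inter> Thin)"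
  proof
    fix l assume l: "l \<in> {l. ext l \<and> v \<in> colours l}"
    then have "l \<notin> Thin" "v \<in> l" using True colours_simps(1)[of l] by (auto split: if_splits)
    then show "l \<in> (star v - {M}) - (star v \<inter> Thin)" using l ext_ne_M by (auto simp: star_def ext_def)
  qed
  then have "card {l. ext l \<and> v \<in> colours l} \<le> card ((star v - {M}) - (star v \<inter> Thin))"
    using finite_star by (intro card_mono) auto
  also have "\<dots> = card (star v - {M}) - card (star v \<inter> Thin)"
    using finite_star Thin_ext ext_ne_M by (intro card_Diff_subset) auto
  also have "\<dots> = q - a" using card_star_Diff[OF M True] card_Thin[of v] v True by simp
  finally show ?thesis using Out by simp
next
  case False
  have ne: "v \<noteq> p" "p \<in> pts" if "p \<in> P" for p using that v P_pts by auto
  have "{l. ext l \<and> v \<in> colours l} \<subseteq> star v - join v ` P"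
  proof
    fix l assume l: "l \<in> {l. ext l \<and> v \<in> colours l}"
    then have "v \<in> l" using colours_simps(1)[of l] by (auto split: if_splits)
    then show "l \<in> star v - join v ` P" using l join ne v by (auto simp: star_def ext_def)
  qed
  then have "card {l. ext l \<and> v \<in> colours l} \<le> card (star v - join v ` P)"
    using finite_star by (intro card_mono) auto
  also have "\<dots> = card (star v) - card (join v ` P)"
    using join ne v finite_P by (intro card_Diff_subset) (auto simp: star_def)
  also have "card (join v ` P) = Suc a"
  proof -
    have "inj_on (join v) P"
    proof (rule inj_onI, rule ccontr)
      fix p p' assume pp: "p \<in> P" "p' \<in> P" "join v p = join v p'" "p \<noteq> p'"
      have j: "join v p \<in> lines" "v \<in> join v p" "p \<in> join v p" using join[of v p] ne pp(1) v by auto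
      have "p' \<in> join v p" using join[of v p'] ne pp(2,3) v by auto
      then have "join v p = M" using line_unique[OF j(1) M pp(4) j(3)] pp P by blast
      then show False using j False by blast
    qed
    then show ?thesis using P by (simp add: card_image)
  qed
  also have "card (star v) - Suc a = q - a" using card_star[of v] v by simp
  finally show ?thesis using Out by simp
qed

lemma card_normals_union: "p \<in> P \<Longrightarrow> card (\<Union>l\<in>normals p. l - M) = q * card (normals p)"
proof -
  assume p: "p \<in> P"
  have "card (\<Union>l\<in>normals p. l - M) = (\<Sum>l\<in>normals p. card (l - M))"
  proof (rule card_UN_disjoint)
    show "finite (normals p)" by (simp add: normals_def finite_star)
    show "\<forall>l\<in>normals p. finite (l - M)" using normals_line finite_line by blast
    show "\<forall>l\<in>normals p. \<forall>k\<in>normals p. l \<noteq> k \<longrightarrow> (l - M) \<inter> (k - M) = {}"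
    proof (intro ballI impI)
      fix l k assume lk: "l \<in> normals p" "k \<in> normals p" "l \<noteq> k"
      show "(l - M) \<inter> (k - M) = {}"
      proof (rule ccontr)
        assume "(l - M) \<inter> (k - M) \<noteq> {}"
        then obtain x where "x \<in> l" "x \<in> k" "x \<notin> M" by blast
        moreover have "x \<noteq> p" using calculation p P by blast
        ultimately show False using line_unique[of l k x p] normals_line lk by blast
      qed
    qed
  qed
  also have "\<dots> = (\<Sum>l\<in>normals p. q)" using normals_line card_diff_M by (intro sum.cong) auto
  finally show ?thesis by simp
qed

lemma free_at_subset: "p \<in> P \<Longrightarrow> free_at p \<subseteq> verts - {p}"
proof
  fix y assume p: "p \<in> P" and y: "y \<in> free_at p"
  consider l where "l \<in> normals p" "y \<in> l - M" | "p = p0" "y \<in> M - {p0}" | "p = p0" "y \<in> Out"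
    using y by (auto simp: free_at_def split: if_splits)
  then show "y \<in> verts - {p}"
  proof cases
    case 1
    then show ?thesis using normals_line line_subset p P by (auto simp: verts_def)
  next
    case 2
    then show ?thesis using M_pts by (auto simp: verts_def)
  next
    case 3
    then show ?thesis using Out_pts P_pts p by (auto simp: verts_def)
  qed
qed

lemma finite_free_at: "p \<in> P \<Longrightarrow> finite (free_at p)"
  using free_at_subset finite_verts by (meson finite_Diff finite_subset)

lemma finite_given: "finite (given p)"
proof -
  have "given p \<subseteq> pts" using Up_heads(1) Up(1) line_subset by (fastforce simp: given_def)
  then show ?thesis using finite_pts finite_subset by blast
qed

lemma card_free_at:
  assumes p: "p \<in> P"
  shows "q * card (normals p) + (if p = p0 then q + card Out else 0) \<le> card (free_at p) + card (given p)"
proof -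
  let ?A = "\<Union>l\<in>normals p. l - M"
  let ?B = "if p = p0 then (M - {p0}) \<union> Out else {}"
  have fin: "finite ?A" "finite ?B"
    using finite_normals normals_line finite_line M Out by auto
  have "card ?A - card (given p) \<le> card (?A - given p)"
    using finite_given by (rule diff_card_le_card_Diff)
  moreover have "card (free_at p) = card (?A - given p) + card ?B"
    unfolding free_at_def using fin normals_line line_subset Out_pts
    by (intro card_Un_disjoint) (auto split: if_splits, blast)
  moreover have "card ?B = (if p = p0 then q + card Out else 0)"
  proof (cases "p = p0")
    case True
    have "card ((M - {p0}) \<union> Out) = card (M - {p0}) + card Out"
      using M finite_line Out M_pts by (intro card_Un_disjoint) auto
    then show ?thesis using True card_line[OF M] p0 P finite_line[OF M] by auto
  qed simp
  moreover have "card ?A = q * card (normals p)" by (rule card_normals_union[OF p])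
  ultimately show ?thesis by linarith
qed

lemma card_colours_matched: "matched \<beta> \<Longrightarrow> finite (colours \<beta>) \<and> card (colours \<beta>) = q - 1"
  using card_core[of \<beta>] colour_matched(1)[of \<beta>] colours_simps(4)[of \<beta>] by simp

text \<open>
  The labels that do not touch \<open>p\<close>: all of those on normal lines through \<open>p\<close>; if \<open>p = p0\<close>, all of those on
  \<open>M\<close> and on the outer block and some on the coned lines; and otherwise only those on \<open>M\<close> whose
  matching pairs \<open>p\<close> with another point of \<open>P\<close>.
\<close>

lemma demand_on_P:
  assumes p: "p \<in> P" and t: "(\<beta>, v) \<in> demand (Inl p)"
  shows "\<beta> \<in> normals p \<and> v \<in> colours \<beta> \<or> p = p0 \<and> \<beta> \<in> {M, outer} \<and> v \<in> colours \<beta>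
    \<or> p = p0 \<and> \<beta> \<in> Coned \<and> v \<in> {v \<in> \<beta> - M. \<not> (\<exists>u \<in> \<beta> - M. colour \<beta> {p0, u} = v)}
    \<or> p \<noteq> p0 \<and> \<beta> = M \<and> v \<in> (\<lambda>p'. colour M {p, p'}) ` (P - {p, p0})"
proof -
  have t': "(\<beta>, v) \<in> labels" "p \<in> \<beta>" "\<not> touches base verts (\<beta>, v) p" using t p by (auto simp: demand_def)
  have \<beta>: "\<beta> \<in> insert outer lines" and v: "v \<in> colours \<beta>" using t' by (auto simp: labels_def)
  from \<beta> show ?thesis
  proof (cases rule: line_cases)
    case 1
    then show ?thesis using t' p by (auto simp: ext_def)
  next
    case 2
    then have v': "v \<in> \<beta> - M" using v colours_simps by metis
    then have "v \<noteq> p" using p P by blast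
    then obtain u where "u \<in> \<beta>" "u \<noteq> p" "colour \<beta> {p, u} = v" using colour_Up[OF 2 v' t'(2)] by blast
    then have False using touchesI[OF \<beta>, of p u v] t' 2 by (auto simp: coloured_edges_simps)
    then show ?thesis ..
  next
    case 3
    then have v': "v \<in> \<beta> - M" using v colours_simps by metis
    have l: "\<beta> \<in> lines" "\<beta> \<noteq> M" "p0 \<in> \<beta>" using Coned_line 3 by auto
    have "p = p0" using foot_in(3)[OF l(1,2) t'(2)] Coned_foot[OF 3] p P by blast
    moreover have "colour \<beta> {p0, u} \<noteq> v" if "u \<in> \<beta> - M" for u
    proof
      assume "colour \<beta> {p0, u} = v"
      moreover have "u \<noteq> p0" using that p0 P by blast
      ultimately show False using touchesI[OF \<beta>, of p0 u v] t' 3 that l \<open>p = p0\<close> by (auto simp: coloured_edges_simps)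
    qed
    ultimately show ?thesis using 3 v' by blast
  next
    case 4
    show ?thesis
    proof (cases "p \<in> core \<beta>")
      case False
      show ?thesis
      proof (cases "\<beta> = M \<or> \<beta> = outer")
        case True
        then have "p = p0" using False t' by (auto simp: core_def)
        then show ?thesis using True v by blast
      next
        case False
        then have "normal \<beta>" using 4 by (simp add: matched_def)
        then show ?thesis using normals[OF p] t' v by blast
      qed
    next
      case True
      have v': "v \<in> core \<beta> - {omitted \<beta>}" using v colours_simps(4)[OF 4] by simp
      obtain u where u: "u \<in> core \<beta>" "u \<noteq> p" "colour \<beta> {p, u} = v" using colour_matched(2)[OF 4 v' True] by blast
      have "{p, u} \<notin> coloured_edges \<beta>" using touchesI[OF \<beta> _ u(3,2)] t' by blast
      then have "\<beta> = M" "{p, u} \<subseteq> P" using u True coloured_edges_simps(4)[OF 4] by auto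
      moreover have "u \<noteq> p0" "p \<noteq> p0" using u True \<open>\<beta> = M\<close> by (auto simp: core_def)
      ultimately show ?thesis using u by blast
    qed
  qed
qed

lemma finite_Coned: "finite Coned" using Coned finite_star finite_subset by blast

lemma card_demand_on_P:
  assumes p: "p \<in> P" "p \<noteq> p0"
  shows "card (demand (Inl p)) \<le> card (normals p) * (q - 1) + (a - 1)"
proof -
  have fin: "finite (colours l) \<and> card (colours l) = q - 1" if "l \<in> normals p" for l
    using card_colours_matched normals[OF p(1)] that by (auto simp: matched_def)
  have "demand (Inl p) \<subseteq> Sigma (normals p) colours \<union> Pair M ` (\<lambda>p'. colour M {p, p'}) ` (P - {p, p0})"
    using demand_on_P[OF p(1)] p(2) by fastforce
  then have "card (demand (Inl p)) \<le> card (Sigma (normals p) colours \<union> Pair M ` (\<lambda>p'. colour M {p, p'}) ` (P - {p, p0}))"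
    using fin finite_normals finite_P by (intro card_mono finite_UnI finite_SigmaI) auto
  also have "\<dots> \<le> card (Sigma (normals p) colours) + card (Pair M ` (\<lambda>p'. colour M {p, p'}) ` (P - {p, p0}))"
    by (rule card_Un_le)
  also have "card (Pair M ` (\<lambda>p'. colour M {p, p'}) ` (P - {p, p0})) \<le> card (P - {p, p0})"
    using finite_P by (meson card_image_le finite_Diff finite_imageI le_trans)
  also have "card (P - {p, p0}) = a - 1" using p p0 P finite_P by (simp add: card_Diff_subset)
  also have "card (Sigma (normals p) colours) = card (normals p) * (q - 1)"
    using fin finite_normals by (subst card_SigmaI) auto
  finally show ?thesis by simp
qed

lemma card_demand_p0: "card (demand (Inl p0)) \<le> card (normals p0) * (q - 1) + h * card Coned + 2 * (q - 1)"
proof -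
  let ?D = "\<lambda>\<beta>. {v \<in> \<beta> - M. \<not> (\<exists>u \<in> \<beta> - M. colour \<beta> {p0, u} = v)}"
  have fin: "finite (colours l) \<and> card (colours l) = q - 1" if "l \<in> normals p0 \<union> {M, outer}" for l
    using card_colours_matched normals[OF p0] that by (auto simp: matched_def)
  have D: "finite (?D l) \<and> card (?D l) \<le> h" if "l \<in> Coned" for l
    using colour_Coned(2)[OF that] Coned_line[OF that] finite_line by auto
  have "demand (Inl p0) \<subseteq> Sigma (normals p0) colours \<union> Sigma Coned ?D \<union> Sigma {M, outer} colours"
    using demand_on_P[OF p0] by fastforce
  then have "card (demand (Inl p0)) \<le> card (Sigma (normals p0) colours \<union> Sigma Coned ?D \<union> Sigma {M, outer} colours)"
    using fin D finite_normals finite_Coned by (intro card_mono finite_UnI finite_SigmaI) auto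
  also have "\<dots> \<le> card (Sigma (normals p0) colours) + card (Sigma Coned ?D) + card (Sigma {M, outer} colours)"
    by (meson card_Un_le add_le_mono1 le_trans)
  also have "card (Sigma (normals p0) colours) = card (normals p0) * (q - 1)"
    using fin finite_normals by (subst card_SigmaI) auto
  also have "card (Sigma {M, outer} colours) = 2 * (q - 1)"
    using fin outer_ne_M by (subst card_SigmaI) auto
  also have "card (Sigma Coned ?D) \<le> h * card Coned"
    using D finite_Coned sum_bounded_above[of Coned "\<lambda>l. card (?D l)" h] by (subst card_SigmaI) (auto simp: mult.commute)
  finally show ?thesis by simp
qed

lemma card_slots:
  assumes "j \<in> slots"
  shows "finite (demand j) \<and> finite (offer j)" "card (demand j) \<le> card (offer j)"
proof -
  have inj: "card ((\<lambda>y. {v, y}) ` A) = card A" for v :: 'v and A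
    by (rule card_image) (auto simp: inj_on_def doubleton_eq_iff)
  have "(finite (demand j) \<and> finite (offer j)) \<and> card (demand j) \<le> card (offer j)"
  proof (cases j)
    case (Inr lb)
    then show ?thesis by (cases lb) (simp add: demand_def offer_def)
  next
    case (Inl v)
    then have v: "v \<in> pts" using assms by (auto simp: slots_def)
    show ?thesis
    proof (cases "v \<in> P")
      case False
      have "finite {l. ext l \<and> v \<in> colours l}" using finite_lines by (rule finite_subset[rotated]) (auto simp: ext_def)
      moreover have "card ((\<lambda>l. (l, v)) ` {l. ext l \<and> v \<in> colours l}) = card {l. ext l \<and> v \<in> colours l}"
        by (rule card_image) (auto simp: inj_on_def)
      ultimately show ?thesis
        using False Inl v card_demand_off_P[of v] Out by (simp add: demand_def offer_def inj)
    next
      case True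
      have offer: "offer j = (\<lambda>y. {v, y}) ` free_at v" using True Inl by (simp add: offer_def)
      have fin: "finite (demand j)" using finite_labels True Inl by (simp add: demand_def)
      have "card (demand j) \<le> card (free_at v)"
      proof (cases "v = p0")
        case True
        have "card (normals p0) * (q - 1) + card (normals p0) = q * card (normals p0)"
          using q by (cases q) (auto simp: algebra_simps)
        then show ?thesis
          using True Inl card_demand_p0 card_free_at[OF p0] count0 q a by (simp add: normals_def[symmetric] given_def[symmetric])
      next
        case False
        have "card (normals v) * (q - 1) + card (normals v) = q * card (normals v)"
          using q by (cases q) (auto simp: algebra_simps)
        then show ?thesis
          using False Inl \<open>v \<in> P\<close> card_demand_on_P[of v] card_free_at[of v] count[of v]
          by (simp add: normals_def[symmetric] given_def[symmetric])
      qed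
      then show ?thesis using offer fin finite_free_at True by (simp add: inj)
    qed
  qed
  then show "finite (demand j) \<and> finite (offer j)" "card (demand j) \<le> card (offer j)" by auto
qed

text \<open>
  Two lines have a point in common. A label on a line that misses \<open>P\<close> touches an outer vertex,
  and every other line has a point in \<open>P\<close>, so the labels on the outer block meet all others.
\<close>

lemma complete_labels:
  obtains cl where "\<And>t t'. t \<in> labels \<Longrightarrow> t' \<in> labels \<Longrightarrow> \<exists>v. touches cl verts t v \<and> touches cl verts t' v"
proof -
  obtain cl where cl: "\<And>e t. base e = Some t \<Longrightarrow> cl e = Some t"
    "\<And>j t. j \<in> slots \<Longrightarrow> t \<in> demand j \<Longrightarrow> \<exists>e \<in> offer j. cl e = Some t"
    using extend_by_tokens[of slots demand offer base] card_slots free_slots slots_disjoint by blast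
  have keep: "touches cl verts t w" if "touches base verts t w" for t w
    using that cl(1) unfolding touches_def by blast
  have ext_tok: "touches cl verts (\<beta>, v) v \<and> (\<exists>y \<in> Out. touches cl verts (\<beta>, v) y)"
    if t: "(\<beta>, v) \<in> labels" and e: "ext \<beta>" for \<beta> v
  proof -
    have v: "v \<in> colours \<beta>" using t by (auto simp: labels_def)
    then have v\<beta>: "v \<in> \<beta>" using colours_simps(1)[OF e] by (auto split: if_splits)
    then have vp: "v \<in> pts" "v \<notin> P" using e line_subset by (auto simp: ext_def)
    have "(\<beta>, v) \<in> demand (Inl v)" using vp e v by (simp add: demand_def)
    then obtain y where y: "y \<in> Out" "cl {v, y} = Some (\<beta>, v)"
      using cl(2)[of "Inl v"] vp by (auto simp: slots_def offer_def)
    have "y \<noteq> v" using y vp Out_pts by auto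
    then have "touches cl verts (\<beta>, v) v" using y vp by (auto simp: touches_def verts_def)
    moreover have "touches cl verts (\<beta>, v) y"
      using y vp \<open>y \<noteq> v\<close> by (auto simp: touches_def verts_def insert_commute)
    ultimately show ?thesis using y by blast
  qed
  have cover: "touches cl verts (\<beta>, v) w" if t: "(\<beta>, v) \<in> labels" and w: "w \<in> \<beta>" for \<beta> v w
  proof -
    consider "touches base verts (\<beta>, v) w" | "ext \<beta>" "w = v" | "\<beta> \<in> Up" "w = v" "v \<in> heads \<beta>"
      | "w \<in> P" "\<not> touches base verts (\<beta>, v) w"
      using base_cover[OF t w] by blast
    then show ?thesis
    proof cases
      case 3
      then have "(\<beta>, v) \<in> demand (Inr (\<beta>, v))" "Inr (\<beta>, v) \<in> slots" by (auto simp: demand_def slots_def)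
      then have e: "cl (spare \<beta> v) = Some (\<beta>, v)" using cl(2)[of "Inr (\<beta>, v)"] by (auto simp: offer_def)
      have "\<exists>y \<in> verts. y \<noteq> v \<and> v \<in> verts \<and> spare \<beta> v = {v, y}"
        using 3(1,3)
      proof (cases rule: spare_cases)
        case (1 k)
        then show ?thesis using Thin(1)[OF 1(1)] line_subset[of k]
          by (intro bexI[of _ "mate k v"]) (auto simp: verts_def)
      next
        case (2 p)
        then show ?thesis using P P_pts by (intro bexI[of _ p]) (auto simp: verts_def)
      qed
      then show ?thesis using e 3 by (auto simp: touches_def)
    next
      case 4
      then have "(\<beta>, v) \<in> demand (Inl w)" "Inl w \<in> slots" using t w P_pts by (auto simp: demand_def slots_def)
      then obtain y where y: "y \<in> free_at w" "cl {w, y} = Some (\<beta>, v)"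
        using cl(2)[of "Inl w"] 4(1) by (auto simp: offer_def)
      have "y \<in> verts" "y \<noteq> w" using free_at_subset[OF 4(1)] y(1) by auto
      then show ?thesis using y 4 P_pts by (auto simp: touches_def verts_def)
    qed (use keep ext_tok t in auto)
  qed
  show thesis
  proof (rule that[of cl])
    fix t t' assume tT: "t \<in> labels" "t' \<in> labels"
    obtain \<beta> v where t: "t = (\<beta>, v)" by (cases t)
    obtain \<beta>' v' where t': "t' = (\<beta>', v')" by (cases t')
    have \<beta>: "\<beta> \<in> insert outer lines" "\<beta>' \<in> insert outer lines" using tT t t' by (auto simp: labels_def)
    have outer_line: "\<exists>x. touches cl verts (l, u) x \<and> touches cl verts (outer, w) x"
      if "(l, u) \<in> labels" "(outer, w) \<in> labels" "l \<in> lines" for l u w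
    proof (cases "ext l")
      case True
      then show ?thesis using ext_tok[OF that(1)] cover[OF that(2)] by (auto simp: outer_def)
    next
      case False
      then obtain x where "x \<in> l" "x \<in> P" using \<open>l \<in> lines\<close> unfolding ext_def by blast
      then show ?thesis using cover[OF that(1)] cover[OF that(2)] by (auto simp: outer_def)
    qed
    show "\<exists>x. touches cl verts t x \<and> touches cl verts t' x"
    proof (cases "\<beta> = outer"; cases "\<beta>' = outer")
      assume "\<beta> = outer" "\<beta>' = outer"
      then show ?thesis using cover tT t t' p0 by (auto simp: outer_def)
    next
      assume "\<beta> = outer" "\<beta>' \<noteq> outer"
      then show ?thesis using outer_line[of \<beta>' v' v] tT \<beta> t t' by blast
    next
      assume "\<beta> \<noteq> outer" "\<beta>' = outer"
      then show ?thesis using outer_line[of \<beta> v v'] tT \<beta> t t' by blast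
    next
      assume "\<beta> \<noteq> outer" "\<beta>' \<noteq> outer"
      then obtain x where "x \<in> \<beta>" "x \<in> \<beta>'" using lines_meet \<beta> by blast
      then show ?thesis using cover tT t t' by blast
    qed
  qed
qed

text \<open>
  The colours are added up over the pencils at the points of \<open>M\<close>; the assumption \<open>total\<close> supplies the
  number of normal lines.
\<close>

lemma card_labels: "card labels = q * (q + 1)\<^sup>2 - 2 * a * q"
proof -
  have finC: "finite (colours \<beta>)" if "\<beta> \<in> insert outer lines" for \<beta>
  proof -
    have "colours \<beta> \<subseteq> \<beta>" using core_subset by (auto simp: colours_def)
    then show ?thesis using block_subset[OF that] finite_verts finite_subset by (metis order_trans)
  qed
  have "card labels = (\<Sum>\<beta>\<in>insert outer lines. card (colours \<beta>))"
    unfolding labels_def using finC finite_lines by (intro card_SigmaI) auto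
  also have "\<dots> = card (colours outer) + (\<Sum>l\<in>lines. card (colours l))"
    using outer_notin_lines finite_lines by simp
  also have "card (colours outer) = q - 1" using card_colours_matched by (simp add: matched_def)
  also have "(\<Sum>l\<in>lines. card (colours l)) = card (colours M) + (\<Sum>x\<in>M. \<Sum>l\<in>star x - {M}. card (colours l))"
    by (rule sum_lines[OF M])
  also have "card (colours M) = q - 1" using card_colours_matched by (simp add: matched_def)
  also have "(\<Sum>x\<in>M. \<Sum>l\<in>star x - {M}. card (colours l)) =
      (\<Sum>x\<in>M - P. \<Sum>l\<in>star x - {M}. card (colours l)) + (\<Sum>x\<in>P. \<Sum>l\<in>star x - {M}. card (colours l))"
    using P finite_line[OF M] by (simp add: sum.subset_diff)
  also have "(\<Sum>x\<in>M - P. \<Sum>l\<in>star x - {M}. card (colours l)) = (\<Sum>x\<in>M - P. a * q + (q - a) * (q + 1))"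
  proof (rule sum.cong)
    fix x assume x: "x \<in> M - P"
    have ext: "ext l" if "l \<in> star x - {M}" for l
    proof -
      have l: "l \<in> lines" "l \<noteq> M" "x \<in> l" using that by (auto simp: star_def)
      have "p = x" if "p \<in> l" "p \<in> P" for p
        using foot_in(3)[OF l(1,2)] that x P l by blast
      then show ?thesis using l x by (auto simp: ext_def)
    qed
    have DM: "star x \<inter> Thin \<subseteq> star x - {M}" using Thin_ext ext_ne_M by auto
    have "(\<Sum>l\<in>star x - {M}. card (colours l)) =
        (\<Sum>l\<in>(star x - {M}) - (star x \<inter> Thin). card (colours l)) + (\<Sum>l\<in>star x \<inter> Thin. card (colours l))"
      using DM finite_star by (intro sum.subset_diff) auto
    also have "(\<Sum>l\<in>star x \<inter> Thin. card (colours l)) = (\<Sum>l\<in>star x \<inter> Thin. q)"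
      using colours_simps(1)[OF Thin_ext] card_diff_M Thin(1) ext_ne_M[OF Thin_ext] by (intro sum.cong) auto
    also have "(\<Sum>l\<in>(star x - {M}) - (star x \<inter> Thin). card (colours l)) = (\<Sum>l\<in>(star x - {M}) - (star x \<inter> Thin). q + 1)"
      using colours_simps(1)[OF ext] card_line by (intro sum.cong) (auto simp: star_def)
    finally have *: "(\<Sum>l\<in>star x - {M}. card (colours l)) =
        (\<Sum>l\<in>(star x - {M}) - (star x \<inter> Thin). q + 1) + (\<Sum>l\<in>star x \<inter> Thin. q)" .
    have "card ((star x - {M}) - (star x \<inter> Thin)) = q - a"
      using DM finite_star card_star_Diff[OF M, of x] card_Thin[OF x] x finite_subset[OF DM]
      by (subst card_Diff_subset) auto
    then show "(\<Sum>l\<in>star x - {M}. card (colours l)) = a * q + (q - a) * (q + 1)"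
      unfolding * using card_Thin[OF x] by simp
  qed simp
  also have "\<dots> = (q - a) * (a * q + (q - a) * (q + 1))"
    using P card_line[OF M] finite_P by (simp add: card_Diff_subset)
  also have "(\<Sum>x\<in>P. \<Sum>l\<in>star x - {M}. card (colours l)) = (\<Sum>x\<in>P. q * q - card (normals x))"
  proof (rule sum.cong)
    fix p assume p: "p \<in> P"
    have sub: "normals p \<subseteq> star p - {M}" by (auto simp: normals_def)
    have "(\<Sum>l\<in>star p - {M}. card (colours l)) = (\<Sum>l\<in>(star p - {M}) - normals p. card (colours l)) + (\<Sum>l\<in>normals p. card (colours l))"
      using sub finite_star by (intro sum.subset_diff) auto
    also have "(\<Sum>l\<in>normals p. card (colours l)) = (\<Sum>l\<in>normals p. q - 1)"
      using card_colours_matched normals[OF p] by (intro sum.cong) (auto simp: matched_def)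
    also have "(\<Sum>l\<in>(star p - {M}) - normals p. card (colours l)) = (\<Sum>l\<in>(star p - {M}) - normals p. q)"
    proof (rule sum.cong)
      fix l assume l: "l \<in> (star p - {M}) - normals p"
      then have "l \<in> Up \<or> l \<in> Coned" "l \<in> lines" "l \<noteq> M" by (auto simp: normals_def star_def)
      moreover from this have "colours l = l - M" using colours_simps(2,3)[of l] by blast
      ultimately show "card (colours l) = q" using card_diff_M[of l] by simp
    qed simp
    finally have *: "(\<Sum>l\<in>star p - {M}. card (colours l)) =
        (\<Sum>l\<in>(star p - {M}) - normals p. q) + (\<Sum>l\<in>normals p. q - 1)" .
    have "card ((star p - {M}) - normals p) = q - card (normals p)"
      using sub finite_normals card_star_Diff[OF M, of p] p P by (subst card_Diff_subset) auto
    then have **: "(\<Sum>l\<in>star p - {M}. card (colours l)) = (q - card (normals p)) * q + card (normals p) * (q - 1)"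
      unfolding * by simp
    have "card (normals p) \<le> q" using card_mono[OF _ sub] finite_star card_star_Diff[OF M, of p] p P by auto
    then obtain d where d: "q = card (normals p) + d" using le_Suc_ex by blast
    obtain r where r: "q = Suc r" using a by (cases q) auto
    have "int (d * q + card (normals p) * r) = int (q * q) - int (card (normals p))"
    proof -
      have "int d = int q - int (card (normals p))" "int r = int q - 1" using d r by auto
      then show ?thesis by (simp only: of_nat_add of_nat_mult) (simp add: algebra_simps)
    qed
    then have "d * q + card (normals p) * r = q * q - card (normals p)" by linarith
    moreover have "q - card (normals p) = d" "q - 1 = r" using d r by auto
    ultimately show "(\<Sum>l\<in>star p - {M}. card (colours l)) = q * q - card (normals p)"
      unfolding ** by simp
  qed simp
  finally have eq: "card labels = q - 1 + (q - 1 + ((q - a) * (a * q + (q - a) * (q + 1)) + (\<Sum>x\<in>P. q * q - card (normals x))))" .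
  have le: "card (normals x) \<le> q * q" if "x \<in> P" for x
  proof -
    have "card (normals x) \<le> card (star x - {M})" using finite_star by (intro card_mono) (auto simp: normals_def)
    then show ?thesis using card_star_Diff[OF M, of x] that P le_square[of q] by (metis le_trans subsetD)
  qed
  have "int (\<Sum>x\<in>P. q * q - card (normals x)) = (\<Sum>x\<in>P. int q * int q - int (card (normals x)))"
    using le by (simp add: of_nat_diff)
  also have "\<dots> = (int a + 1) * (int q * int q) - int (\<Sum>x\<in>P. card (normals x))"
    using P by (simp add: sum_subtractf algebra_simps)
  also have "int (\<Sum>x\<in>P. card (normals x)) = int q + int a ^ 2 - 2"
    using arg_cong[OF total, of int] by (simp add: normals_def)
  finally have s: "int (\<Sum>x\<in>P. q * q - card (normals x)) = (int a + 1) * (int q * int q) - (int q + int a ^ 2 - 2)" .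
  obtain d where d: "q = Suc (a + d)" using a less_imp_Suc_add by blast
  have "int (card labels) = int q * (int q + 1)\<^sup>2 - 2 * int a * int q"
    unfolding eq of_nat_add s by (simp add: d power2_eq_square algebra_simps)
  then have "int (card labels + 2 * a * q) = int (q * (q + 1)\<^sup>2)"
    by (simp add: algebra_simps)
  then have "card labels + 2 * a * q = q * (q + 1)\<^sup>2"
    by (rule of_nat_eq_iff[THEN iffD1])
  from arg_cong[OF this, of "\<lambda>n. n - 2 * a * q"] show ?thesis
    unfolding diff_add_inverse2 .
qed

theorem psi_lower: "q * (q + 1)\<^sup>2 - 2 * a * q \<le> psi ((q + 1)\<^sup>2 - a)"
proof -
  have "card verts = card pts + card Out"
    unfolding verts_def using finite_pts Out by (intro card_Un_disjoint) auto
  moreover have "(q + 1)\<^sup>2 = card pts + q"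
    unfolding card_pts by (simp add: power2_eq_square)
  ultimately have verts: "card verts = (q + 1)\<^sup>2 - a"
    using Out(3) by linarith
  show ?thesis
  proof (rule complete_labels)
    fix cl :: "'v set \<Rightarrow> ('v set \<times> 'v) option"
    assume "\<And>t t'. t \<in> labels \<Longrightarrow> t' \<in> labels \<Longrightarrow> \<exists>v. touches cl verts t v \<and> touches cl verts t' v"
    then have "card labels \<le> psi (card verts)" by (rule card_le_psi_of_meeting_labels[OF finite_verts])
    then show ?thesis unfolding verts card_labels .
  qed
qed

end

section \<open>Lower bounds for the three kinds of parameters\<close>

context projective_plane begin

lemma meet_unique: "l \<in> lines \<Longrightarrow> l' \<in> lines \<Longrightarrow> l \<noteq> l' \<Longrightarrow> x \<in> l \<Longrightarrow> x \<in> l' \<Longrightarrow> y \<in> l \<Longrightarrow> y \<in> l' \<Longrightarrow> x = y"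
  using line_unique by blast

lemma line_exists: "\<exists>M. M \<in> lines"
  using line_avoiding pts_nonempty by blast

text \<open>
  Here \<open>P\<close> has a single point \<open>p0\<close>, no matching is given up, and two lines through \<open>p0\<close> are coned. This
  uses up exactly the edges that the other blocks leave at \<open>p0\<close>.
\<close>

lemma psi_lower_0:
  assumes q: "q = 2 * h" "h > 0" and Out: "finite Out" "Out \<inter> pts = {}" "card Out = q"
  shows "q * (q + 1)\<^sup>2 \<le> psi ((q + 1)\<^sup>2)"
proof -
  obtain M where M: "M \<in> lines" using line_exists by blast
  have "card M = Suc q" using card_line M by simp
  then obtain p0 where p0: "p0 \<in> M" by fastforce
  have "2 \<le> card (star p0 - {M})" using card_star_Diff[OF M p0] q by simp
  then obtain Coned where Coned: "Coned \<subseteq> star p0 - {M}" "card Coned = 2" "finite Coned"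
    by (rule obtain_subset_with_card_n)
  have normals: "card (star p0 - {M} - {} - Coned) = q - 2"
    using Coned card_star_Diff[OF M p0] finite_star by (simp add: card_Diff_subset)
  interpret pencil_scheme pts lines q h 0 M "{p0}" Out p0 "{}" "{}" Coned "\<lambda>_. {}" "\<lambda>_ _. p0" "\<lambda>_ _. {}"
  proof
    show "card {b. \<exists>l\<in>{}. b \<in> {} \<and> {} = {b, p0}} + h * card Coned + (q - 2)
        \<le> card (star p0 - {M} - {} - Coned) + card Out"
      unfolding normals using Coned Out q by simp
    show "(\<Sum>p\<in>{p0}. card (star p - {M} - {} - Coned)) + 2 = q + 0\<^sup>2"
      using normals q by simp
  qed (use q M p0 Out Coned in auto)
  show ?thesis using psi_lower by simp
qed

text \<open>
  The points of \<open>P\<close> are \<open>pp 0, \<dots>, pp a\<close>. On a line \<open>d'\<close> through \<open>pp 1\<close> choose points \<open>cc 1, \<dots>, cc a\<close> off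
  \<open>M\<close>, and let the thin lines be the lines \<open>L k x\<close> that join \<open>cc k\<close> to the points \<open>x\<close> of \<open>W = M - P\<close>. For
  each \<open>k \<ge> 1\<close>, upgrade \<open>q - a\<close> lines through \<open>pp k\<close> that avoid \<open>cc k\<close>. Two lines \<open>L k x\<close> and \<open>L k y\<close> meet such
  a line in different points, since they already meet in \<open>cc k\<close>. So a bipartite relation between \<open>W\<close>
  and these lines in which all degrees are \<open>h\<close> selects \<open>h\<close> heads both on every thin line and on every upgraded
  line. The line \<open>d'\<close> is upgraded as well. Its spare edges end in \<open>P\<close>: each point \<open>pp k\<close> with \<open>k \<ge> 2\<close> can
  afford one, namely to \<open>cc k\<close>, and \<open>pp 0\<close> provides the others. Finally one line through \<open>pp 0\<close> is coned.
\<close>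

lemma psi_lower_pos:
  assumes q: "q = 2 * h" "h > 0" and a: "1 \<le> a" "a \<le> h"
    and Out: "finite Out" "Out \<inter> pts = {}" "card Out + a = q"
  shows "q * (q + 1)\<^sup>2 - 2 * a * q \<le> psi ((q + 1)\<^sup>2 - a)"
proof -
  let ?K = "{1..a}"
  define N where "N = q - a"
  have N: "h \<le> N" "N \<le> q - 1" "q = N + a" using q a by (auto simp: N_def)
  obtain M where M: "M \<in> lines" using line_exists by blast
  have finM: "finite M" and cM: "card M = Suc q" using card_line finite_line M by auto
  have Mpts: "M \<subseteq> pts" using M line_subset by blast
  have "card {..a} \<le> card M" using cM a q by simp
  then obtain pp where pp: "pp ` {..a} \<subseteq> M" "inj_on pp {..a}"
    using card_le_inj[of "{..a}" M] finM by auto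
  have ppM: "pp k \<in> M" if "k \<le> a" for k using pp that by auto
  have ppeq: "pp k = pp j \<longleftrightarrow> k = j" if "k \<le> a" "j \<le> a" for k j
    using pp(2) that by (auto simp: inj_on_def)
  define P where "P = pp ` {..a}"
  define W where "W = M - P"
  have P: "P \<subseteq> M" "card P = Suc a" "finite P" using pp by (auto simp: P_def card_image)
  have W: "finite W" "card W = N" "W \<subseteq> M"
    using P finM cM by (auto simp: W_def N_def card_Diff_subset)
  have "card (star (pp 1) - {M}) = q" using card_star_Diff[OF M ppM] a by simp
  then have "card (star (pp 1) - {M}) \<noteq> 0" using q by simp
  then have "star (pp 1) - {M} \<noteq> {}" by (metis card.empty)
  then obtain d' where d': "d' \<in> lines" "d' \<noteq> M" "pp 1 \<in> d'" by (auto simp: star_def)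
  have d'M: "x = pp 1" if "x \<in> d'" "x \<in> M" for x
    using meet_unique[OF d'(1) M d'(2) that d'(3) ppM[OF a(1)]] .
  have "d' - M = d' - {pp 1}" using d'M d'(3) ppM[OF a(1)] by blast
  then have cd': "card (d' - M) = q" using card_line[OF d'(1)] d'(3) by simp
  have find': "finite (d' - M)" using finite_line[OF d'(1)] by simp
  have "card ?K \<le> card (d' - M)" using cd' a q by simp
  then obtain cc where cc: "cc ` ?K \<subseteq> d' - M" "inj_on cc ?K"
    using card_le_inj[of ?K "d' - M"] find' by auto
  have ccd: "cc k \<in> d'" "cc k \<notin> M" "cc k \<in> pts" if "k \<in> ?K" for k
  proof -
    have "cc k \<in> d' - M" using cc(1) that by blast
    then show "cc k \<in> d'" "cc k \<notin> M" "cc k \<in> pts" using line_subset[OF d'(1)] by auto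
  qed
  define L where "L k x = join (cc k) x" for k x
  have L: "L k x \<in> lines" "cc k \<in> L k x" "x \<in> L k x" "L k x \<noteq> M" if "k \<in> ?K" "x \<in> M" for k x
  proof -
    have "cc k \<noteq> x" "x \<in> pts" using ccd[OF that(1)] that Mpts by auto
    then show "L k x \<in> lines" "cc k \<in> L k x" "x \<in> L k x"
      using join[OF ccd(3)[OF that(1)]] by (auto simp: L_def)
    then show "L k x \<noteq> M" using ccd(2)[OF that(1)] by blast
  qed
  have LM: "y = x" if "k \<in> ?K" "x \<in> M" "y \<in> L k x" "y \<in> M" for k x y
    using meet_unique[OF L(1)[OF that(1,2)] M L(4)[OF that(1,2)] that(3,4) L(3)[OF that(1,2)] that(2)] .
  have Wpp: "pp k \<notin> W" if "k \<le> a" for k using that by (auto simp: W_def P_def)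
  have L_inj: "k = j \<and> x = y" if kj: "k \<in> ?K" "j \<in> ?K" "x \<in> W" "y \<in> W" "L k x = L j y" for k j x y
  proof -
    have xy: "x \<in> M" "y \<in> M" using kj W by auto
    have "x = y" using LM[OF kj(2) xy(2), of x] L(3)[OF kj(1) xy(1)] kj(5) xy by simp
    moreover have "k = j"
    proof (rule ccontr)
      assume "k \<noteq> j"
      then have "cc k \<noteq> cc j" using inj_on_eq_iff[OF cc(2) kj(1,2)] by blast
      moreover have "cc j \<in> L k x" using L(2)[OF kj(2) xy(2)] kj(5) by simp
      ultimately have "L k x = d'"
        using line_unique[OF L(1)[OF kj(1) xy(1)] d'(1)] L(2)[OF kj(1) xy(1)]
          ccd(1)[OF kj(1)] ccd(1)[OF kj(2)] by blast
      then have "x = pp 1" using d'M L(3)[OF kj(1) xy(1)] xy by blast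
      then show False using Wpp[OF a(1)] kj by blast
    qed
    ultimately show ?thesis by blast
  qed
  \<comment> \<open>the lines to be upgraded; leaving out \<open>L k (pp k)\<close> keeps \<open>cc k\<close> off them\<close>
  have "\<forall>k. \<exists>S. k \<in> ?K \<longrightarrow> S \<subseteq> star (pp k) - {M} - {L k (pp k)} \<and> card S = N"
  proof (intro allI)
    fix k
    show "\<exists>S. k \<in> ?K \<longrightarrow> S \<subseteq> star (pp k) - {M} - {L k (pp k)} \<and> card S = N"
    proof (cases "k \<in> ?K")
      case True
      then have "pp k \<in> M" using ppM by simp
      then have "L k (pp k) \<in> star (pp k) - {M}" using L[OF True] by (auto simp: star_def)
      then have "card (star (pp k) - {M} - {L k (pp k)}) = q - 1"
        using card_star_Diff[OF M \<open>pp k \<in> M\<close>] by simp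
      then show ?thesis using N(2) by (metis obtain_subset_with_card_n)
    qed blast
  qed
  then obtain Uk where Uk: "\<And>k. k \<in> ?K \<Longrightarrow> Uk k \<subseteq> star (pp k) - {M} - {L k (pp k)}"
    "\<And>k. k \<in> ?K \<Longrightarrow> card (Uk k) = N" by metis
  have finU: "finite (Uk k)" if "k \<in> ?K" for k using Uk(1)[OF that] finite_star finite_subset by blast
  have U0: "l \<in> lines" "l \<noteq> M" "pp k \<in> l" "cc k \<notin> l" if "k \<in> ?K" "l \<in> Uk k" for k l
  proof -
    show l: "l \<in> lines" "l \<noteq> M" "pp k \<in> l" using Uk(1)[OF that(1)] that(2) by (auto simp: star_def)
    have k: "pp k \<in> M" using ppM that by simp
    show "cc k \<notin> l"
    proof
      assume "cc k \<in> l"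
      moreover have "cc k \<noteq> pp k" using ccd(2)[OF that(1)] k by auto
      ultimately have "l = L k (pp k)"
        using line_unique[OF l(1) L(1)[OF that(1) k]] l(3) L(2,3)[OF that(1) k] by blast
      then show False using Uk(1)[OF that(1)] that(2) by blast
    qed
  qed
  have UM: "x = pp k" if "k \<in> ?K" "l \<in> Uk k" "x \<in> l" "x \<in> M" for k l x
    using meet_unique[OF U0(1)[OF that(1,2)] M U0(2)[OF that(1,2)] that(3,4) U0(3)[OF that(1,2)] ppM] that(1) by simp
  have Uk_unique: "k = j" if "k \<in> ?K" "j \<in> ?K" "l \<in> Uk k" "l \<in> Uk j" for k j l
    using UM[OF that(1,3), of "pp j"] U0(3)[OF that(2,4)] ppM ppeq that(1,2) by auto
  have d'_notin_Uk: "d' \<notin> Uk k" if "k \<in> ?K" for k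
    using U0(4)[OF that] ccd(1)[OF that] by blast
  have "\<forall>k. \<exists>R. k \<in> ?K \<longrightarrow> R \<subseteq> W \<times> Uk k \<and> (\<forall>x\<in>W. card {d. (x, d) \<in> R} = h) \<and> (\<forall>d\<in>Uk k. card {x. (x, d) \<in> R} = h)"
  proof (intro allI)
    fix k
    show "\<exists>R. k \<in> ?K \<longrightarrow> R \<subseteq> W \<times> Uk k \<and> (\<forall>x\<in>W. card {d. (x, d) \<in> R} = h) \<and> (\<forall>d\<in>Uk k. card {x. (x, d) \<in> R} = h)"
    proof (cases "k \<in> ?K")
      case True
      obtain R where "R \<subseteq> W \<times> Uk k" "\<And>x. x \<in> W \<Longrightarrow> card {d. (x, d) \<in> R} = h" "\<And>d. d \<in> Uk k \<Longrightarrow> card {x. (x, d) \<in> R} = h"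
        using regular_relation[OF W(1,2) finU[OF True] Uk(2)[OF True] N(1)] by blast
      then show ?thesis by blast
    qed blast
  qed
  then obtain R where R: "\<And>k. k \<in> ?K \<Longrightarrow> R k \<subseteq> W \<times> Uk k"
    "\<And>k x. k \<in> ?K \<Longrightarrow> x \<in> W \<Longrightarrow> card {d. (x, d) \<in> R k} = h"
    "\<And>k d. k \<in> ?K \<Longrightarrow> d \<in> Uk k \<Longrightarrow> card {x. (x, d) \<in> R k} = h" by metis
  \<comment> \<open>the heads of \<open>d'\<close>; leaving out \<open>cc 1\<close> keeps their edges to \<open>pp 0\<close> off the coned line\<close>
  define S where "S = cc ` {2..a}"
  have S: "S \<subseteq> d' - M - {cc 1}" "card S = a - 1" "finite S"
  proof -
    have "cc k \<in> d' - M - {cc 1}" if k: "k \<in> {2..a}" for k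
    proof -
      have kK: "k \<in> ?K" "1 \<in> ?K" "k \<noteq> 1" using k a(1) by auto
      have "cc k \<noteq> cc 1" using inj_on_eq_iff[OF cc(2) kK(1,2)] kK(3) by blast
      then show ?thesis using ccd[OF kK(1)] by blast
    qed
    then show "S \<subseteq> d' - M - {cc 1}" unfolding S_def by (rule image_subsetI)
    have "inj_on cc {2..a}" using cc(2) by (rule inj_on_subset) auto
    then show "card S = a - 1" "finite S" using a by (simp_all add: S_def card_image)
  qed
  have "card (d' - M - {cc 1}) = q - 1" using cd' ccd[of 1] a(1) by simp
  then have "card (d' - M - {cc 1} - S) = q - a" using S a by (simp add: card_Diff_subset)
  then have "h - (a - 1) \<le> card (d' - M - {cc 1} - S)" using q a by simp
  then obtain S' where S': "S' \<subseteq> d' - M - {cc 1} - S" "card S' = h - (a - 1)" "finite S'"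
    by (rule obtain_subset_with_card_n)
  define B' where "B' = S \<union> S'"
  have B': "B' \<subseteq> d' - M" "card B' = h" "cc 1 \<notin> B'"
  proof -
    show "B' \<subseteq> d' - M" "cc 1 \<notin> B'" using S S' by (auto simp: B'_def)
    have "card B' = card S + card S'" unfolding B'_def using S S' by (intro card_Un_disjoint) auto
    then show "card B' = h" using S S' a by simp
  qed
  \<comment> \<open>on a thin or upgraded line, the intersections with the lines related to it\<close>
  define heads where "heads l = (if l = d' then B' else
    {b \<in> l. \<exists>k\<in>?K. \<exists>x\<in>W. \<exists>d. (x, d) \<in> R k \<and> b \<in> d \<and> b \<in> L k x \<and> (l = d \<or> l = L k x)})" for l
  have d'L: "L k x \<noteq> d'" if "k \<in> ?K" "x \<in> W" for k x
    using d'M[of x] L(3)[OF that(1), of x] that(2) W(3) Wpp[OF a(1)] by blast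
  have LU: "L k x \<notin> Uk j" if "k \<in> ?K" "x \<in> W" "j \<in> ?K" for k x j
  proof
    assume "L k x \<in> Uk j"
    then have "x = pp j" using UM[OF that(3), of "L k x" x] L(3)[OF that(1), of x] that W by blast
    then show False using Wpp[of j] that by auto
  qed
  have heads_L: "heads (L k x) = {b \<in> L k x. \<exists>d. (x, d) \<in> R k \<and> b \<in> d}" if k: "k \<in> ?K" and x: "x \<in> W" for k x
  proof -
    have "L k x = d \<or> L k x = L j y \<longleftrightarrow> j = k \<and> y = x" if "j \<in> ?K" "y \<in> W" "(y, d) \<in> R j" for j y d
      using L_inj[OF k that(1) x that(2)] LU[OF k x that(1)] R(1)[OF that(1)] that by blast
    then have *: "j = k \<and> y = x" if "j \<in> ?K" "y \<in> W" "(y, d) \<in> R j" "L k x = d \<or> L k x = L j y" for j y d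
      using that by blast
    have "heads (L k x) = {b \<in> L k x. \<exists>j\<in>?K. \<exists>y\<in>W. \<exists>d. (y, d) \<in> R j \<and> b \<in> d \<and> b \<in> L j y \<and> (L k x = d \<or> L k x = L j y)}"
      using d'L[OF k x] by (simp add: heads_def)
    also have "\<dots> = {b \<in> L k x. \<exists>d. (x, d) \<in> R k \<and> b \<in> d}"
      using * k x by blast
    finally show ?thesis .
  qed
  have heads_U: "heads l = {b \<in> l. \<exists>x. (x, l) \<in> R k \<and> b \<in> L k x}" if k: "k \<in> ?K" and l: "l \<in> Uk k" for k l
  proof -
    have "l = d \<or> l = L j y \<longleftrightarrow> j = k \<and> l = d" if "j \<in> ?K" "y \<in> W" "(y, d) \<in> R j" for j y d
      using LU[OF that(1,2) k] l R(1)[OF that(1)] that Uk_unique[OF that(1) k, of l] by blast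
    then have *: "j = k \<and> l = d" if "j \<in> ?K" "y \<in> W" "(y, d) \<in> R j" "l = d \<or> l = L j y" for j y d
      using that by blast
    have "l \<noteq> d'" using d'_notin_Uk[OF k] l by blast
    then have "heads l = {b \<in> l. \<exists>j\<in>?K. \<exists>y\<in>W. \<exists>d. (y, d) \<in> R j \<and> b \<in> d \<and> b \<in> L j y \<and> (l = d \<or> l = L j y)}"
      by (simp add: heads_def)
    also have "\<dots> = {b \<in> l. \<exists>x. (x, l) \<in> R k \<and> b \<in> L k x}"
      using * k R(1)[OF k] by blast
    finally show ?thesis .
  qed
  have L_ne_U: "L k x \<noteq> l" if "k \<in> ?K" "x \<in> M" "l \<in> Uk k" for k x l
    using U0(4)[OF that(1,3)] L(2)[OF that(1,2)] by blast
  have card_heads_L: "card (heads (L k x)) = h" if k: "k \<in> ?K" and x: "x \<in> W" for k x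
  proof -
    have xM: "x \<in> M" using x W by blast
    have ppL: "pp k \<notin> L k x" using LM[OF k xM, of "pp k"] ppM[of k] Wpp[of k] x k by auto
    have jn: "join (pp k) b = d" if "b \<in> L k x" "(x, d) \<in> R k" "b \<in> d" for b d
    proof -
      have d: "d \<in> Uk k" using R(1)[OF k] that by blast
      have "pp k \<noteq> b" using ppL that by blast
      then show ?thesis using join_eq[OF U0(1)[OF k d] U0(3)[OF k d] that(3)] by simp
    qed
    have "bij_betw (join (pp k)) (heads (L k x)) {d. (x, d) \<in> R k}"
      unfolding bij_betw_def
    proof
      show "inj_on (join (pp k)) (heads (L k x))"
      proof (rule inj_onI)
        fix b b' assume "b \<in> heads (L k x)" "b' \<in> heads (L k x)" and eq: "join (pp k) b = join (pp k) b'"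
        then obtain d d' where d: "b \<in> L k x" "(x, d) \<in> R k" "b \<in> d" "b' \<in> L k x" "(x, d') \<in> R k" "b' \<in> d'"
          unfolding heads_L[OF k x] by blast
        then have "d = d'" using jn eq by metis
        moreover have "d \<in> Uk k" using R(1)[OF k] d by blast
        ultimately show "b = b'"
          using meet_unique[OF L(1)[OF k xM] U0(1)[OF k] L_ne_U[OF k xM]] d by metis
      qed
      show "join (pp k) ` heads (L k x) = {d. (x, d) \<in> R k}"
      proof
        show "join (pp k) ` heads (L k x) \<subseteq> {d. (x, d) \<in> R k}"
          unfolding heads_L[OF k x] using jn by auto
        show "{d. (x, d) \<in> R k} \<subseteq> join (pp k) ` heads (L k x)"
        proof
          fix d assume d: "d \<in> {d. (x, d) \<in> R k}"
          then have "d \<in> Uk k" using R(1)[OF k] by blast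
          then obtain b where b: "b \<in> L k x" "b \<in> d" using lines_meet[OF L(1)[OF k xM] U0(1)[OF k]] by blast
          then show "d \<in> join (pp k) ` heads (L k x)"
            using jn[of b d] d unfolding heads_L[OF k x] by (intro image_eqI[of _ _ b]) auto
        qed
      qed
    qed
    then show ?thesis using R(2)[OF k x] by (metis bij_betw_same_card)
  qed
  have card_heads_U: "card (heads l) = h" if k: "k \<in> ?K" and l: "l \<in> Uk k" for k l
  proof -
    define f where "f x = (SOME b. b \<in> l \<and> b \<in> L k x)" for x
    have f: "f x \<in> l \<and> f x \<in> L k x" if "x \<in> M" for x
      unfolding f_def using lines_meet[OF U0(1)[OF k l] L(1)[OF k that]] by (rule someI_ex)
    have fu: "b = f x" if "x \<in> M" "b \<in> l" "b \<in> L k x" for b x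
      using meet_unique[OF L(1)[OF k that(1)] U0(1)[OF k l] L_ne_U[OF k that(1) l] that(3,2)] f[OF that(1)] by blast
    have RX: "x \<in> W \<and> x \<in> M" if "(x, l) \<in> R k" for x using R(1)[OF k] that W by blast
    have "bij_betw f {x. (x, l) \<in> R k} (heads l)"
      unfolding bij_betw_def
    proof
      show "inj_on f {x. (x, l) \<in> R k}"
      proof (rule inj_onI)
        fix x y assume xy: "x \<in> {x. (x, l) \<in> R k}" "y \<in> {x. (x, l) \<in> R k}" "f x = f y"
        then have m: "x \<in> W" "y \<in> W" "x \<in> M" "y \<in> M" using RX by auto
        have "f x \<noteq> cc k" using f[OF m(3)] U0(4)[OF k l] by auto
        then have "L k x = L k y"
          using line_unique[OF L(1)[OF k m(3)] L(1)[OF k m(4)]] f[OF m(3)] f[OF m(4)] xy(3) L(2)[OF k] m by metis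
        then show "x = y" using L_inj[OF k k m(1,2)] by blast
      qed
      show "f ` {x. (x, l) \<in> R k} = heads l"
      proof
        show "f ` {x. (x, l) \<in> R k} \<subseteq> heads l" unfolding heads_U[OF k l] using f RX by blast
        show "heads l \<subseteq> f ` {x. (x, l) \<in> R k}" unfolding heads_U[OF k l] using fu RX by blast
      qed
    qed
    then show ?thesis using R(3)[OF k l] by (metis bij_betw_same_card)
  qed
  have heads_M: "b \<notin> M" if "k \<in> ?K" "x \<in> W" "b \<in> L k x" "(x, d) \<in> R k" "b \<in> d" for b k x d
  proof
    assume "b \<in> M"
    have "d \<in> Uk k" using R(1)[OF that(1)] that by blast
    then have "b = pp k" using UM that \<open>b \<in> M\<close> by blast
    moreover have "b = x" using LM[OF that(1) _ that(3) \<open>b \<in> M\<close>] that(2) W by blast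
    ultimately show False using Wpp[of k] that by auto
  qed
  have L_minus: "card (L k x - M) = q" "finite (L k x - M)" if "k \<in> ?K" "x \<in> W" for k x
  proof -
    have x: "x \<in> M" using that W by blast
    have "L k x - M = L k x - {x}" using LM[OF that(1) x] L(3)[OF that(1) x] x by blast
    then show "card (L k x - M) = q" "finite (L k x - M)"
      using card_line[OF L(1)[OF that(1) x]] finite_line[OF L(1)[OF that(1) x]] L(3)[OF that(1) x] by auto
  qed
  have heads_sub_L: "heads (L k x) \<subseteq> L k x - M" if "k \<in> ?K" "x \<in> W" for k x
    unfolding heads_L[OF that] using heads_M[OF that] by blast
  have "\<forall>l. \<exists>m. (\<exists>k\<in>?K. \<exists>x\<in>W. l = L k x) \<longrightarrow> bij_betw m (heads l) (l - M - heads l)"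
  proof (intro allI)
    fix l
    show "\<exists>m. (\<exists>k\<in>?K. \<exists>x\<in>W. l = L k x) \<longrightarrow> bij_betw m (heads l) (l - M - heads l)"
    proof (cases "\<exists>k\<in>?K. \<exists>x\<in>W. l = L k x")
      case True
      then obtain k x where kx: "k \<in> ?K" "x \<in> W" "l = L k x" by blast
      have fin: "finite (heads l)" "finite (l - M - heads l)"
        using heads_sub_L[OF kx(1,2)] L_minus(2)[OF kx(1,2)] kx(3) finite_subset by auto
      have "card (l - M - heads l) = card (heads l)"
        using heads_sub_L[OF kx(1,2)] L_minus(1)[OF kx(1,2)] card_heads_L[OF kx(1,2)] kx(3) fin q
        by (simp add: card_Diff_subset)
      then show ?thesis using finite_same_card_bij[OF fin] by metis
    qed blast
  qed
  then obtain mate where mate: "\<And>k x. k \<in> ?K \<Longrightarrow> x \<in> W \<Longrightarrow> bij_betw (mate (L k x)) (heads (L k x)) (L k x - M - heads (L k x))"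
    by metis
  define Thin where "Thin = {L k x | k x. k \<in> ?K \<and> x \<in> W}"
  define Up where "Up = insert d' (\<Union>k\<in>?K. Uk k)"
  define f0 where "f0 = L 1 (pp 0)"
  define kk where "kk l = (THE k. k \<in> ?K \<and> l \<in> Uk k)" for l
  have kk: "kk l = k" if "k \<in> ?K" "l \<in> Uk k" for k l
    unfolding kk_def using that Uk_unique by blast
  \<comment> \<open>the thin line through the head \<open>b\<close> of a line through \<open>pp k\<close> is the one joining \<open>b\<close> to \<open>cc k\<close>\<close>
  define spare where "spare l b = (if l = d' then (if b \<in> S then {b, pp (inv_into ?K cc b)} else {b, pp 0})
     else {b, mate (join (cc (kk l)) b) b})" for l b
  have p0: "pp 0 \<in> P" "pp 0 \<in> M" using ppM by (auto simp: P_def)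
  have f0: "f0 \<in> lines" "cc 1 \<in> f0" "pp 0 \<in> f0" "f0 \<noteq> M" using L[of 1 "pp 0"] a(1) p0 by (auto simp: f0_def)
  have f0M: "x = pp 0" if "x \<in> f0" "x \<in> M" for x
    using LM[of 1 "pp 0" x] that a(1) p0 by (auto simp: f0_def)
  have U_cases: thesis if "l \<in> Up" "l = d' \<Longrightarrow> thesis" "\<And>k. k \<in> ?K \<Longrightarrow> l \<in> Uk k \<Longrightarrow> thesis" for l thesis
    using that by (auto simp: Up_def)
  have spare_d': "\<exists>p. p \<in> P \<and> spare d' b = {b, p} \<and> (b \<in> S \<longrightarrow> (\<exists>k\<in>{2..a}. b = cc k \<and> p = pp k)) \<and> (b \<notin> S \<longrightarrow> p = pp 0)" for b
  proof (cases "b \<in> S")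
    case True
    then obtain k where k: "k \<in> {2..a}" "b = cc k" by (auto simp: S_def)
    then have "inv_into ?K cc b = k" using cc(2) by simp
    then show ?thesis using k True by (intro exI[of _ "pp k"]) (auto simp: spare_def P_def)
  next
    case False
    then show ?thesis using p0 by (auto simp: spare_def)
  qed
  have spare_U: "\<exists>x. x \<in> W \<and> (x, l) \<in> R k \<and> b \<in> L k x \<and> b \<in> heads (L k x) \<and> b \<in> l \<and> b \<notin> M \<and> spare l b = {b, mate (L k x) b}
      \<and> mate (L k x) b \<in> L k x - M - heads (L k x)"
    if k: "k \<in> ?K" and l: "l \<in> Uk k" and b: "b \<in> heads l" for k l b
  proof -
    obtain x where x: "(x, l) \<in> R k" "b \<in> L k x" "b \<in> l" using b unfolding heads_U[OF k l] by blast
    then have xX: "x \<in> W" "x \<in> M" using R(1)[OF k] W by auto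
    have "cc k \<noteq> b" using U0(4)[OF k l] x by blast
    then have "join (cc k) b = L k x" using join_eq[OF L(1,2)[OF k xX(2)] x(2)] by simp
    then have "spare l b = {b, mate (L k x) b}" using d'_notin_Uk[OF k] l kk[OF k l] by (auto simp: spare_def)
    moreover have bh: "b \<in> heads (L k x)" unfolding heads_L[OF k xX(1)] using x by blast
    moreover have "mate (L k x) b \<in> L k x - M - heads (L k x)" using mate[OF k xX(1)] bh by (auto simp: bij_betw_def)
    ultimately show ?thesis using x xX heads_M[OF k xX(1) x(2,1,3)] by blast
  qed
  have heads_d': "heads d' = B'" by (simp add: heads_def)
  have U_lines: "l \<in> lines" "l \<noteq> M" "l \<inter> P \<noteq> {}" "heads l \<subseteq> l - M" "card (heads l) = h" "pp 0 \<notin> l" if "l \<in> Up" for l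
  proof -
    have "l \<in> lines \<and> l \<noteq> M \<and> l \<inter> P \<noteq> {} \<and> heads l \<subseteq> l - M \<and> card (heads l) = h \<and> pp 0 \<notin> l"
      using that
    proof (rule U_cases)
      assume l: "l = d'"
      have "pp 1 \<in> P" using a(1) by (auto simp: P_def)
      moreover have "pp 0 \<notin> d'" using d'M[of "pp 0"] p0 ppeq[of 0 1] a(1) by auto
      ultimately show ?thesis using d' l B' heads_d' by auto
    next
      fix k assume k: "k \<in> ?K" "l \<in> Uk k"
      have "pp k \<in> P" using k by (auto simp: P_def)
      moreover have "pp 0 \<notin> l" using UM[OF k, of "pp 0"] p0 ppeq[of 0 k] k by auto
      moreover have "heads l \<subseteq> l - M" using spare_U[OF k] by blast
      ultimately show ?thesis using U0[OF k] card_heads_U[OF k] by blast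
    qed
    then show "l \<in> lines" "l \<noteq> M" "l \<inter> P \<noteq> {}" "heads l \<subseteq> l - M" "card (heads l) = h" "pp 0 \<notin> l" by auto
  qed
  have Gk: "{b. \<exists>l\<in>Up. b \<in> heads l \<and> spare l b = {b, pp k}} \<subseteq> (if k = 0 then S' else if k = 1 then {} else {cc k})"
    if k: "k \<le> a" for k
  proof
    fix b assume "b \<in> {b. \<exists>l\<in>Up. b \<in> heads l \<and> spare l b = {b, pp k}}"
    then obtain l where l: "l \<in> Up" "b \<in> heads l" "spare l b = {b, pp k}" by blast
    have bM: "b \<notin> M" using U_lines(4)[OF l(1)] l(2) by blast
    have "l = d'"
      using l(1)
    proof (rule U_cases)
      fix j assume j: "j \<in> ?K" "l \<in> Uk j"
      obtain x where "spare l b = {b, mate (L j x) b}" "mate (L j x) b \<notin> M" using spare_U[OF j l(2)] by blast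
      then have False using l(3) ppM[OF k] bM by (auto simp: doubleton_eq_iff)
      then show ?thesis ..
    qed
    obtain p where p: "p \<in> P" "spare d' b = {b, p}" "b \<in> S \<Longrightarrow> \<exists>k\<in>{2..a}. b = cc k \<and> p = pp k" "b \<notin> S \<Longrightarrow> p = pp 0"
      using spare_d'[of b] by blast
    have pk: "p = pp k" using p(2) l(3) \<open>l = d'\<close> ppM[OF k] bM by (auto simp: doubleton_eq_iff)
    show "b \<in> (if k = 0 then S' else if k = 1 then {} else {cc k})"
    proof (cases "b \<in> S")
      case True
      then obtain j where j: "j \<in> {2..a}" "b = cc j" "p = pp j" using p(3) by blast
      then have "j = k" using pk ppeq[of j k] k by auto
      then show ?thesis using j by auto
    next
      case False
      then have "k = 0" using pk p(4) ppeq[of k 0] k by auto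
      moreover have "b \<in> S'" using False l(2) \<open>l = d'\<close> heads_d' by (auto simp: B'_def)
      ultimately show ?thesis by simp
    qed
  qed
  have nst0: "card (star (pp 0) - {M} - Up - {f0}) = q - 1"
  proof -
    have "star (pp 0) - {M} - Up - {f0} = star (pp 0) - {M} - {f0}"
      using U_lines(6) by (auto simp: star_def)
    moreover have "f0 \<in> star (pp 0) - {M}" using f0 by (auto simp: star_def)
    ultimately show ?thesis using card_star_Diff[OF M p0(2)] by simp
  qed
  have nstk: "card (star (pp k) - {M} - Up - {f0}) = (if k = 1 then a - 1 else a)" if k: "k \<in> ?K" for k
  proof -
    have kM: "pp k \<in> M" using ppM k by simp
    have "f0 \<notin> star (pp k)" using f0M[of "pp k"] kM ppeq[of k 0] k by (auto simp: star_def)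
    moreover have "Uk j \<inter> star (pp k) = {}" if "j \<in> ?K" "j \<noteq> k" for j
    proof -
      have "pp k \<notin> l" if "l \<in> Uk j" for l
        using UM[OF \<open>j \<in> ?K\<close> that, of "pp k"] kM ppeq[of k j] k \<open>j \<in> ?K\<close> \<open>j \<noteq> k\<close> by auto
      then show ?thesis by (auto simp: star_def)
    qed
    moreover have "d' \<in> star (pp k) \<longleftrightarrow> k = 1" using d'M[of "pp k"] d' kM ppeq[of k 1] k a(1) by (auto simp: star_def)
    moreover have "star (pp k) \<inter> Up = star (pp k) \<inter> (if k = 1 then insert d' (Uk k) else Uk k)"
    proof (intro Set.set_eqI iffI)
      fix l assume l: "l \<in> star (pp k) \<inter> Up"
      then have "l \<in> Up" by blast
      then show "l \<in> star (pp k) \<inter> (if k = 1 then insert d' (Uk k) else Uk k)"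
      proof (rule U_cases)
        assume "l = d'"
        then show ?thesis using l calculation(3) by simp
      next
        fix j assume j: "j \<in> ?K" "l \<in> Uk j"
        then have "j = k" using l calculation(2)[of j] by blast
        then show ?thesis using l j by auto
      qed
    next
      fix l assume "l \<in> star (pp k) \<inter> (if k = 1 then insert d' (Uk k) else Uk k)"
      then have "l \<in> star (pp k) \<and> (l = d' \<or> l \<in> Uk k)" by (auto split: if_splits)
      then show "l \<in> star (pp k) \<inter> Up" using k unfolding Up_def by blast
    qed
    ultimately have eq: "star (pp k) - {M} - Up - {f0} = (star (pp k) - {M}) - (if k = 1 then insert d' (Uk k) else Uk k)"
      by blast
    have "Uk k \<subseteq> star (pp k) - {M}" using Uk(1)[OF k] by blast
    moreover have "d' \<in> star (pp 1) - {M}" using d' by (auto simp: star_def)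
    ultimately have sub: "(if k = 1 then insert d' (Uk k) else Uk k) \<subseteq> star (pp k) - {M}" by auto
    have "card (if k = 1 then insert d' (Uk k) else Uk k) = (if k = 1 then N + 1 else N)"
      using Uk(2)[OF k] d'_notin_Uk[OF k] finU[OF k] by auto
    then show ?thesis
      unfolding eq using sub finU[OF k] card_star_Diff[OF M kM] N(3) by (subst card_Diff_subset) auto
  qed
  interpret pencil_scheme pts lines q h a M P Out "pp 0" Thin Up "{f0}" heads mate spare
  proof
    show "q = 2 * h" "0 < h" by fact+
    show "a < q" using q a by simp
    show "M \<in> lines" "P \<subseteq> M" "card P = Suc a" "pp 0 \<in> P" "finite Out" "Out \<inter> pts = {}" "card Out + a = q"
      using M P p0 Out by auto
    show "l \<in> lines" if "l \<in> Thin" for l using that L(1) W by (auto simp: Thin_def)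
    show "l \<inter> P = {}" if lD: "l \<in> Thin" for l
    proof -
      obtain k x where kx: "k \<in> ?K" "x \<in> W" "l = L k x" using lD unfolding Thin_def by blast
      have "y \<notin> P" if "y \<in> l" for y using LM[OF kx(1), of x y] kx that P W by (auto simp: W_def)
      then show ?thesis by blast
    qed
    show "heads l \<subseteq> l - M" if "l \<in> Thin" for l using that heads_sub_L by (auto simp: Thin_def)
    show "card (heads l) = h" if "l \<in> Thin" for l using that card_heads_L by (auto simp: Thin_def)
    show "bij_betw (mate l) (heads l) (l - M - heads l)" if "l \<in> Thin" for l using that mate by (auto simp: Thin_def)
    show "card (star x \<inter> Thin) = a" if "x \<in> M - P" for x
    proof -
      have x: "x \<in> W" using that by (simp add: W_def)
      have "star x \<inter> Thin = (\<lambda>k. L k x) ` ?K"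
      proof
        show "star x \<inter> Thin \<subseteq> (\<lambda>k. L k x) ` ?K"
        proof
          fix l assume l: "l \<in> star x \<inter> Thin"
          then obtain k y where ky: "k \<in> ?K" "y \<in> W" "l = L k y" by (auto simp: Thin_def)
          then have "x = y" using LM[OF ky(1), of y x] l that W by (auto simp: star_def)
          then show "l \<in> (\<lambda>k. L k x) ` ?K" using ky by blast
        qed
        show "(\<lambda>k. L k x) ` ?K \<subseteq> star x \<inter> Thin" using L(1,3) that x unfolding star_def Thin_def by blast
      qed
      moreover have "inj_on (\<lambda>k. L k x) ?K" using L_inj x by (auto simp: inj_on_def)
      ultimately show ?thesis by (simp add: card_image)
    qed
    show "{f0} \<subseteq> star (pp 0) - {M}" using f0 by (auto simp: star_def)
    show "Up \<inter> {f0} = {}" using U_lines(6) f0 by auto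
    show "(\<exists>k\<in>Thin. b \<in> heads k \<and> spare l b = {b, mate k b}) \<or> (\<exists>p\<in>P. spare l b = {b, p} \<and> join b p \<notin> Up \<union> {f0})"
      if lb: "l \<in> Up" "b \<in> heads l" for l b
      using lb(1)
    proof (rule U_cases)
      fix k assume k: "k \<in> ?K" "l \<in> Uk k"
      then obtain x where "x \<in> W" "b \<in> heads (L k x)" "spare l b = {b, mate (L k x) b}" using spare_U[OF k lb(2)] by blast
      then show ?thesis using k by (auto simp: Thin_def)
    next
      assume l: "l = d'"
      then have bB: "b \<in> B'" using lb heads_d' by simp
      then have bd: "b \<in> d'" "b \<notin> M" "b \<noteq> cc 1" "b \<in> pts" using B' line_subset[OF d'(1)] by auto
      obtain p where p: "p \<in> P" "spare d' b = {b, p}" "b \<in> S \<Longrightarrow> \<exists>k\<in>{2..a}. b = cc k \<and> p = pp k" "b \<notin> S \<Longrightarrow> p = pp 0"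
        using spare_d'[of b] by blast
      have pM: "p \<in> M" "p \<in> pts" "b \<noteq> p" using p P Mpts bd by auto
      note j = join[OF bd(4) pM(2,3)]
      have jM: "join b p \<noteq> M" using j bd by blast
      have jMp: "y = p" if "y \<in> join b p" "y \<in> M" for y using meet_unique[OF j(1) M jM that j(3) pM(1)] .
      have "join b p \<notin> Up \<union> {f0}"
      proof (cases "b \<in> S")
        case True
        then obtain k where k: "k \<in> {2..a}" "b = cc k" "p = pp k" using p(3) by blast
        have kK: "k \<in> ?K" using k by auto
        have "join b p = L k (pp k)" using k by (simp add: L_def)
        then have nk: "join b p \<notin> Uk k" using Uk(1)[OF kK] by blast
        have "join b p \<notin> Uk i" if "i \<in> ?K" "i \<noteq> k" for i
          using jMp[of "pp i"] U0(3)[OF that(1), of "join b p"] ppM[of i] ppeq[of i k] that k by auto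
        moreover have "join b p \<noteq> d'" using jMp[of "pp 1"] d'(3) ppM[OF a(1)] ppeq[of 1 k] k by auto
        moreover have "join b p \<noteq> f0" using jMp[of "pp 0"] f0(3) p0 ppeq[of 0 k] k by auto
        ultimately show ?thesis using nk unfolding Up_def by blast
      next
        case False
        then have p0': "p = pp 0" using p(4) by blast
        then have "join b p \<notin> Up" using U_lines(6)[of "join b p"] j(3) by blast
        moreover have "join b p \<noteq> f0"
        proof
          assume "join b p = f0"
          then have "f0 = d'" using line_unique[OF f0(1) d'(1) bd(3)] j(2) f0(2) bd(1) ccd(1)[of 1] a(1) by auto
          then show False using f0(3) U_lines(6)[of d'] by (auto simp: Up_def)
        qed
        ultimately show ?thesis by blast
      qed
      then show ?thesis using p l by blast
    qed
    show "l = l' \<and> b = b'"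
      if h: "l \<in> Up" "b \<in> heads l" "l' \<in> Up" "b' \<in> heads l'" "spare l b = spare l' b'" for l b l' b'
    proof -
      have bM: "b \<notin> M" "b' \<notin> M" using U_lines(4) h by blast+
      have meetM: "(spare d' c \<inter> M \<noteq> {})" for c using spare_d'[of c] P by auto
      have avoidM: "spare m c \<inter> M = {}" if "k \<in> ?K" "m \<in> Uk k" "c \<in> heads m" for k m c
        using spare_U[OF that] by auto
      show ?thesis
        using h(1)
      proof (rule U_cases)
        assume l: "l = d'"
        show ?thesis
          using h(3)
        proof (rule U_cases)
          assume l': "l' = d'"
          obtain p p' where "p \<in> P" "spare d' b = {b, p}" "p' \<in> P" "spare d' b' = {b', p'}" using spare_d' by blast
          then have "b = b'" using h(5) l l' bM P by (auto simp: doubleton_eq_iff)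
          then show ?thesis using l l' by simp
        next
          fix j assume "j \<in> ?K" "l' \<in> Uk j"
          then show ?thesis using meetM[of b] avoidM[of j l' b'] h l by auto
        qed
      next
        fix k assume k: "k \<in> ?K" "l \<in> Uk k"
        show ?thesis
          using h(3)
        proof (rule U_cases)
          assume "l' = d'"
          then show ?thesis using meetM[of b'] avoidM[OF k h(2)] h by auto
        next
          fix j assume j: "j \<in> ?K" "l' \<in> Uk j"
          obtain x where x: "x \<in> W" "b \<in> L k x" "b \<in> heads (L k x)" "b \<in> l" "spare l b = {b, mate (L k x) b}"
            "mate (L k x) b \<in> L k x - M - heads (L k x)" using spare_U[OF k h(2)] by blast
          obtain y where y: "y \<in> W" "b' \<in> L j y" "b' \<in> heads (L j y)" "b' \<in> l'" "spare l' b' = {b', mate (L j y) b'}"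
            "mate (L j y) b' \<in> L j y - M - heads (L j y)" using spare_U[OF j h(4)] by blast
          have eq: "{b, mate (L k x) b} = {b', mate (L j y) b'}" using x y h by simp
          have xy: "x \<in> M" "y \<in> M" using x y W by auto
          have "b \<noteq> mate (L k x) b" using x by auto
          then have "L k x = L j y"
            using line_unique[OF L(1)[OF k(1) xy(1)] L(1)[OF j(1) xy(2)], of b "mate (L k x) b"] eq x y
            by (auto simp: doubleton_eq_iff)
          then have kj: "k = j" "x = y" using L_inj[OF k(1) j(1) x(1) y(1)] by auto
          have "b = b'" using eq x y kj by (auto simp: doubleton_eq_iff)
          moreover have "pp k \<noteq> b" using bM ppM[of k] k(1) by auto
          ultimately have "l = l'"
            using line_unique[OF U0(1)[OF k] U0(1)[OF j]] U0(3)[OF k] U0(3)[OF j] kj x(4) y(4) by metis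
          then show ?thesis using \<open>b = b'\<close> by blast
        qed
      qed
    qed
    show "card {b. \<exists>l\<in>Up. b \<in> heads l \<and> spare l b = {b, p}} + (a - 1) \<le> card (star p - {M} - Up - {f0})"
      if p: "p \<in> P" "p \<noteq> pp 0" for p
    proof -
      obtain k where k: "k \<le> a" "p = pp k" using p by (auto simp: P_def)
      then have kK: "k \<in> ?K" using p by (cases k) auto
      have "card {b. \<exists>l\<in>Up. b \<in> heads l \<and> spare l b = {b, p}} \<le> (if k = 1 then 0 else 1)"
        using card_mono[OF _ Gk[OF k(1)]] k kK by auto
      then show ?thesis using nstk[OF kK] k a by (auto split: if_splits)
    qed
    show "card {b. \<exists>l\<in>Up. b \<in> heads l \<and> spare l b = {b, pp 0}} + h * card {f0} + (q - 2)
        \<le> card (star (pp 0) - {M} - Up - {f0}) + card Out"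
    proof -
      have "card {b. \<exists>l\<in>Up. b \<in> heads l \<and> spare l b = {b, pp 0}} \<le> h - (a - 1)"
        using card_mono[OF _ Gk[of 0]] S' by auto
      then show ?thesis unfolding nst0 using q a Out(3) by simp
    qed
    show "(\<Sum>p\<in>P. card (star p - {M} - Up - {f0})) + 2 = q + a\<^sup>2"
    proof -
      have "(\<Sum>p\<in>P. card (star p - {M} - Up - {f0})) = (\<Sum>k\<le>a. card (star (pp k) - {M} - Up - {f0}))"
        unfolding P_def using pp(2) by (simp add: sum.reindex)
      also have "{..a} = insert 0 (insert 1 {2..a})" using a(1) by auto
      also have "(\<Sum>k\<in>insert 0 (insert 1 {2..a}). card (star (pp k) - {M} - Up - {f0}))
          = (q - 1) + ((a - 1) + (\<Sum>k\<in>{2..a}. card (star (pp k) - {M} - Up - {f0})))"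
        using nst0 nstk[of 1] a(1) by simp
      also have "(\<Sum>k\<in>{2..a}. card (star (pp k) - {M} - Up - {f0})) = (\<Sum>k\<in>{2..a}. a)"
        using nstk by (intro sum.cong) auto
      finally have "(\<Sum>p\<in>P. card (star p - {M} - Up - {f0})) = (q - 1) + ((a - 1) + (a - 1) * a)" by simp
      moreover obtain a' where "a = Suc a'" using a(1) by (cases a) auto
      ultimately show ?thesis using q a by (simp add: power2_eq_square)
    qed
  qed (fact U_lines(1-5))+
  show ?thesis by (rule psi_lower)
qed

text \<open>
  The classes inside \<open>Out\<close> are the perfect matchings of \<open>Out - {o0}\<close>, each completed by an edge at \<open>o0\<close>.
  They touch all outer vertices, and every class on a line touches at least one.
\<close>

lemma psi_lower_minus:
  assumes q: "even q" "q > 0" and Out: "finite Out" "Out \<inter> pts = {}" "card Out = q + 1"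
  shows "q * ((q + 1)\<^sup>2 + 2) \<le> psi ((q + 1)\<^sup>2 + 1)"
proof -
  let ?verts = "pts \<union> Out"
  obtain o0 where o0: "o0 \<in> Out" using Out by fastforce
  have cO: "card (Out - {o0}) = q" using Out o0 by simp
  then obtain z where z: "z \<in> Out - {o0}" using q by (metis card.empty ex_in_conv not_gr0)
  obtain c where c: "\<And>v w. v \<in> Out - {o0} - {z} \<Longrightarrow> w \<in> Out - {o0} \<Longrightarrow> \<exists>u \<in> Out - {o0}. u \<noteq> w \<and> c {w, u} = v"
    using factorization[OF _ _ z] cO q Out by (metis finite_Diff)
  have "\<forall>l. \<exists>d. l \<in> lines \<longrightarrow> (\<forall>v\<in>l. \<forall>w\<in>l. v \<noteq> w \<longrightarrow> (\<exists>u \<in> l. u \<noteq> w \<and> d {w, u} = v))"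
  proof (intro allI)
    fix l
    show "\<exists>d. l \<in> lines \<longrightarrow> (\<forall>v\<in>l. \<forall>w\<in>l. v \<noteq> w \<longrightarrow> (\<exists>u \<in> l. u \<noteq> w \<and> d {w, u} = v))"
    proof (cases "l \<in> lines")
      case True
      have "odd (card l)" using card_line[OF True] q by simp
      then obtain d where "\<And>v w. v \<in> l \<Longrightarrow> w \<in> l \<Longrightarrow> v \<noteq> w \<Longrightarrow> \<exists>u \<in> l. u \<noteq> w \<and> d {w, u} = v"
        using near_factorization[OF finite_line[OF True]] by blast
      then show ?thesis by blast
    qed blast
  qed
  then obtain d where d: "\<And>l v w. l \<in> lines \<Longrightarrow> v \<in> l \<Longrightarrow> w \<in> l \<Longrightarrow> v \<noteq> w \<Longrightarrow> \<exists>u \<in> l. u \<noteq> w \<and> d l {w, u} = v"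
    by metis
  define base where "base e =
      (if e \<subseteq> Out - {o0} then Some (Out, c e)
       else if e \<subseteq> pts then let l = (SOME l. l \<in> lines \<and> e \<subseteq> l) in Some (l, d l e) else None)" for e
  define labels where "labels = Sigma lines (\<lambda>l. l) \<union> Pair Out ` (Out - {o0} - {z})"
  define demand where "demand v = (if v = o0 then Pair Out ` (Out - {o0} - {z}) else (\<lambda>l. (l, v)) ` star v)" for v
  define offer where "offer v = (if v = o0 then (\<lambda>y. {v, y}) ` (Out - {o0}) else (\<lambda>y. {v, y}) ` Out)" for v
  have on: "y \<notin> pts" if "y \<in> Out" for y using that Out by blast
  have base_line: "base {w, u} = Some (l, d l {w, u})" if "l \<in> lines" "w \<in> l" "u \<in> l" "u \<noteq> w" for l w u
  proof -
    have some: "(SOME k. k \<in> lines \<and> {w, u} \<subseteq> k) = l"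
    proof (rule some_equality)
      show "l \<in> lines \<and> {w, u} \<subseteq> l" using that by simp
      show "k = l" if k: "k \<in> lines \<and> {w, u} \<subseteq> k" for k
        using line_unique[OF _ \<open>l \<in> lines\<close> \<open>u \<noteq> w\<close>, of k] k \<open>w \<in> l\<close> \<open>u \<in> l\<close> by simp
    qed
    have "w \<in> pts" "u \<in> pts" using that line_subset by blast+
    then have "{w, u} \<subseteq> pts" "\<not> {w, u} \<subseteq> Out - {o0}" using on by auto
    then show ?thesis by (simp only: base_def some Let_def if_True if_False simp_thms)
  qed
  have base_out: "base {w, u} = Some (Out, c {w, u})" if "w \<in> Out - {o0}" "u \<in> Out - {o0}" for w u
  proof -
    have "{w, u} \<subseteq> Out - {o0}" using that by simp
    then show ?thesis by (simp only: base_def if_True)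
  qed
  have inj: "card ((\<lambda>y. {v, y}) ` A) = card A" for v :: 'p and A
    by (rule card_image) (auto simp: inj_on_def doubleton_eq_iff)
  have None: "base e = None" if vI: "v \<in> insert o0 pts" and eF: "e \<in> offer v" for v e
  proof -
    obtain y where e: "e = {v, y}" "y \<in> Out" "v = o0 \<longrightarrow> y \<noteq> o0" 
    proof (cases "v = o0")
      case True
      then have "e \<in> (\<lambda>y. {v, y}) ` (Out - {o0})" using eF by (simp add: offer_def)
      then show thesis using that by blast
    next
      case False
      then have "e \<in> (\<lambda>y. {v, y}) ` Out" using eF by (simp add: offer_def)
      then show thesis using that False by blast
    qed
    have "\<not> e \<subseteq> pts" using e on by blast
    moreover have "\<not> e \<subseteq> Out - {o0}" using e vI on by auto
    ultimately show ?thesis by (simp only: base_def if_False)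
  qed
  obtain cl where cl: "\<And>e t. base e = Some t \<Longrightarrow> cl e = Some t"
    "\<And>v t. v \<in> insert o0 pts \<Longrightarrow> t \<in> demand v \<Longrightarrow> \<exists>e \<in> offer v. cl e = Some t"
  proof (rule extend_by_tokens[of "insert o0 pts" demand offer base])
    fix v assume v: "v \<in> insert o0 pts"
    show "finite (demand v) \<and> finite (offer v)" using Out finite_star by (simp add: demand_def offer_def)
    show "card (demand v) \<le> card (offer v)"
    proof (cases "v = o0")
      case True
      have "card (demand v) = card (Out - {o0} - {z})" using True by (simp add: demand_def card_image inj_on_def)
      also have "\<dots> \<le> card (Out - {o0})" using Out by (intro card_mono) auto
      finally show ?thesis using True by (simp add: offer_def inj)
    next
      case False
      have "card (demand v) = card (star v)" using False by (simp add: demand_def card_image inj_on_def)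
      then show ?thesis using False v card_star[of v] Out by (simp add: offer_def inj)
    qed
  next
    fix v e assume "v \<in> insert o0 pts" "e \<in> offer v"
    then show "base e = None" by (rule None)
  next
    fix v w assume "v \<in> insert o0 pts" "w \<in> insert o0 pts" "v \<noteq> w"
    then show "offer v \<inter> offer w = {}" using on o0 by (auto simp: offer_def doubleton_eq_iff split: if_splits)
  qed blast
  have line_cover: "touches cl ?verts (l, v) w" if l: "l \<in> lines" "v \<in> l" "w \<in> l" for l v w
  proof (cases "v = w")
    case False
    then obtain u where u: "u \<in> l" "u \<noteq> w" "d l {w, u} = v" using d l by blast
    then have "cl {w, u} = Some (l, v)" using cl(1) base_line[OF l(1,3) u(1,2)] by simp
    then show ?thesis using u l line_subset[OF l(1)] by (auto simp: touches_def)
  next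
    case True
    have v: "v \<in> pts" "v \<noteq> o0" using l line_subset on[OF o0] by auto
    then have "(l, v) \<in> demand v" using l by (auto simp: demand_def star_def)
    then obtain y where y: "y \<in> Out" "cl {v, y} = Some (l, v)" using cl(2)[of v] v by (auto simp: offer_def)
    then have "y \<noteq> v" using on v by blast
    then show ?thesis using v y True by (auto simp: touches_def)
  qed
  have line_out: "\<exists>y \<in> Out. touches cl ?verts (l, v) y" if l: "l \<in> lines" "v \<in> l" for l v
  proof -
    have v: "v \<in> pts" "v \<noteq> o0" using l line_subset on[OF o0] by auto
    then have "(l, v) \<in> demand v" using l by (auto simp: demand_def star_def)
    then obtain y where y: "y \<in> Out" "cl {v, y} = Some (l, v)" using cl(2)[of v] v by (auto simp: offer_def)
    then have "cl {y, v} = Some (l, v)" "v \<noteq> y" using on v by (auto simp: insert_commute)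
    then show ?thesis using y v by (intro bexI[of _ y]) (auto simp: touches_def)
  qed
  have out_cover: "touches cl ?verts (Out, v) w" if v: "v \<in> Out - {o0} - {z}" and w: "w \<in> Out" for v w
  proof (cases "w = o0")
    case False
    then obtain u where u: "u \<in> Out - {o0}" "u \<noteq> w" "c {w, u} = v" using c[OF v] w by blast
    then have "cl {w, u} = Some (Out, v)" using cl(1) base_out[of w u] w False by simp
    then show ?thesis using u w by (auto simp: touches_def)
  next
    case True
    have "(Out, v) \<in> demand o0" using v by (simp add: demand_def)
    then obtain y where "y \<in> Out - {o0}" "cl {o0, y} = Some (Out, v)" using cl(2)[of o0] by (auto simp: offer_def)
    then show ?thesis using True o0 by (auto simp: touches_def)
  qed
  have "card labels \<le> psi (card ?verts)"
  proof (rule card_le_psi_of_meeting_labels[of ?verts labels cl])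
    show "finite ?verts" using finite_pts Out by simp
    fix t t' assume tt: "t \<in> labels" "t' \<in> labels"
    have kinds: "(\<exists>l v. t = (l, v) \<and> l \<in> lines \<and> v \<in> l) \<or> (\<exists>v \<in> Out - {o0} - {z}. t = (Out, v))" if "t \<in> labels" for t
      using that by (auto simp: labels_def)
    have mixed: "\<exists>x. touches cl ?verts (l, v) x \<and> touches cl ?verts (Out, w) x"
      if "l \<in> lines" "v \<in> l" "w \<in> Out - {o0} - {z}" for l v w
      using line_out[OF that(1,2)] out_cover[OF that(3)] by blast
    from kinds[OF tt(1)] kinds[OF tt(2)] show "\<exists>x. touches cl ?verts t x \<and> touches cl ?verts t' x"
    proof (elim disjE exE conjE bexE)
      fix l v l' v' assume "t = (l, v)" "l \<in> lines" "v \<in> l" "t' = (l', v')" "l' \<in> lines" "v' \<in> l'"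
      moreover from this obtain x where "x \<in> l" "x \<in> l'" using lines_meet by blast
      ultimately show ?thesis using line_cover by blast
    next
      fix v v' assume "t = (Out, v)" "v \<in> Out - {o0} - {z}" "t' = (Out, v')" "v' \<in> Out - {o0} - {z}"
      then show ?thesis using out_cover o0 by blast
    qed (use mixed in blast)+
  qed
  moreover have "card ?verts = (q + 1)\<^sup>2 + 1"
    using finite_pts Out card_pts by (subst card_Un_disjoint) (auto simp: power2_eq_square)
  moreover have "card labels = q * ((q + 1)\<^sup>2 + 2)"
  proof -
    have "Out \<notin> lines" using o0 on line_subset by blast
    then have "card labels = card (Sigma lines (\<lambda>l. l)) + card (Pair Out ` (Out - {o0} - {z}))"
      unfolding labels_def using finite_lines finite_line Out by (intro card_Un_disjoint finite_SigmaI) auto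
    also have "card (Sigma lines (\<lambda>l. l)) = (\<Sum>l\<in>lines. card l)"
      using finite_lines finite_line by (intro card_SigmaI) auto
    also have "\<dots> = (q\<^sup>2 + q + 1) * (q + 1)"
      using card_line card_lines by simp
    also have "card (Pair Out ` (Out - {o0} - {z})) = q - 1"
      using z o0 Out by (simp add: card_image inj_on_def)
    finally have *: "card labels = (q\<^sup>2 + q + 1) * (q + 1) + (q - 1)" .
    obtain r where "q = Suc r" using q(2) by (cases q) auto
    then show ?thesis unfolding * by (simp add: power2_eq_square algebra_simps)
  qed
  ultimately show ?thesis by simp
qed

end

section \<open>The pseudoachromatic number\<close>

text \<open>
  It contains a field of order \<open>2 ^ k\<close> for every \<open>k > 0\<close>.
\<close>

lemma infinite_closure_of_bit: "infinite (UNIV :: bit alg_closure set)"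
proof
  assume fin: "finite (UNIV :: bit alg_closure set)"
  let ?N = "Suc (card (UNIV :: bit alg_closure set))"
  show False
  proof (rule finite_field_of_order_2_power[of ?N])
    fix F :: "bit alg_closure set"
    assume "card F = 2 ^ ?N"
    moreover have "card F \<le> card (UNIV :: bit alg_closure set)"
      using fin by (intro card_mono) auto
    moreover have "?N < 2 ^ ?N" by (rule less_exp)
    ultimately show False by linarith
  qed simp
qed

text \<open>
  As the coordinates come from an infinite type, there is always room for outer vertices of the
  same type.
\<close>

lemma plane_of_order_2_power:
  assumes k: "k > 0"
  obtains pts :: "((bit alg_closure \<times> bit alg_closure) + bit alg_closure option) set" and lines
  where "projective_plane pts lines (2 ^ k)"
    "\<And>N. \<exists>Out. finite Out \<and> Out \<inter> pts = {} \<and> card Out = N"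
proof (rule finite_field_of_order_2_power[OF k])
  fix F :: "bit alg_closure set"
  assume F: "card F = 2 ^ k" "0 \<in> F" "1 \<in> F"
    and closed: "\<And>x y. x \<in> F \<Longrightarrow> y \<in> F \<Longrightarrow> x - y \<in> F"
    "\<And>x y. x \<in> F \<Longrightarrow> y \<in> F \<Longrightarrow> x * y \<in> F" "\<And>x y. x \<in> F \<Longrightarrow> y \<in> F \<Longrightarrow> x / y \<in> F"
  have "finite F" by (rule card_ge_0_finite) (simp add: F)
  then obtain pts :: "((bit alg_closure \<times> bit alg_closure) + bit alg_closure option) set" and lines
    where plane: "projective_plane pts lines (2 ^ k)"
    using projective_plane_over_field[of F] F closed by auto
  have "inj (\<lambda>x :: bit alg_closure. Inl (x, x) :: (bit alg_closure \<times> bit alg_closure) + bit alg_closure option)"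
    by (simp add: inj_on_def)
  then have "infinite (UNIV :: ((bit alg_closure \<times> bit alg_closure) + bit alg_closure option) set)"
    using infinite_closure_of_bit by (meson finite_imageD finite_subset subset_UNIV)
  moreover have "finite pts" using plane by (simp add: projective_plane_def)
  ultimately have inf: "infinite (- pts)" by (simp add: Compl_eq_Diff_UNIV)
  have "\<exists>Out. finite Out \<and> Out \<inter> pts = {} \<and> card Out = N" for N
    using infinite_arbitrarily_large[OF inf, of N] by auto
  with plane show thesis by (rule that)
qed

theorem theorem3:
  fixes q n k m :: nat and a :: int
  assumes "q = 2 ^ k" and "q > 4"
    and "n = q\<^sup>2 + q + 1"
    and "a \<in> {-1..\<lceil>(1 + sqrt (4 * real q + 9)) / 2\<rceil> - 1}"
    and "int m = int n + int q - a"
  shows "int (psi m) = (int m - a) * int q"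
proof -
  have k: "k > 2"
  proof (rule ccontr)
    assume "\<not> k > 2"
    then have "(2 :: nat) ^ k \<le> 2 ^ 2" by (intro power_increasing) auto
    then show False using assms(1,2) by simp
  qed
  define h :: nat where "h = 2 ^ (k - 1)"
  have q: "q = 2 * h" "h > 0" "h \<ge> 4" 
  proof -
    show "q = 2 * h" using k assms(1) by (cases k) (simp_all add: h_def)
    show "h > 0" by (simp add: h_def)
    have "(2 :: nat) ^ 2 \<le> 2 ^ (k - 1)" using k by (intro power_increasing) auto
    then show "h \<ge> 4" by (simp add: h_def)
  qed
  have m: "int m = (int q + 1)\<^sup>2 - a"
    using assms(3,5) by (simp add: power2_eq_square algebra_simps)
  have a_ge: "a \<ge> -1" using assms(4) by simp
  \<comment> \<open>the upper end of the range of \<open>a\<close> enters only here\<close>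
  have a_quad: "a * (a - 1) < int q + 2"
  proof (cases "a \<ge> 1")
    case True
    have "a < \<lceil>(1 + sqrt (4 * real q + 9)) / 2\<rceil>" using assms(4) by simp
    then have "real_of_int a < (1 + sqrt (4 * real q + 9)) / 2" by (simp add: less_ceiling_iff)
    then have lt: "2 * real_of_int a - 1 < sqrt (4 * real q + 9)" by simp
    have "(2 * real_of_int a - 1)\<^sup>2 < (sqrt (4 * real q + 9))\<^sup>2"
      using lt True by (intro power_strict_mono) auto
    then have "real_of_int (a * (a - 1)) < real_of_int (int q + 2)"
      by (simp add: power2_eq_square algebra_simps)
    then show ?thesis by (simp only: of_int_less_iff)
  next
    case False
    then have "a = -1 \<or> a = 0" using a_ge by auto
    then show ?thesis using assms(2) by auto
  qed
  have a_le: "a \<le> int h"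
  proof (rule ccontr)
    assume "\<not> a \<le> int h"
    then have "(int h + 1) * int h \<le> a * (a - 1)" by (intro mult_mono) auto
    moreover have "4 * int h \<le> int h * int h" using q by (intro mult_right_mono) auto
    ultimately have "5 * int h < int q + 2" using a_quad by (simp add: algebra_simps)
    then show False using q by simp
  qed
  have upper: "int (psi m) \<le> (int m - a) * int q"
    by (rule psi_upper[OF q(1,2) m a_quad a_le])
  show ?thesis
  proof (rule plane_of_order_2_power[of k])
    show "k > 0" using k by simp
    fix pts :: "((bit alg_closure \<times> bit alg_closure) + bit alg_closure option) set" and lines
    assume plane: "projective_plane pts lines (2 ^ k)"
      and Out_ex: "\<And>N. \<exists>Out. finite Out \<and> Out \<inter> pts = {} \<and> card Out = N"
    interpret projective_plane pts lines q
      using plane unfolding assms(1) .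
    consider "a = -1" | "a = 0" | "a \<ge> 1" using a_ge by linarith
    then have "(int m - a) * int q \<le> int (psi m)"
    proof cases
      case 1
      obtain Out where Out: "finite Out" "Out \<inter> pts = {}" "card Out = q + 1" using Out_ex by blast
      have "int m = int ((q + 1)\<^sup>2 + 1)" using m 1 by simp
      then have m': "m = (q + 1)\<^sup>2 + 1" by (rule of_nat_eq_iff[THEN iffD1])
      have "q * ((q + 1)\<^sup>2 + 2) \<le> psi m"
        unfolding m' using psi_lower_minus[OF _ _ Out] q by simp
      then have "int (q * ((q + 1)\<^sup>2 + 2)) \<le> int (psi m)" by (rule of_nat_mono)
      then show ?thesis using m 1 by (simp add: algebra_simps)
    next
      case 2
      obtain Out where Out: "finite Out" "Out \<inter> pts = {}" "card Out = q" using Out_ex by blast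
      have "int m = int ((q + 1)\<^sup>2)" using m 2 by simp
      then have m': "m = (q + 1)\<^sup>2" by (rule of_nat_eq_iff[THEN iffD1])
      have "q * (q + 1)\<^sup>2 \<le> psi m"
        unfolding m' by (rule psi_lower_0[OF q(1,2) Out])
      then have "int (q * (q + 1)\<^sup>2) \<le> int (psi m)" by (rule of_nat_mono)
      then show ?thesis using m 2 by (simp add: algebra_simps)
    next
      case 3
      define b where "b = nat a"
      have b: "int b = a" "1 \<le> b" "b \<le> h" using 3 a_le by (auto simp: b_def)
      obtain Out where Out: "finite Out" "Out \<inter> pts = {}" "card Out = q - b" using Out_ex by blast
      have "card Out + b = q" using Out(3) b q by simp
      note lower = psi_lower_pos[OF q(1,2) b(2,3) Out(1,2) this]
      have "int (m + b) = int ((q + 1)\<^sup>2)" using m b(1) by simp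
      then have "m + b = (q + 1)\<^sup>2" by (rule of_nat_eq_iff[THEN iffD1])
      then have m': "m = (q + 1)\<^sup>2 - b" by simp
      have "q * (q + 1)\<^sup>2 \<le> psi m + 2 * b * q"
        using lower unfolding m' by simp
      then have "int (q * (q + 1)\<^sup>2) \<le> int (psi m + 2 * b * q)" by (rule of_nat_mono)
      then have "int q * (int q + 1)\<^sup>2 \<le> int (psi m) + 2 * a * int q"
        using b(1) by (simp add: ac_simps)
      moreover have "(int m - a) * int q = int q * (int q + 1)\<^sup>2 - 2 * a * int q"
        unfolding m by (simp add: algebra_simps)
      ultimately show ?thesis by linarith
    qed
    with upper show ?thesis by simp
  qed
qed

end
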